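(* Let $n\geq 4$. (i) If $n\leq 7$, then $E(\mathcal{P}_e(A_n))=E(\Delta_D(A_n))\subsetneq E(\Delta(A_n))$. (ii) If $n\geq 8$, then $E(\mathcal{P}_e(A_n))\subsetneq E(\Delta_D(A_n))\subsetneq E(\Delta(A_n))$.
   Context: $A_n$ is the alternating group; $E(\cdot)$ denotes edge set. The commuting graph $\Delta(G)$ has vertex set $G$ with distinct $x,y$ adjacent iff $xy=yx$. The enhanced power graph $\mathcal{P}_e(G)$ has vertex set $G$ with distinct $x,y$ adjacent iff $\langle x,y\rangle$ is cyclic. The deep commuting graph $\Delta_D(G)$ has vertex set $G$, distinct vertices adjacent iff their preimages commute in a Schur cover $\tilde G$ of $G$ (a central extension $\{e\}\to M(G)\to\tilde G\to G\to\{e\}$ with kernel contained in $Z(\tilde G)\cap[\tilde G,\tilde G]$, of maximal order; $M(G)$ the Schur multiplier). *)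

theory Defs
  imports "HOL-Algebra.Sym_Groups" "HOL-Algebra.Elementary_Groups" "HOL-Algebra.Generated_Groups"
begin

definition commuting_edges :: "('a, 'b) monoid_scheme \<Rightarrow> 'a set set" where
  "commuting_edges G = {{x, y} | x y. x \<in> carrier G \<and> y \<in> carrier G \<and> x \<noteq> y \<and>
      x \<otimes>\<^bsub>G\<^esub> y = y \<otimes>\<^bsub>G\<^esub> x}"

definition enhanced_power_edges :: "('a, 'b) monoid_scheme \<Rightarrow> 'a set set" where
  "enhanced_power_edges G = {{x, y} | x y. x \<in> carrier G \<and> y \<in> carrier G \<and> x \<noteq> y \<and>
      cyclic_group (subgroup_generated G {x, y})}"

text \<open>A stem extension of G: a finite group H (carrier encoded in nat, which loses no
  generality up to isomorphism) with a surjective homomorphism onto G whose kernel lies in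
  Z(H) \<inter> [H,H].\<close>

definition stem_extension :: "('a, 'b) monoid_scheme \<Rightarrow> nat monoid \<Rightarrow> (nat \<Rightarrow> 'a) \<Rightarrow> bool" where
  "stem_extension G H \<pi> \<longleftrightarrow> group H \<and> finite (carrier H) \<and> \<pi> \<in> hom H G \<and>
     \<pi> ` carrier H = carrier G \<and>
     kernel H G \<pi> \<subseteq> {z \<in> carrier H. \<forall>h \<in> carrier H. z \<otimes>\<^bsub>H\<^esub> h = h \<otimes>\<^bsub>H\<^esub> z}
                     \<inter> derived H (carrier H)"

definition schur_cover :: "('a, 'b) monoid_scheme \<Rightarrow> nat monoid \<Rightarrow> (nat \<Rightarrow> 'a) \<Rightarrow> bool" where
  "schur_cover G H \<pi> \<longleftrightarrow> stem_extension G H \<pi> \<and>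
     (\<forall>H' \<pi>'. stem_extension G H' \<pi>' \<longrightarrow> card (kernel H' G \<pi>') \<le> card (kernel H G \<pi>))"

definition deep_commuting_edges :: "('a, 'b) monoid_scheme \<Rightarrow> 'a set set" where
  "deep_commuting_edges G = {{x, y} | x y. x \<in> carrier G \<and> y \<in> carrier G \<and> x \<noteq> y \<and>
      (\<forall>H \<pi>. schur_cover G H \<pi> \<longrightarrow>
         (\<forall>x' \<in> carrier H. \<forall>y' \<in> carrier H. \<pi> x' = x \<longrightarrow> \<pi> y' = y \<longrightarrow>
             x' \<otimes>\<^bsub>H\<^esub> y' = y' \<otimes>\<^bsub>H\<^esub> x'))}"

end

theory Submission
  imports Defs "HOL-Algebra.Multiplicative_Group" "HOL-Library.Numeral_Type"
    "HOL-Library.Function_Algebras" "HOL-Computational_Algebra.Primes"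
begin

text \<open>Every finite group has a Schur cover, because the transfer bounds the exponent of the kernel of a
  stem extension, while the kernel is generated by the values of a cocycle. If the group is perfect,
  a Schur cover maps to every finite central extension, so a commuting pair fails to be deep
  commuting as soon as its lifts to one finite central extension do not commute. A pair generating a
  cyclic group has commuting lifts everywhere.

  For \<open>n \<le> 7\<close>, a noncyclic abelian subgroup of \<open>A\<^sub>n\<close> contains a Klein four-group on four points, a pair
  \<open>(a b)(c d), (a b)(e f)\<close>, or a pair of disjoint 3-cycles. The lifts of the first two pairs
  anticommute in the double cover, realised in a Clifford algebra, and those of the third do not
  commute in the triple cover of \<open>A\<^sub>6\<close> or \<open>A\<^sub>7\<close>, realised by monomial transformations on the 21 duads.
  The group \<open>A\<^sub>4\<close> is not perfect. There the kernel of a Schur cover is nontrivial, because of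
  \<open>SL\<^sub>2(3)\<close>, but would be killed by 3 and by 4 through the transfer if the four-group had an abelian
  preimage.

  For \<open>n \<ge> 8\<close>, the commutator of lifts of \<open>(1 2 3)\<close> and \<open>(4 5 6)\<close> has order dividing 3, and it equals its
  inverse because \<open>(1 2)(7 8)\<close> inverts one 3-cycle and centralises the other. So the lifts commute
  although the pair generates a noncyclic group.\<close>

section \<open>Lifts of commuting elements\<close>

text \<open>No Schur multiplier is computed. To refute a deep edge of a perfect group, one finite
  central extension with noncommuting lifts is enough, and its kernel may be larger than that of a
  cover. All such extensions are groups of pairs: an even permutation and an operator covering it.
  Only 3-cycles have to be lifted, since they generate the alternating group. Deep commutation of a
  pair extends to the whole subgroup that the pair generates. So a noncyclic pair can be traded for
  generators of some C_p x C_p inside that subgroup, and these for better placed elements of it,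
  until one of three explicit pairs appears. The bound \<open>n \<le> 7\<close> enters three times:
  a free orbit of C_p x C_p with p odd has at least 9 points; an even involution with more than two
  2-cycles moves at least 8 points; the field modulo 3 behind the triple cover lives on 7 points.
  The spinors have coefficients in a finite field of odd characteristic: finiteness keeps the lifts
  finite in number, and odd characteristic separates anticommuting from commuting.\<close>

locale central_extension = group_hom H G \<pi>
  for H (structure) and G (structure) and \<pi> +
  assumes surj: "\<pi> ` carrier H = carrier G"
    and central: "\<lbrakk>z \<in> kernel H G \<pi>; h \<in> carrier H\<rbrakk> \<Longrightarrow> z \<otimes> h = h \<otimes> z"

lemma (in group_hom) card_vimage:
  assumes fin: "finite (carrier G)" and surj: "h ` carrier G = carrier H" and S: "S \<subseteq> carrier H"
  shows "card {x \<in> carrier G. h x \<in> S} = card S * card (kernel G H h)"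
proof -
  have fS: "finite S" using fin surj S by (metis finite_imageI finite_subset)
  have eq: "{x \<in> carrier G. h x \<in> S} = (\<Union>s\<in>S. {x \<in> carrier G. h x = s})" by auto
  have "card {x \<in> carrier G. h x = s} = card (kernel G H h)" if "s \<in> S" for s
  proof -
    have "s \<in> h ` carrier G" using that S unfolding surj by (rule subsetD[rotated])
    then obtain y where y: "y \<in> carrier G" "h y = s" by (elim imageE) simp
    have "bij_betw (\<lambda>z. z \<otimes> y) (kernel G H h) {x \<in> carrier G. h x = s}"
    proof (rule bij_betwI[where g = "\<lambda>x. x \<otimes> inv y"])
      show "(\<lambda>z. z \<otimes> y) \<in> kernel G H h \<rightarrow> {x \<in> carrier G. h x = s}"
        using y by (auto simp: kernel_def)
      show "(\<lambda>x. x \<otimes> inv y) \<in> {x \<in> carrier G. h x = s} \<rightarrow> kernel G H h"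
        using y by (auto simp: kernel_def)
    qed (use y in \<open>auto simp: kernel_def G.m_assoc\<close>)
    then show ?thesis by (simp add: bij_betw_same_card)
  qed
  then show ?thesis
    unfolding eq using fS fin by (subst card_UN_disjoint) auto
qed

lemma (in group_hom) card_carrier:
  assumes "finite (carrier G)" and "h ` carrier G = carrier H"
  shows "card (carrier G) = card (carrier H) * card (kernel G H h)"
proof -
  have "{x \<in> carrier G. h x \<in> carrier H} = carrier G" by auto
  then show ?thesis using card_vimage[OF assms subset_refl] by simp
qed

context central_extension
begin

lemma fibre:
  assumes "x \<in> carrier H" "y \<in> carrier H" "\<pi> x = \<pi> y"
  obtains z where "z \<in> kernel H G \<pi>" "z \<in> carrier H" "x = y \<otimes> z"
proof
  show "inv y \<otimes> x \<in> kernel H G \<pi>" using assms by (simp add: kernel_def)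
  show "x = y \<otimes> (inv y \<otimes> x)" using assms by (simp add: G.m_assoc[symmetric])
qed (use assms in simp)

text \<open>Two lifts of one element differ by a central factor, so commuting with \<open>c\<close>
  depends on the image alone. Later arguments may therefore pick whichever lift is
  convenient.\<close>

lemma commute_lift_indep:
  assumes c: "c \<in> carrier H" and x: "x \<in> carrier H" and y: "y \<in> carrier H" "\<pi> x = \<pi> y"
    and comm: "y \<otimes> c = c \<otimes> y"
  shows "x \<otimes> c = c \<otimes> x"
proof -
  obtain z where z: "z \<in> kernel H G \<pi>" "z \<in> carrier H" "x = y \<otimes> z" using fibre x y by metis
  have "x \<otimes> c = y \<otimes> (c \<otimes> z)" using z c y central[OF z(1) c] by (simp add: G.m_assoc)
  also have "\<dots> = c \<otimes> x" using z c y comm by (simp add: G.m_assoc[symmetric])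
  finally show ?thesis .
qed

text \<open>The elements of \<open>G\<close> all of whose lifts commute with \<open>c\<close> form a
  subgroup.\<close>

lemma lift_generate_commutes:
  assumes S: "S \<subseteq> carrier G" and c: "c \<in> carrier H"
    and comm: "\<And>x. \<lbrakk>x \<in> carrier H; \<pi> x \<in> S\<rbrakk> \<Longrightarrow> x \<otimes> c = c \<otimes> x"
    and a: "a \<in> generate G S" and x: "x \<in> carrier H" "\<pi> x = a"
  shows "x \<otimes> c = c \<otimes> x"
  using a x
proof (induction arbitrary: x)
  case one
  then show ?case using central c by (auto simp: kernel_def)
next
  case (incl s)
  then show ?case using comm by auto
next
  case (inv s)
  then have "\<pi> (inv x) = s" using S by (metis hom_inv H.inv_inv subsetD)
  then have "inv x \<otimes> c = c \<otimes> inv x" using comm inv by auto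
  have "x \<otimes> c = x \<otimes> (c \<otimes> inv x) \<otimes> x"
    using inv.prems c by (simp add: G.m_assoc)
  also have "\<dots> = c \<otimes> x"
    using inv.prems c by (simp add: \<open>inv x \<otimes> c = c \<otimes> inv x\<close>[symmetric] G.m_assoc[symmetric])
  finally show ?case .
next
  case (eng a b)
  obtain y where y: "y \<in> carrier H" "\<pi> y = a" 
    using H.generate_in_carrier[OF S eng(1)] surj by (metis imageE)
  obtain w where w: "w \<in> carrier H" "\<pi> w = b"
    using H.generate_in_carrier[OF S eng(2)] surj by (metis imageE)
  have "(y \<otimes> w) \<otimes> c = c \<otimes> (y \<otimes> w)"
    using eng.IH(1)[OF y] eng.IH(2)[OF w] y w c by (metis G.m_assoc)
  then show ?case using commute_lift_indep[OF c, of x "y \<otimes> w"] eng.prems y w by simp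
qed

text \<open>The previous lemma is applied once in each argument. For a singleton \<open>S\<close> it
  says that a cyclic subgroup has an abelian preimage.\<close>

lemma lift_generate_commute2:
  assumes S: "S \<subseteq> carrier G"
    and comm: "\<And>x y. \<lbrakk>x \<in> carrier H; y \<in> carrier H; \<pi> x \<in> S; \<pi> y \<in> S\<rbrakk> \<Longrightarrow> x \<otimes> y = y \<otimes> x"
    and x: "x \<in> carrier H" "\<pi> x \<in> generate G S" and y: "y \<in> carrier H" "\<pi> y \<in> generate G S"
  shows "x \<otimes> y = y \<otimes> x"
proof (rule lift_generate_commutes[OF S y(1) _ x(2,1) refl])
  fix u assume u: "u \<in> carrier H" "\<pi> u \<in> S"
  have "y \<otimes> u = u \<otimes> y"
    by (rule lift_generate_commutes[OF S u(1) _ y(2,1) refl]) (use comm u in auto)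
  then show "u \<otimes> y = y \<otimes> u" ..
qed

end

lemma stem_extension_central:
  assumes "group G" and "stem_extension G H \<pi>"
  shows "central_extension H G \<pi>"
  using assms unfolding stem_extension_def central_extension_def central_extension_axioms_def
    group_hom_def group_hom_axioms_def by blast

lemma doubleton_mem_iff:
  assumes "\<And>u v. R u v \<Longrightarrow> R v u"
  shows "{x, y} \<in> {{u, v} | u v. R u v} \<longleftrightarrow> R x y"
  using assms by (auto simp: doubleton_eq_iff)

lemma doubleton_in_deep_commuting_edges:
  "{x, y} \<in> deep_commuting_edges G \<longleftrightarrow> x \<in> carrier G \<and> y \<in> carrier G \<and> x \<noteq> y \<and>
     (\<forall>H \<pi>. schur_cover G H \<pi> \<longrightarrow>
        (\<forall>x' \<in> carrier H. \<forall>y' \<in> carrier H. \<pi> x' = x \<longrightarrow> \<pi> y' = y \<longrightarrow>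
             x' \<otimes>\<^bsub>H\<^esub> y' = y' \<otimes>\<^bsub>H\<^esub> x'))"
  unfolding deep_commuting_edges_def
proof (rule doubleton_mem_iff)
  fix u v
  assume "u \<in> carrier G \<and> v \<in> carrier G \<and> u \<noteq> v \<and>
     (\<forall>H \<pi>. schur_cover G H \<pi> \<longrightarrow>
        (\<forall>x' \<in> carrier H. \<forall>y' \<in> carrier H. \<pi> x' = u \<longrightarrow> \<pi> y' = v \<longrightarrow>
             x' \<otimes>\<^bsub>H\<^esub> y' = y' \<otimes>\<^bsub>H\<^esub> x'))"
  then show "v \<in> carrier G \<and> u \<in> carrier G \<and> v \<noteq> u \<and>
     (\<forall>H \<pi>. schur_cover G H \<pi> \<longrightarrow>
        (\<forall>x' \<in> carrier H. \<forall>y' \<in> carrier H. \<pi> x' = v \<longrightarrow> \<pi> y' = u \<longrightarrow>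
             x' \<otimes>\<^bsub>H\<^esub> y' = y' \<otimes>\<^bsub>H\<^esub> x'))"
    by (metis (no_types, lifting))
qed

lemma deep_commuting_edges_generate:
  assumes G: "group G" and xy: "{x, y} \<in> deep_commuting_edges G"
    and ab: "a \<in> generate G {x, y}" "b \<in> generate G {x, y}" "a \<noteq> b"
  shows "{a, b} \<in> deep_commuting_edges G"
proof -
  have xy': "{x, y} \<subseteq> carrier G" using xy doubleton_in_deep_commuting_edges[of x y G] by auto
  then have car: "a \<in> carrier G" "b \<in> carrier G" using ab group.generate_in_carrier[OF G] by metis+
  have "x' \<otimes>\<^bsub>H\<^esub> y' = y' \<otimes>\<^bsub>H\<^esub> x'"
    if H: "schur_cover G H \<pi>" and x': "x' \<in> carrier H" "\<pi> x' = a" and y': "y' \<in> carrier H" "\<pi> y' = b"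
    for H \<pi> x' y'
  proof -
    interpret central_extension H G \<pi>
      using stem_extension_central[OF G] H unfolding schur_cover_def by blast
    have base: "u \<otimes>\<^bsub>H\<^esub> v = v \<otimes>\<^bsub>H\<^esub> u"
      if "u \<in> carrier H" "v \<in> carrier H" and uv: "\<pi> u \<in> {x, y}" "\<pi> v \<in> {x, y}" for u v
    \<comment> \<open>Edges join distinct vertices, so two lifts of the same vertex are not covered
      by the assumption and need lift independence instead.\<close>
    proof (cases "\<pi> u = \<pi> v")
      case True
      then show ?thesis using commute_lift_indep[of v u v] that by auto
    next
      case False
      then consider "\<pi> u = x" "\<pi> v = y" | "\<pi> u = y" "\<pi> v = x" using uv by auto
      then show ?thesis
      proof cases
        case 1
        then show ?thesis using xy H that unfolding doubleton_in_deep_commuting_edges by blast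
      next
        case 2
        then have "v \<otimes>\<^bsub>H\<^esub> u = u \<otimes>\<^bsub>H\<^esub> v"
          using xy H that unfolding doubleton_in_deep_commuting_edges by blast
        then show ?thesis ..
      qed
    qed
    show ?thesis
      by (rule lift_generate_commute2[OF xy']) (use base x' y' ab in auto)
  qed
  then show ?thesis unfolding doubleton_in_deep_commuting_edges using car ab(3) by blast
qed

lemma (in group) cyclic_subgroup_generatedE:
  assumes cyc: "cyclic_group (subgroup_generated G {x, y})" and xy: "x \<in> carrier G" "y \<in> carrier G"
  obtains g where "g \<in> carrier G" "generate G {x, y} = generate G {g}"
proof -
  let ?B = "subgroup_generated G {x, y}"
  obtain g where g: "g \<in> carrier ?B" "subgroup_generated ?B {g} = ?B"
    using cyc unfolding cyclic_group_def by blast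
  have "generate G {x, y} = carrier ?B" using xy by (simp add: carrier_subgroup_generated)
  also have "\<dots> = generate ?B {g}" using g by (metis carrier_subgroup_generated Int_insert_right_if1 Int_empty_right)
  also have "\<dots> = generate G {g}"
    by (metis generate_consistent subgroup_subgroup_generated empty_subsetI g(1)
         subgroup_generated_def carrier_subgroup_generated insert_subset)
  finally show thesis using that g(1) carrier_subgroup_generated_subset by blast
qed

lemma enhanced_power_subset_deep:
  assumes G: "group G"
  shows "enhanced_power_edges G \<subseteq> deep_commuting_edges G"
proof
  fix e assume "e \<in> enhanced_power_edges G"
  then obtain x y where e: "e = {x, y}" "x \<in> carrier G" "y \<in> carrier G" "x \<noteq> y"
    and cyc: "cyclic_group (subgroup_generated G {x, y})" unfolding enhanced_power_edges_def by blast
  interpret A: group G by fact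
  obtain g where g: "g \<in> carrier G" "generate G {x, y} = generate G {g}"
    using A.cyclic_subgroup_generatedE[OF cyc e(2,3)] .
  then have xyg: "x \<in> generate G {g}" "y \<in> generate G {g}"
    using generate.incl[of _ "{x, y}" G] by blast+
  have "x' \<otimes>\<^bsub>H\<^esub> y' = y' \<otimes>\<^bsub>H\<^esub> x'"
    if H: "schur_cover G H \<pi>" and x': "x' \<in> carrier H" "\<pi> x' = x" and y': "y' \<in> carrier H" "\<pi> y' = y"
    for H \<pi> x' y'
  proof -
    interpret central_extension H G \<pi>
      using stem_extension_central[OF G] H unfolding schur_cover_def by blast
    show ?thesis
    proof (rule lift_generate_commute2[where S = "{g}"])
      fix u v assume "u \<in> carrier H" "v \<in> carrier H" "\<pi> u \<in> {g}" "\<pi> v \<in> {g}"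
      then show "u \<otimes>\<^bsub>H\<^esub> v = v \<otimes>\<^bsub>H\<^esub> u" using commute_lift_indep[of v u v] by auto
    qed (use g(1) x' y' xyg in auto)
  qed
  then show "e \<in> deep_commuting_edges G"
    unfolding e(1) doubleton_in_deep_commuting_edges using e by blast
qed

section \<open>Transfer and the existence of Schur covers\<close>

text \<open>The transfer into the abelian subgroup \<open>A\<close> kills
  \<open>derived G (carrier G)\<close>. At a central element of \<open>A\<close> each of its factors
  is that element itself, so its value there is the power by the index.\<close>

lemma (in group) transfer_power_eq_one:
  assumes fin: "finite (carrier G)" and A: "subgroup A G"
    and comm: "\<And>a b. \<lbrakk>a \<in> A; b \<in> A\<rbrakk> \<Longrightarrow> a \<otimes> b = b \<otimes> a"
    and z: "z \<in> A" and cent: "\<And>g. g \<in> carrier G \<Longrightarrow> z \<otimes> g = g \<otimes> z"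
    and zd: "z \<in> derived G (carrier G)"
  shows "z [^] card (rcosets A) = \<one>"
proof -
  define AG where "AG = G\<lparr>carrier := A\<rparr>"
  define rep where "rep C = (SOME x. x \<in> C)" for C :: "'a set"
  \<comment> \<open>\<open>t C g\<close> is the \<open>A\<close>-part of
    \<open>rep C \<otimes> g\<close> with respect to the transversal \<open>rep\<close>; the product
    \<open>\<phi>\<close> of these over all cosets is the transfer.\<close>
  define t where "t C g = rep C \<otimes> g \<otimes> inv (rep (C #> g))" for C g
  define \<phi> where "\<phi> g = finprod AG (\<lambda>C. t C g) (rcosets A)" for g
  have AG_simps: "carrier AG = A" "x \<otimes>\<^bsub>AG\<^esub> y = x \<otimes> y" "\<one>\<^bsub>AG\<^esub> = \<one>" for x y by (auto simp: AG_def)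
  interpret A: subgroup A G by fact
  have gAG: "group AG" unfolding AG_def using subgroup_imp_group[OF A] .
  interpret AG: comm_group AG
    by (rule group.group_comm_groupI[OF gAG]) (use comm in \<open>auto simp: AG_simps\<close>)
  have rep: "rep C \<in> carrier G" "C = A #> rep C" "C \<subseteq> carrier G" if "C \<in> rcosets A" for C
  proof -
    obtain x where x: "x \<in> carrier G" "C = A #> x" using \<open>C \<in> rcosets A\<close> by (auto simp: RCOSETS_def)
    then have "x \<in> C" using rcos_self A by auto
    then have rC: "rep C \<in> C" unfolding rep_def by (rule someI)
    then show "C = A #> rep C" using x repr_independence[OF _ x(1) A] by auto
    show "C \<subseteq> carrier G" using x r_coset_subset_G[OF A.subset] by simp
    then show "rep C \<in> carrier G" using rC by blast
  qed
  have trans: "C #> g \<in> rcosets A" if "C \<in> rcosets A" "g \<in> carrier G" for C g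
  proof -
    have "C #> g = A #> (rep C \<otimes> g)"
      using rep[OF that(1)] that(2) coset_mult_assoc[OF A.subset, of "rep C" g] by metis
    then show ?thesis using rep[OF that(1)] that(2) rcosetsI[OF A.subset] by simp
  qed
  have tA: "t C g \<in> A" if C: "C \<in> rcosets A" and g: "g \<in> carrier G" for C g
  proof -
    have "A #> (rep C \<otimes> g) = C #> g"
      using rep[OF C] g coset_mult_assoc[OF A.subset, of "rep C" g] by metis
    also have "\<dots> = A #> rep (C #> g)" using rep(2)[OF trans[OF C g]] .
    finally have "rep C \<otimes> g \<in> A #> rep (C #> g)"
      using rcos_self[OF _ A, of "rep C \<otimes> g"] rep(1)[OF C] g by simp
    then show ?thesis
      unfolding t_def by (rule A.rcos_module_imp[OF is_group rep(1)[OF trans[OF C g]]])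
  qed
  have t_mult: "t C (g \<otimes> h) = t C g \<otimes> t (C #> g) h"
    if C: "C \<in> rcosets A" and g: "g \<in> carrier G" and h: "h \<in> carrier G" for C g h
  proof -
    have a: "C #> (g \<otimes> h) = C #> g #> h" using coset_mult_assoc[OF rep(3)[OF C] g h] by simp
    have r: "rep (C #> g) \<in> carrier G" "rep (C #> g #> h) \<in> carrier G" "rep C \<in> carrier G"
      using rep(1) trans C g h by auto
    have "t C g \<otimes> t (C #> g) h
        = rep C \<otimes> g \<otimes> (inv rep (C #> g) \<otimes> rep (C #> g)) \<otimes> h \<otimes> inv rep (C #> g #> h)"
      unfolding t_def using r g h by (simp only: m_assoc m_closed inv_closed)
    also have "\<dots> = t C (g \<otimes> h)" unfolding t_def a using r g h by (simp add: m_assoc)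
    finally show ?thesis ..
  qed
  have finR: "finite (rcosets A)" using fin A.subset rcosets_subset_PowG[OF A] 
    by (meson finite_Pow_iff finite_subset)
  have bij: "bij_betw (\<lambda>C. C #> g) (rcosets A) (rcosets A)" if g: "g \<in> carrier G" for g
  proof (rule bij_betwI[where g = "\<lambda>C. C #> inv g"])
    show "C #> g #> inv g = C" if "C \<in> rcosets A" for C
      using coset_mult_assoc[OF rep(3)[OF that], of g "inv g"] g coset_mult_one[OF rep(3)[OF that]] by simp
    show "C #> inv g #> g = C" if "C \<in> rcosets A" for C
      using coset_mult_assoc[OF rep(3)[OF that], of "inv g" g] g coset_mult_one[OF rep(3)[OF that]] by simp
  qed (use trans g in auto)
  have \<phi>A: "\<phi> g \<in> A" if "g \<in> carrier G" for g
    using AG.finprod_closed[of "\<lambda>C. t C g" "rcosets A"] tA that unfolding \<phi>_def by (auto simp: AG_simps)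
  have hom: "\<phi> \<in> hom G AG"
  proof (rule homI)
    fix g assume "g \<in> carrier G" then show "\<phi> g \<in> carrier AG" using \<phi>A by (simp add: AG_simps)
  next
    fix g h assume g: "g \<in> carrier G" and h: "h \<in> carrier G"
    have "\<phi> (g \<otimes> h) = finprod AG (\<lambda>C. t C g \<otimes>\<^bsub>AG\<^esub> t (C #> g) h) (rcosets A)"
      unfolding \<phi>_def by (rule AG.finprod_cong') (use t_mult tA trans g h in \<open>auto simp: AG_simps\<close>)
    also have "\<dots> = \<phi> g \<otimes>\<^bsub>AG\<^esub> finprod AG (\<lambda>C. t (C #> g) h) (rcosets A)"
      unfolding \<phi>_def by (rule AG.finprod_multf) (use tA trans g h in \<open>auto simp: AG_simps\<close>)
    \<comment> \<open>Right multiplication by \<open>g\<close> permutes the cosets, so reindexing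
      removes the shift.\<close>
    also have "finprod AG (\<lambda>C. t (C #> g) h) (rcosets A) = \<phi> h"
    proof -
      have "finprod AG (\<lambda>C. t C h) ((\<lambda>C. C #> g) ` (rcosets A)) = finprod AG (\<lambda>C. t (C #> g) h) (rcosets A)"
        by (rule AG.finprod_reindex)
          (use bij[OF g] tA trans g h in \<open>auto simp: AG_simps bij_betw_def\<close>)
      then show ?thesis using bij[OF g] unfolding \<phi>_def by (simp add: bij_betw_def)
    qed
    finally show "\<phi> (g \<otimes> h) = \<phi> g \<otimes>\<^bsub>AG\<^esub> \<phi> h" .
  qed
  interpret \<phi>: group_hom G AG \<phi> using hom gAG is_group by (simp add: group_hom_def group_hom_axioms_def)
  have "\<phi> ` derived G (carrier G) = {\<one>}"
    using \<phi>.derived_img[OF subset_refl] AG.derived_eq_singleton[of "\<phi> ` carrier G"] \<phi>A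
    by (auto simp: AG_simps)
  then have "\<phi> z = \<one>" using zd by auto
  moreover have "\<phi> z = z [^] card (rcosets A)"
  proof -
    have zG: "z \<in> carrier G" using z A.subset by auto
    have "C #> z = C" if C: "C \<in> rcosets A" for C
    proof -
      have "C #> z = A #> (rep C \<otimes> z)"
        using rep[OF C] zG coset_mult_assoc[OF A.subset, of "rep C" z] by metis
      also have "\<dots> = A #> (z \<otimes> rep C)" using cent rep(1)[OF C] by simp
      also have "\<dots> = A #> rep C" using coset_mult_assoc[OF A.subset zG rep(1)[OF C]] coset_join2[OF zG A z] by simp
      finally show ?thesis using rep(2)[OF C] by simp
    qed
    then have "t C z = z" if C: "C \<in> rcosets A" for C
      unfolding t_def using C cent[OF rep(1)[OF C], symmetric] rep(1)[OF C] zG by (simp add: m_assoc)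
    then have "\<phi> z = finprod AG (\<lambda>C. z) (rcosets A)"
      unfolding \<phi>_def by (intro AG.finprod_cong') (use z in \<open>auto simp: AG_simps\<close>)
    also have "\<dots> = z [^]\<^bsub>AG\<^esub> card (rcosets A)" using AG.finprod_const z by (simp add: AG_simps)
    also have "\<dots> = z [^] card (rcosets A)" unfolding AG_def using nat_pow_consistent by metis
    finally show ?thesis .
  qed
  ultimately show ?thesis by simp
qed

text \<open>Induction on \<open>S\<close>: exponents of a new generator can be reduced modulo
  \<open>m\<close>, so it enlarges the generated group at most \<open>m\<close>-fold.\<close>

lemma (in comm_group) card_generate_le:
  assumes "finite S" "S \<subseteq> carrier G" "\<And>x. x \<in> S \<Longrightarrow> x [^] m = \<one>" "0 < (m::nat)"
  shows "finite (generate G S) \<and> card (generate G S) \<le> m ^ card S"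
  using assms
proof (induction S rule: finite_induct)
  case empty
  then show ?case using generate_empty by simp
next
  case (insert a S)
  have a: "a \<in> carrier G" and S: "S \<subseteq> carrier G" using insert by auto
  define T where "T = {a [^] (i::int) \<otimes> x | i x. x \<in> generate G S}"
  have gS: "generate G S \<subseteq> carrier G" using generate_incl[OF S] .
  have sT: "subgroup T G"
  proof (rule subgroupI)
    show "T \<subseteq> carrier G" using a gS by (auto simp: T_def)
    show "T \<noteq> {}" using generate.one by (auto simp: T_def)
  next
    fix u assume "u \<in> T"
    then obtain i x where u: "u = a [^] (i::int) \<otimes> x" "x \<in> generate G S" by (auto simp: T_def)
    then have "inv u = a [^] (- i) \<otimes> inv x"
      using a gS by (simp add: inv_mult_group int_pow_neg subsetD m_comm)
    then show "inv u \<in> T" using generate_m_inv_closed[OF S u(2)] by (auto simp: T_def)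
  next
    fix u v assume "u \<in> T" "v \<in> T"
    then obtain i x j y where u: "u = a [^] (i::int) \<otimes> x" "x \<in> generate G S"
      and v: "v = a [^] (j::int) \<otimes> y" "y \<in> generate G S" by (auto simp: T_def)
    have "u \<otimes> v = a [^] (i + j) \<otimes> (x \<otimes> y)"
      using u v a gS by (simp add: int_pow_mult subsetD m_ac)
    then show "u \<otimes> v \<in> T" using generate.eng[OF u(2) v(2)] by (auto simp: T_def)
  qed
  have "a \<in> T" using generate.one a unfolding T_def by (intro CollectI exI[of _ 1] exI[of _ "\<one>"]) auto
  moreover have "S \<subseteq> T"
  proof
    fix x assume x: "x \<in> S"
    then have "x = a [^] (0::int) \<otimes> x" using S by auto
    then show "x \<in> T" using generate.incl[OF x, of G] unfolding T_def by blast
  qed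
  ultimately have gen: "generate G (insert a S) \<subseteq> T" using generate_subgroup_incl[OF _ sT] by simp
  have "T \<subseteq> (\<lambda>(i, x). a [^] i \<otimes> x) ` ({..<m} \<times> generate G S)"
  proof
    fix u assume "u \<in> T"
    then obtain i x where u: "u = a [^] (i::int) \<otimes> x" "x \<in> generate G S" by (auto simp: T_def)
    have am: "a [^] (int m) = \<one>" using insert.prems by (simp add: int_pow_int)
    have "a [^] i = a [^] (int m * (i div int m) + i mod int m)" by simp
    also have "\<dots> = (a [^] int m) [^] (i div int m) \<otimes> a [^] (i mod int m)"
      using a by (simp only: int_pow_mult int_pow_pow)
    also have "\<dots> = a [^] (i mod int m)" using a by (simp only: am int_pow_one) simp
    also have "\<dots> = a [^] (nat (i mod int m))" using insert.prems(3) by (simp add: int_pow_int[symmetric])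
    finally have "u = (\<lambda>(i, x). a [^] i \<otimes> x) (nat (i mod int m), x)" using u by simp
    moreover have "nat (i mod int m) < m" using insert.prems(3) by (simp add: nat_less_iff)
    ultimately show "u \<in> (\<lambda>(i, x). a [^] i \<otimes> x) ` ({..<m} \<times> generate G S)"
      using u(2) by (intro image_eqI[where x = "(nat (i mod int m), x)"]) auto
  qed
  with gen have sub: "generate G (insert a S) \<subseteq> (\<lambda>(i, x). a [^] i \<otimes> x) ` ({..<m} \<times> generate G S)" by simp
  have IH: "finite (generate G S)" "card (generate G S) \<le> m ^ card S" using insert by auto
  have "card (generate G (insert a S)) \<le> card ({..<m} \<times> generate G S)"
    using IH(1) by (intro surj_card_le[OF _ sub]) auto
  also have "\<dots> \<le> m * m ^ card S" using IH(2) by (simp add: card_cartesian_product)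
  finally show ?case using insert.hyps IH(1) finite_subset[OF sub] by simp
qed

text \<open>Central factors cancel in commutators, so a set that supplements the centre already
  yields every commutator.\<close>

lemma (in group) derived_eq_of_central_supplement:
  assumes T: "T \<subseteq> carrier G"
    and dec: "\<And>x. x \<in> carrier G \<Longrightarrow>
      \<exists>t\<in>T. \<exists>z\<in>carrier G. x = t \<otimes> z \<and> (\<forall>g\<in>carrier G. z \<otimes> g = g \<otimes> z)"
  shows "derived G (carrier G) = derived G T"
proof (rule subset_antisym[OF _ mono_derived[OF T]])
  have "derived_set G (carrier G) \<subseteq> derived_set G T"
  proof
    fix c assume "c \<in> derived_set G (carrier G)"
    then obtain x y where xy: "x \<in> carrier G" "y \<in> carrier G" "c = x \<otimes> y \<otimes> inv x \<otimes> inv y" by auto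
    obtain t z where t: "t \<in> T" "z \<in> carrier G" "x = t \<otimes> z" "\<And>g. g \<in> carrier G \<Longrightarrow> z \<otimes> g = g \<otimes> z"
      using dec[OF xy(1)] by blast
    obtain u w where u: "u \<in> T" "w \<in> carrier G" "y = u \<otimes> w" "\<And>g. g \<in> carrier G \<Longrightarrow> w \<otimes> g = g \<otimes> w"
      using dec[OF xy(2)] by blast
    have G: "t \<in> carrier G" "u \<in> carrier G" using t u T by auto
    have "x \<otimes> y = (t \<otimes> u) \<otimes> (w \<otimes> z)"
    proof -
      have "x \<otimes> y = t \<otimes> (z \<otimes> y)" using t(2,3) G xy by (simp add: m_assoc)
      also have "z \<otimes> y = y \<otimes> z" using t(4) xy(2) .
      also have "t \<otimes> (y \<otimes> z) = (t \<otimes> u) \<otimes> (w \<otimes> z)" using u(2,3) G t(2) by (simp add: m_assoc)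
      finally show ?thesis .
    qed
    moreover have "y \<otimes> x = (u \<otimes> t) \<otimes> (w \<otimes> z)"
    proof -
      have "y \<otimes> x = u \<otimes> (w \<otimes> t) \<otimes> z" using t(2,3) u(2,3) G by (simp add: m_assoc)
      also have "w \<otimes> t = t \<otimes> w" using u(4) G(1) .
      finally show ?thesis using t(2) u(2) G by (simp add: m_assoc)
    qed
    ultimately have "c = (t \<otimes> u) \<otimes> inv (u \<otimes> t)"
    proof -
      have "c = (x \<otimes> y) \<otimes> inv (y \<otimes> x)" using xy by (simp add: inv_mult_group m_assoc)
      also have "\<dots> = ((t \<otimes> u) \<otimes> (w \<otimes> z)) \<otimes> inv ((u \<otimes> t) \<otimes> (w \<otimes> z))"
        using \<open>x \<otimes> y = _\<close> \<open>y \<otimes> x = _\<close> by simp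
      also have "\<dots> = (t \<otimes> u) \<otimes> ((w \<otimes> z) \<otimes> (inv (w \<otimes> z) \<otimes> inv (u \<otimes> t)))"
        using t(2) u(2) G by (simp add: inv_mult_group m_assoc)
      also have "\<dots> = (t \<otimes> u) \<otimes> inv (u \<otimes> t)"
        using t(2) u(2) G by (simp add: m_assoc[symmetric])
      finally show ?thesis .
    qed
    then have "c = t \<otimes> u \<otimes> inv t \<otimes> inv u" using G by (simp add: inv_mult_group m_assoc)
    then show "c \<in> derived_set G T" using t u by auto
  qed
  then show "derived G (carrier G) \<subseteq> derived G T" unfolding derived_def by (rule mono_generate)
qed

context central_extension
begin

text \<open>Let \<open>Z0\<close> be generated by the factor set of a section \<open>s\<close>. Then
  \<open>T\<close>, the products of section values with \<open>Z0\<close>, is a subgroup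
  supplementing the centre, so [H,H] = [T,T] lies in \<open>T\<close>. The kernel lies in [H,H],
  hence in \<open>T\<close>, and \<open>T\<close> meets it only in \<open>Z0\<close>. Thus at most
  \<open>|G|^2\<close> elements, each killed by \<open>|G|\<close>, generate the kernel.\<close>

lemma kernel_card_le:
  assumes fin: "finite (carrier H)" and stem: "kernel H G \<pi> \<subseteq> derived H (carrier H)"
  shows "card (kernel H G \<pi>) \<le> card (carrier G) ^ (card (carrier G)) ^ 2"
proof -
  let ?Z = "kernel H G \<pi>" and ?m = "card (carrier G)"
  have finG: "finite (carrier G)" using fin surj by (metis finite_imageI)
  have m0: "0 < ?m" using finG by (auto simp: card_gt_0_iff)
  have sZ: "subgroup ?Z H" using subgroup_kernel .
  have ZH: "z \<in> carrier H" if "z \<in> ?Z" for z using that by (simp add: kernel_def)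
  have cZ: "0 < card ?Z"
    using finite_subset[OF _ fin] ZH sZ by (metis card_gt_0_iff empty_iff subgroup.one_closed subsetI)
  have idx: "card (rcosets ?Z) = ?m"
    using G.lagrange[OF sZ] card_carrier[OF fin surj] cZ unfolding order_def by simp
  have exp: "z [^] ?m = \<one>" if "z \<in> ?Z" for z
  proof -
    have "z [^] card (rcosets ?Z) = \<one>"
    proof (rule G.transfer_power_eq_one[OF fin sZ])
      show "a \<otimes> b = b \<otimes> a" if "a \<in> ?Z" "b \<in> ?Z" for a b
        using central[OF that(1) ZH[OF that(2)]] .
      show "z \<otimes> g = g \<otimes> z" if "g \<in> carrier H" for g
        using central[OF \<open>z \<in> ?Z\<close> that] .
      show "z \<in> ?Z" by fact
      show "z \<in> derived H (carrier H)" using \<open>z \<in> ?Z\<close> stem by (rule subsetD[rotated])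
    qed
    then show ?thesis unfolding idx .
  qed
  define ZG where "ZG = H\<lparr>carrier := ?Z\<rparr>"
  have gZ: "group ZG" unfolding ZG_def using G.subgroup_imp_group[OF sZ] .
  have cgZ: "comm_group ZG"
    by (rule group.group_comm_groupI[OF gZ]) (use central ZH in \<open>auto simp: ZG_def\<close>)
  define s where "s g = (SOME h. h \<in> carrier H \<and> \<pi> h = g)" for g
  have s: "s g \<in> carrier H \<and> \<pi> (s g) = g" if "g \<in> carrier G" for g
    unfolding s_def by (rule someI_ex) (use that surj in \<open>metis imageE\<close>)
  have sc: "s g \<in> carrier H" and ps: "\<pi> (s g) = g" if "g \<in> carrier G" for g using s[OF that] by auto
  \<comment> \<open>The factor set of the section: \<open>s g \<otimes> s h\<close> equals
    \<open>s (g h)\<close> times this kernel element.\<close>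
  define f where "f = (\<lambda>(g, h). inv s (g \<otimes>\<^bsub>G\<^esub> h) \<otimes> (s g \<otimes> s h))"
  define S where "S = f ` (carrier G \<times> carrier G)"
  have fZ: "f (g, h) \<in> ?Z" if "g \<in> carrier G" "h \<in> carrier G" for g h
    using that sc ps by (simp add: f_def kernel_def)
  have SZ: "S \<subseteq> ?Z" unfolding S_def using fZ by auto
  have finS: "finite S" unfolding S_def using finG by simp
  have cardS: "card S \<le> ?m ^ 2"
  proof -
    have "card S \<le> card (carrier G \<times> carrier G)"
      unfolding S_def by (rule card_image_le) (simp add: finG)
    then show ?thesis by (simp only: power2_eq_square card_cartesian_product)
  qed
  define Z0 where "Z0 = generate H S"
  have Z0_eq: "Z0 = generate ZG S" unfolding Z0_def ZG_def using G.generate_consistent[OF SZ sZ] by simp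
  have bd: "finite Z0 \<and> card Z0 \<le> ?m ^ card S"
    unfolding Z0_eq
  proof (rule comm_group.card_generate_le[OF cgZ finS _ _ m0])
    show "S \<subseteq> carrier ZG" using SZ by (simp add: ZG_def)
    show "x [^]\<^bsub>ZG\<^esub> ?m = \<one>\<^bsub>ZG\<^esub>" if "x \<in> S" for x
      using exp[of x] that SZ G.nat_pow_consistent[of x ?m ?Z] by (auto simp: ZG_def)
  qed
  have SH: "S \<subseteq> carrier H" using SZ ZH by auto
  have sZ0: "subgroup Z0 H" unfolding Z0_def by (rule G.generate_is_subgroup[OF SH])
  have Z0Z: "Z0 \<subseteq> ?Z" unfolding Z0_def by (rule G.generate_subgroup_incl[OF SZ sZ])
  have fZ0: "f (g, h) \<in> Z0" if "g \<in> carrier G" "h \<in> carrier G" for g h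
    unfolding Z0_def S_def using that by (intro generate.incl) auto
  define T where "T = {h \<in> carrier H. inv s (\<pi> h) \<otimes> h \<in> Z0}"
  have T_iff: "h \<in> T \<longleftrightarrow> (\<exists>g\<in>carrier G. \<exists>z\<in>Z0. h = s g \<otimes> z)" for h
  proof
    assume h: "h \<in> T"
    then have "h = s (\<pi> h) \<otimes> (inv s (\<pi> h) \<otimes> h)"
      using sc[of "\<pi> h"] by (simp add: T_def G.m_assoc[symmetric])
    moreover have "\<pi> h \<in> carrier G" "inv s (\<pi> h) \<otimes> h \<in> Z0" using h by (auto simp: T_def)
    ultimately show "\<exists>g\<in>carrier G. \<exists>z\<in>Z0. h = s g \<otimes> z" by metis
  next
    assume "\<exists>g\<in>carrier G. \<exists>z\<in>Z0. h = s g \<otimes> z"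
    then obtain g z where gz: "g \<in> carrier G" "z \<in> Z0" "h = s g \<otimes> z" by blast
    have z: "z \<in> ?Z" "z \<in> carrier H" using gz Z0Z ZH by auto
    have "\<pi> h = g" using gz z sc ps by (simp add: kernel_def)
    then show "h \<in> T" using gz z sc[OF gz(1)] by (simp add: T_def G.m_assoc[symmetric])
  qed
  have TH: "T \<subseteq> carrier H" by (auto simp: T_def)
  have Tmult: "u \<otimes> v \<in> T" if "u \<in> T" "v \<in> T" for u v
  proof -
    obtain g z where u: "g \<in> carrier G" "z \<in> Z0" "u = s g \<otimes> z" using \<open>u \<in> T\<close> T_iff by blast
    obtain h w where v: "h \<in> carrier G" "w \<in> Z0" "v = s h \<otimes> w" using \<open>v \<in> T\<close> T_iff by blast
    have c: "z \<in> carrier H" "w \<in> carrier H" "s g \<in> carrier H" "s h \<in> carrier H"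
      "s (g \<otimes>\<^bsub>G\<^esub> h) \<in> carrier H" "f (g, h) \<in> carrier H" "z \<in> ?Z"
      using u v Z0Z ZH sc fZ by auto
    have "u \<otimes> v = s g \<otimes> (z \<otimes> s h) \<otimes> w"
      unfolding u(3) v(3) using c(1-6) by (simp add: G.m_assoc)
    also have "z \<otimes> s h = s h \<otimes> z" using central[OF c(7,4)] .
    also have "s g \<otimes> (s h \<otimes> z) \<otimes> w = (s g \<otimes> s h) \<otimes> (z \<otimes> w)"
      using c(1-6) by (simp add: G.m_assoc)
    also have "s g \<otimes> s h = s (g \<otimes>\<^bsub>G\<^esub> h) \<otimes> f (g, h)"
      using c(1-6) by (simp add: f_def G.m_assoc[symmetric])
    finally have "u \<otimes> v = s (g \<otimes>\<^bsub>G\<^esub> h) \<otimes> (f (g, h) \<otimes> (z \<otimes> w))"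
      using c(1-6) by (simp add: G.m_assoc)
    moreover have "f (g, h) \<otimes> (z \<otimes> w) \<in> Z0"
      using u v fZ0 subgroup.m_closed[OF sZ0] by simp
    ultimately show ?thesis unfolding T_iff using u(1) v(1) H.m_closed by blast
  qed
  have sT: "s g \<in> T" if "g \<in> carrier G" for g
    unfolding T_iff using that sc[OF that] subgroup.one_closed[OF sZ0] by (metis G.r_one)
  have sub: "subgroup T H"
  proof (rule G.subgroupI[OF TH])
    show "T \<noteq> {}" using sT by auto
    fix u assume "u \<in> T"
    then have uH: "u \<in> carrier H" using TH by auto
    have pow: "u [^] Suc k \<in> T" for k :: nat
    proof (induction k)
      case 0
      then show ?case using \<open>u \<in> T\<close> uH by simp
    next
      case (Suc k)
      then show ?case using Tmult[OF _ \<open>u \<in> T\<close>] by (metis G.nat_pow_Suc)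
    qed
    have "0 < order H" using fin by (auto simp: order_def card_gt_0_iff)
    then obtain j where "order H = Suc j" by (auto simp: gr0_conv_Suc)
    \<comment> \<open>In a finite group the inverse is a power. Doubling the order keeps the
      exponent \<open>2 * order H - 1\<close> positive even for the trivial group.\<close>
    then obtain k where k: "order H * 2 = Suc (Suc k)" by simp
    have "u [^] Suc k \<otimes> u = \<one>"
    proof -
      have "u [^] Suc k \<otimes> u = u [^] (order H * 2)" unfolding k by simp
      also have "\<dots> = \<one>" using uH G.pow_order_eq_1[OF uH] 
        by (metis G.nat_pow_one G.nat_pow_pow)
      finally show ?thesis .
    qed
    then have "inv u = u [^] Suc k" using G.inv_equality uH by (metis G.nat_pow_closed)
    then show "inv u \<in> T" using pow by simp
  qed (use Tmult in auto)
  have "derived H (carrier H) = derived H T"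
  proof (rule G.derived_eq_of_central_supplement[OF TH])
    fix x assume x: "x \<in> carrier H"
    obtain z where z: "z \<in> ?Z" "z \<in> carrier H" "x = s (\<pi> x) \<otimes> z"
      using fibre[of x "s (\<pi> x)"] x s[of "\<pi> x"] by (metis hom_closed)
    show "\<exists>t\<in>T. \<exists>z\<in>carrier H. x = t \<otimes> z \<and> (\<forall>g\<in>carrier H. z \<otimes> g = g \<otimes> z)"
      using z sT[of "\<pi> x"] x central[OF z(1)] hom_closed[OF x] by blast
  qed
  also have "\<dots> \<subseteq> T" by (rule G.derived_incl[OF subset_refl sub])
  finally have ZT: "?Z \<subseteq> T" using stem by blast
  have one: "\<one> \<in> T" using sub by (rule subgroup.one_closed)
  have "?Z \<subseteq> Z0"
  proof
    fix z assume z: "z \<in> ?Z"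
    \<comment> \<open>The section need not send the identity to the identity, but
      \<open>\<one> \<in> T\<close> shows that its value there lies in \<open>Z0\<close>.\<close>
    have "inv s \<one>\<^bsub>G\<^esub> \<in> Z0" using one sc[of "\<one>\<^bsub>G\<^esub>"] by (simp add: T_def)
    moreover have "inv s \<one>\<^bsub>G\<^esub> \<otimes> z \<in> Z0" using ZT z by (auto simp: T_def kernel_def)
    moreover have "z = inv (inv s \<one>\<^bsub>G\<^esub>) \<otimes> (inv s \<one>\<^bsub>G\<^esub> \<otimes> z)"
      using ZH[OF z] sc[of "\<one>\<^bsub>G\<^esub>"] by (simp add: G.m_assoc[symmetric])
    ultimately show "z \<in> Z0" using sZ0 by (metis subgroup.m_closed subgroup.m_inv_closed)
  qed
  then have "card ?Z \<le> ?m ^ card S" using bd card_mono le_trans by blast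
  also have "\<dots> \<le> ?m ^ ?m ^ 2" using cardS m0 by (intro power_increasing) auto
  finally show ?thesis .
qed

text \<open>Maximality of a Schur cover is stated only against extensions carried by natural
  numbers. This transport makes it applicable to extensions over any type.\<close>

lemma stem_extension_nat_copy:
  assumes fin: "finite (carrier H)" and stem: "kernel H G \<pi> \<subseteq> derived H (carrier H)"
  shows "\<exists>K \<rho>. stem_extension G K \<rho> \<and> card (kernel K G \<rho>) = card (kernel H G \<pi>)"
proof -
  obtain e where e: "bij_betw e {0..<card (carrier H)} (carrier H)"
    using ex_bij_betw_nat_finite[OF fin] by blast
  define f where "f = inv_into {0..<card (carrier H)} e"
  let ?N = "{0..<card (carrier H)}"
  define K where "K = \<lparr>carrier = ?N, mult = \<lambda>a b. f (e a \<otimes> e b), one = f \<one>\<rparr>"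
  have ef: "e (f x) = x" "f x \<in> ?N" if "x \<in> carrier H" for x
    using that e unfolding f_def by (auto simp: bij_betw_def f_inv_into_f inv_into_into simp del: atLeastLessThan_iff)
  have fe: "f (e a) = a" "e a \<in> carrier H" if "a \<in> ?N" for a
    using that e unfolding f_def by (auto simp: bij_betw_def)
  have gK: "group K"
  proof (rule groupI)
    fix a assume a: "a \<in> carrier K"
    then show "\<exists>b\<in>carrier K. b \<otimes>\<^bsub>K\<^esub> a = \<one>\<^bsub>K\<^esub>"
      using fe[of a] ef[of "inv e a"] by (intro bexI[of _ "f (inv e a)"]) (auto simp: K_def)
  qed (use ef fe in \<open>auto simp: K_def G.m_assoc simp del: atLeastLessThan_iff\<close>)
  have homK: "e \<in> hom K H" by (rule homI) (use ef fe in \<open>auto simp: K_def simp del: atLeastLessThan_iff\<close>)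
  interpret e: group_hom K H e using gK homK by (simp add: group_hom_def group_hom_axioms_def)
  have eN: "e ` carrier K = carrier H" using e by (simp add: K_def bij_betw_def)
  have inj: "inj_on e (carrier K)" using e by (simp add: K_def bij_betw_def)
  have ker: "e ` kernel K G (\<pi> \<circ> e) = kernel H G \<pi>"
  proof
    show "e ` kernel K G (\<pi> \<circ> e) \<subseteq> kernel H G \<pi>" by (auto simp: kernel_def)
    show "kernel H G \<pi> \<subseteq> e ` kernel K G (\<pi> \<circ> e)"
      unfolding kernel_def eN[symmetric] by auto
  qed
  have der: "e ` derived K (carrier K) = derived H (carrier H)"
    using e.derived_img[OF subset_refl] eN by simp
  have "stem_extension G K (\<pi> \<circ> e)"
    unfolding stem_extension_def
  proof (intro conjI gK)
    show "finite (carrier K)" by (simp add: K_def)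
    show "\<pi> \<circ> e \<in> hom K G" using Group.hom_compose[OF homK homh] .
    show "(\<pi> \<circ> e) ` carrier K = carrier G" using eN surj by (metis image_comp)
    show "kernel K G (\<pi> \<circ> e) \<subseteq> {z \<in> carrier K. \<forall>h\<in>carrier K. z \<otimes>\<^bsub>K\<^esub> h = h \<otimes>\<^bsub>K\<^esub> z} \<inter> derived K (carrier K)"
    proof
      fix z assume z: "z \<in> kernel K G (\<pi> \<circ> e)"
      then have zK: "z \<in> carrier K" and ez: "e z \<in> kernel H G \<pi>" using ker by (auto simp: kernel_def)
      have "z \<otimes>\<^bsub>K\<^esub> h = h \<otimes>\<^bsub>K\<^esub> z" if "h \<in> carrier K" for h
        using central[OF ez, of "e h"] that zK e.hom_closed[OF that] by (simp add: K_def)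
      moreover have "z \<in> derived K (carrier K)"
      proof -
        obtain d where d: "d \<in> derived K (carrier K)" "e z = e d" using ez stem der by (metis imageE subsetD)
        moreover have "d \<in> carrier K" using d e.G.derived_in_carrier[OF subset_refl] by auto
        ultimately show ?thesis using inj zK by (metis inj_onD)
      qed
      ultimately show "z \<in> {z \<in> carrier K. \<forall>h\<in>carrier K. z \<otimes>\<^bsub>K\<^esub> h = h \<otimes>\<^bsub>K\<^esub> z} \<inter> derived K (carrier K)"
        using zK by blast
    qed
  qed
  moreover have "card (kernel K G (\<pi> \<circ> e)) = card (kernel H G \<pi>)"
    unfolding ker[symmetric] by (rule card_image[symmetric]) (rule inj_on_subset[OF inj], auto simp: kernel_def)
  ultimately show ?thesis by blast
qed

lemma kernel_card_le_schur_cover: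
  assumes fin: "finite (carrier H)" and stem: "kernel H G \<pi> \<subseteq> derived H (carrier H)"
    and K: "schur_cover G K \<rho>"
  shows "card (kernel H G \<pi>) \<le> card (kernel K G \<rho>)"
  using stem_extension_nat_copy[OF fin stem] K unfolding schur_cover_def by metis

end

text \<open>The identity map is a stem extension and the kernel sizes are bounded, so a largest one
  is attained.\<close>

lemma schur_cover_exists:
  assumes G: "group G" and fin: "finite (carrier G)"
  shows "\<exists>H \<pi>. schur_cover G H \<pi>"
proof -
  have "central_extension G G (\<lambda>x. x)"
    using G unfolding central_extension_def central_extension_axioms_def group_hom_def group_hom_axioms_def
    by (auto simp: hom_def kernel_def monoid.l_one[OF group.is_monoid] monoid.r_one[OF group.is_monoid])
  moreover have "kernel G G (\<lambda>x. x) \<subseteq> derived G (carrier G)"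
    unfolding kernel_def derived_def using generate.one by fast
  ultimately obtain H0 \<pi>0 where 0: "stem_extension G H0 \<pi>0"
    using central_extension.stem_extension_nat_copy[OF _ fin] by metis
  let ?P = "\<lambda>(H, \<pi>). stem_extension G H \<pi>" and ?c = "\<lambda>(H, \<pi>). card (kernel H G \<pi>)"
  have "?c x \<le> card (carrier G) ^ (card (carrier G)) ^ 2" if "?P x" for x :: "nat monoid \<times> (nat \<Rightarrow> 'a)"
  proof -
    obtain H \<pi> where x: "x = (H, \<pi>)" by (cases x)
    then show ?thesis
      using that central_extension.kernel_card_le[OF stem_extension_central[OF G, of H \<pi>]]
      unfolding stem_extension_def by auto
  qed
  then obtain x where "?P x" "\<forall>y. ?P y \<longrightarrow> ?c y \<le> ?c x"
    using ex_has_greatest_nat[of ?P "(H0, \<pi>0)" ?c "Suc (card (carrier G) ^ (card (carrier G)) ^ 2)"] 0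
    by (auto simp: less_Suc_eq_le)
  then show ?thesis unfolding schur_cover_def by (cases x) auto
qed

section \<open>Schur covers of perfect groups\<close>

context central_extension
begin

text \<open>A surjection maps [H,H] onto [G,G], which is all of \<open>G\<close> here; so [H,H]
  meets every fibre.\<close>

lemma perfect_decomposition:
  assumes perf: "derived G (carrier G) = carrier G" and x: "x \<in> carrier H"
  shows "\<exists>d\<in>derived H (carrier H). \<exists>z\<in>kernel H G \<pi>. x = d \<otimes> z"
proof -
  have "\<pi> x \<in> \<pi> ` derived H (carrier H)"
    using derived_img[OF subset_refl] surj perf x by auto
  then obtain d where d: "d \<in> derived H (carrier H)" "\<pi> x = \<pi> d" by auto
  moreover have "d \<in> carrier H" using d G.derived_in_carrier[OF subset_refl] by auto
  ultimately show ?thesis using fibre[OF x, of d] by metis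
qed

lemma derived_derived:
  assumes perf: "derived G (carrier G) = carrier G"
  shows "derived H (derived H (carrier H)) = derived H (carrier H)"
proof (rule G.derived_eq_of_central_supplement[symmetric])
  show "derived H (carrier H) \<subseteq> carrier H" by (rule G.derived_in_carrier[OF subset_refl])
  fix x assume "x \<in> carrier H"
  then obtain d z where "d \<in> derived H (carrier H)" "z \<in> kernel H G \<pi>" "x = d \<otimes> z"
    using perfect_decomposition[OF perf] by blast
  moreover have "z \<in> carrier H" using \<open>z \<in> kernel H G \<pi>\<close> by (simp add: kernel_def)
  ultimately show "\<exists>t\<in>derived H (carrier H). \<exists>z\<in>carrier H. x = t \<otimes> z \<and>
      (\<forall>g\<in>carrier H. z \<otimes> g = g \<otimes> z)"
    using central[of z] by blast
qed

lemma stem_perfect: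
  assumes perf: "derived G (carrier G) = carrier G"
    and stem: "kernel H G \<pi> \<subseteq> derived H (carrier H)"
  shows "derived H (carrier H) = carrier H"
proof
  show "derived H (carrier H) \<subseteq> carrier H" by (rule G.derived_in_carrier[OF subset_refl])
  show "carrier H \<subseteq> derived H (carrier H)"
  proof
    fix x assume "x \<in> carrier H"
    then obtain d z where "d \<in> derived H (carrier H)" "z \<in> kernel H G \<pi>" "x = d \<otimes> z"
      using perfect_decomposition[OF perf] by blast
    then show "x \<in> derived H (carrier H)"
      using stem subgroup.m_closed[OF G.derived_is_subgroup[OF subset_refl]] by auto
  qed
qed

lemma central_extension_derived:
  assumes perf: "derived G (carrier G) = carrier G"
  shows "central_extension (H\<lparr>carrier := derived H (carrier H)\<rparr>) G \<pi>"
proof -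
  let ?D = "derived H (carrier H)"
  have sub: "subgroup ?D H" by (rule G.derived_is_subgroup[OF subset_refl])
  have D: "?D \<subseteq> carrier H" by (rule G.derived_in_carrier[OF subset_refl])
  show ?thesis
    unfolding central_extension_def central_extension_axioms_def group_hom_def group_hom_axioms_def
  proof (intro conjI allI impI)
    show "group (H\<lparr>carrier := ?D\<rparr>)" by (rule G.subgroup_imp_group[OF sub])
    show "\<pi> \<in> hom (H\<lparr>carrier := ?D\<rparr>) G" using D by (auto simp: hom_def subset_iff)
    show "\<pi> ` carrier (H\<lparr>carrier := ?D\<rparr>) = carrier G"
      using derived_img[OF subset_refl] surj perf by simp
    show "z \<otimes>\<^bsub>H\<lparr>carrier := ?D\<rparr>\<^esub> h = h \<otimes>\<^bsub>H\<lparr>carrier := ?D\<rparr>\<^esub> z"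
      if "z \<in> kernel (H\<lparr>carrier := ?D\<rparr>) G \<pi>" "h \<in> carrier (H\<lparr>carrier := ?D\<rparr>)" for z h
      using that D central[of z h] by (auto simp: kernel_def)
  qed (rule H.is_group)
qed

end

text \<open>The derived subgroup of the fibre product of a Schur cover with any finite central extension of
  a perfect group is again a stem extension, so maximality forces it to be isomorphic to the Schur
  cover, which therefore maps to every finite central extension.\<close>

lemma not_deep_commuting_if_lifts_not_commute:
  assumes K: "central_extension K G \<rho>" and finK: "finite (carrier K)"
    and perf: "derived G (carrier G) = carrier G"
    and a: "a \<in> carrier K" and b: "b \<in> carrier K" and ab: "a \<otimes>\<^bsub>K\<^esub> b \<noteq> b \<otimes>\<^bsub>K\<^esub> a"
  shows "{\<rho> a, \<rho> b} \<notin> deep_commuting_edges G"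
proof
  assume deep: "{\<rho> a, \<rho> b} \<in> deep_commuting_edges G"
  interpret K: central_extension K G \<rho> by fact
  have finG: "finite (carrier G)" using finK K.surj by (metis finite_imageI)
  obtain H \<pi> where cover: "schur_cover G H \<pi>" using schur_cover_exists[OF K.H.is_group finG] by blast
  then have stemH: "stem_extension G H \<pi>" by (simp add: schur_cover_def)
  interpret H: central_extension H G \<pi> using stem_extension_central[OF K.H.is_group stemH] .
  have finH: "finite (carrier H)" and kerH: "kernel H G \<pi> \<subseteq> derived H (carrier H)"
    using stemH by (auto simp: stem_extension_def)
  define PC where "PC = {(h, k). h \<in> carrier H \<and> k \<in> carrier K \<and> \<pi> h = \<rho> k}"
  define P where "P = (H \<times>\<times> K)\<lparr>carrier := PC\<rparr>"
  interpret HK: group "H \<times>\<times> K" by (rule DirProd_group[OF H.G.is_group K.G.is_group])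
  have subPC: "subgroup PC (H \<times>\<times> K)"
  proof (rule HK.subgroupI)
    have "(\<one>\<^bsub>H\<^esub>, \<one>\<^bsub>K\<^esub>) \<in> PC" by (simp add: PC_def)
    then show "PC \<noteq> {}" by blast
  qed (auto simp: PC_def inv_DirProd[OF H.G.is_group K.G.is_group])
  have gP: "group P" unfolding P_def by (rule HK.subgroup_imp_group[OF subPC])
  have P_simps: "carrier P = PC" "(h, k) \<otimes>\<^bsub>P\<^esub> (h', k') = (h \<otimes>\<^bsub>H\<^esub> h', k \<otimes>\<^bsub>K\<^esub> k')" for h k h' k'
    by (auto simp: P_def)
  have kerPI: "\<exists>h k. z = (h, k) \<and> h \<in> kernel H G \<pi> \<and> k \<in> kernel K G \<rho>" if "z \<in> kernel P G (\<pi> \<circ> fst)" for z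
    using that by (auto simp: kernel_def P_simps PC_def)
  interpret P: central_extension P G "\<pi> \<circ> fst"
    unfolding central_extension_def central_extension_axioms_def group_hom_def group_hom_axioms_def
  proof (intro conjI allI impI gP K.H.is_group)
    show "\<pi> \<circ> fst \<in> hom P G" by (auto simp: hom_def P_simps PC_def)
    have "g \<in> (\<pi> \<circ> fst) ` PC" if "g \<in> carrier G" for g
    proof -
      obtain h where h: "h \<in> carrier H" "\<pi> h = g" using \<open>g \<in> carrier G\<close> H.surj by (metis imageE)
      obtain k where k: "k \<in> carrier K" "\<rho> k = g" using \<open>g \<in> carrier G\<close> K.surj by (metis imageE)
      show ?thesis using h k by (intro image_eqI[of _ _ "(h, k)"]) (auto simp: PC_def)
    qed
    then show "(\<pi> \<circ> fst) ` carrier P = carrier G" by (auto simp: P_simps PC_def)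
    fix z p assume z: "z \<in> kernel P G (\<pi> \<circ> fst)" and p: "p \<in> carrier P"
    obtain h k where hk: "z = (h, k)" "h \<in> kernel H G \<pi>" "k \<in> kernel K G \<rho>" using kerPI[OF z] by blast
    obtain h' k' where p': "p = (h', k')" by (cases p)
    then have "h' \<in> carrier H" "k' \<in> carrier K" using p by (auto simp: P_simps PC_def)
    then show "z \<otimes>\<^bsub>P\<^esub> p = p \<otimes>\<^bsub>P\<^esub> z" 
      unfolding hk(1) p' P_simps using H.central[OF hk(2)] K.central[OF hk(3)] by blast
  qed
  let ?D = "derived P (carrier P)"
  let ?PD = "P\<lparr>carrier := ?D\<rparr>"
  have DP: "?D \<subseteq> PC" using P.G.derived_in_carrier[OF subset_refl] by (simp add: P_simps)
  interpret D: central_extension ?PD G "\<pi> \<circ> fst" by (rule P.central_extension_derived[OF perf])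
  have finP: "finite PC"
    by (rule finite_subset[of _ "carrier H \<times> carrier K"]) (auto simp: PC_def finH finK)
  have finD: "finite (carrier ?PD)" using finite_subset[OF DP finP] by simp
  \<comment> \<open>The group \<open>?PD\<close> is perfect, so its kernel lies in its commutator
    subgroup automatically and it is a stem extension.\<close>
  have "derived ?PD (carrier ?PD) = ?D"
    using P.G.derived_consistent[OF subset_refl P.G.derived_is_subgroup[OF subset_refl]]
      P.derived_derived[OF perf] by simp
  then have stemD: "kernel ?PD G (\<pi> \<circ> fst) \<subseteq> derived ?PD (carrier ?PD)" by (auto simp: kernel_def)
  \<comment> \<open>Maximality bounds the kernel of \<open>?D\<close>, hence its order, by that of
    \<open>H\<close>. Conversely \<open>?D\<close> maps onto \<open>H\<close> because
    \<open>H\<close> is perfect. So the first projection is injective on \<open>?D\<close>.\<close>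
  have "card ?D \<le> card (carrier H)"
    using D.card_carrier[OF finD D.surj] H.card_carrier[OF finH H.surj]
      D.kernel_card_le_schur_cover[OF finD stemD cover] by simp
  moreover have fstD: "fst ` ?D = carrier H"
  proof -
    interpret fst: group_hom P H fst
      using gP H.G.is_group by (auto simp: group_hom_def group_hom_axioms_def hom_def P_simps PC_def)
    have "h \<in> fst ` PC" if "h \<in> carrier H" for h
    proof -
      obtain k where k: "k \<in> carrier K" "\<rho> k = \<pi> h" using H.hom_closed[OF \<open>h \<in> carrier H\<close>] K.surj by (metis imageE)
      show ?thesis using that k by (intro image_eqI[of _ _ "(h, k)"]) (auto simp: PC_def)
    qed
    then have "fst ` carrier P = carrier H" by (auto simp: P_simps PC_def)
    then show ?thesis using fst.derived_img[OF subset_refl] H.stem_perfect[OF perf kerH] by simp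
  qed
  ultimately have inj: "inj_on fst ?D"
    using finD card_image_le[of ?D fst] by (intro eq_card_imp_inj_on) auto
  have lift: "\<exists>d\<in>?D. \<exists>h k. d = (h, k) \<and> h \<in> carrier H \<and> k \<in> carrier K \<and> \<pi> h = g \<and> \<rho> k = g" if "g \<in> carrier G" for g
  proof -
    have "g \<in> (\<pi> \<circ> fst) ` ?D" using D.surj \<open>g \<in> carrier G\<close> by simp
    then obtain d where d: "d \<in> ?D" "(\<pi> \<circ> fst) d = g" by (elim imageE) simp
    obtain h k where "d = (h, k)" by (cases d)
    then show ?thesis using d DP by (intro bexI[of _ d]) (auto simp: PC_def)
  qed
  obtain h k where 1: "(h, k) \<in> ?D" "h \<in> carrier H" "k \<in> carrier K" "\<pi> h = \<rho> a" "\<rho> k = \<rho> a"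
    using lift[OF K.hom_closed[OF a]] by blast
  obtain h' k' where 2: "(h', k') \<in> ?D" "h' \<in> carrier H" "k' \<in> carrier K" "\<pi> h' = \<rho> b" "\<rho> k' = \<rho> b"
    using lift[OF K.hom_closed[OF b]] by blast
  have comm: "h \<otimes>\<^bsub>H\<^esub> h' = h' \<otimes>\<^bsub>H\<^esub> h"
    using deep cover 1 2 unfolding doubleton_in_deep_commuting_edges by blast
  \<comment> \<open>Both products lie in \<open>?D\<close> and agree in the first coordinate, since
    deep commutation holds in \<open>H\<close>; injectivity then forces agreement in
    \<open>K\<close>.\<close>
  have "(h, k) \<otimes>\<^bsub>P\<^esub> (h', k') \<in> ?D" "(h', k') \<otimes>\<^bsub>P\<^esub> (h, k) \<in> ?D"
    using subgroup.m_closed[OF P.G.derived_is_subgroup[OF subset_refl]] 1 2 by auto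
  then have "k \<otimes>\<^bsub>K\<^esub> k' = k' \<otimes>\<^bsub>K\<^esub> k"
    using inj_onD[OF inj, of "(h \<otimes>\<^bsub>H\<^esub> h', k \<otimes>\<^bsub>K\<^esub> k')" "(h' \<otimes>\<^bsub>H\<^esub> h, k' \<otimes>\<^bsub>K\<^esub> k)"] comm
    unfolding P_simps by simp
  then have "a \<otimes>\<^bsub>K\<^esub> k' = k' \<otimes>\<^bsub>K\<^esub> a" using K.commute_lift_indep[OF 2(3) a 1(3)] 1(5) by simp
  then have "b \<otimes>\<^bsub>K\<^esub> a = a \<otimes>\<^bsub>K\<^esub> b" using K.commute_lift_indep[OF a b 2(3)] 2(5) by simp
  then show False using ab by simp
qed

section \<open>Central extensions from pairs\<close>

lemma finite_alt_group: "finite (carrier (alt_group n))"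
  by (rule finite_subset[OF _ finite_permutations[of "{1..n}"]]) (auto simp: alt_group_carrier)

lemma transpositions_in_alt_group:
  assumes "{a, b, c, d} \<subseteq> {1..n}" "a \<noteq> b" "c \<noteq> d"
  shows "transpose a b \<circ> transpose c d \<in> carrier (alt_group n)"
  unfolding alt_group_carrier
proof
  show "transpose a b \<circ> transpose c d permutes {1..n}"
    by (rule permutes_compose[OF permutes_swap_id permutes_swap_id]) (use assms in auto)
  show "evenperm (transpose a b \<circ> transpose c d)"
    using evenperm_comp[OF permutation_swap_id permutation_swap_id, of a b c d] assms by (simp add: evenperm_swap)
qed

text \<open>A pair consists of a group element and an operator covering it. The first projection is
  the covering map, and its kernel consists of the operators over the identity.\<close>

definition pair_monoid :: "('a, 'b) monoid_scheme \<Rightarrow> ('a \<times> ('c \<Rightarrow> 'c)) set \<Rightarrow> ('a \<times> ('c \<Rightarrow> 'c)) monoid" where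
  "pair_monoid G R =
     \<lparr>carrier = R, mult = \<lambda>(s, u) (t, v). (s \<otimes>\<^bsub>G\<^esub> t, u \<circ> v), one = (\<one>\<^bsub>G\<^esub>, id)\<rparr>"

text \<open>Inverses are not assumed: injectivity of the operators makes left multiplication
  injective, and a finite monoid with this property is a group. Surjectivity has to be known only on
  generators, because the image is a subgroup.\<close>

lemma central_extension_pair_monoid:
  assumes G: "group G" and fin: "finite R" and sub: "fst ` R \<subseteq> carrier G"
    and one: "(\<one>\<^bsub>G\<^esub>, id) \<in> R"
    and mult: "\<And>s u t v. \<lbrakk>(s, u) \<in> R; (t, v) \<in> R\<rbrakk> \<Longrightarrow> (s \<otimes>\<^bsub>G\<^esub> t, u \<circ> v) \<in> R"
    and inj: "\<And>s u. (s, u) \<in> R \<Longrightarrow> inj u"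
    and gen: "carrier G = generate G S" "S \<subseteq> fst ` R"
    and cent: "\<And>u t v. \<lbrakk>(\<one>\<^bsub>G\<^esub>, u) \<in> R; (t, v) \<in> R\<rbrakk> \<Longrightarrow> u \<circ> v = v \<circ> u"
  shows "central_extension (pair_monoid G R) G fst"
proof -
  interpret G: group G by fact
  let ?K = "pair_monoid G R"
  have car: "carrier ?K = R" and one_K: "\<one>\<^bsub>?K\<^esub> = (\<one>\<^bsub>G\<^esub>, id)"
    and mult_K: "x \<otimes>\<^bsub>?K\<^esub> y = (fst x \<otimes>\<^bsub>G\<^esub> fst y, snd x \<circ> snd y)" for x y
    by (simp_all add: pair_monoid_def case_prod_beta)
  have fstG: "fst x \<in> carrier G" if "x \<in> R" for x using that sub by auto
  interpret M: monoid ?K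
  proof (rule monoidI)
    fix x y assume "x \<in> carrier ?K" "y \<in> carrier ?K"
    then show "x \<otimes>\<^bsub>?K\<^esub> y \<in> carrier ?K"
      using mult[of "fst x" "snd x" "fst y" "snd y"] unfolding car mult_K by simp
  next
    fix x y z assume "x \<in> carrier ?K" "y \<in> carrier ?K" "z \<in> carrier ?K"
    then show "x \<otimes>\<^bsub>?K\<^esub> y \<otimes>\<^bsub>?K\<^esub> z = x \<otimes>\<^bsub>?K\<^esub> (y \<otimes>\<^bsub>?K\<^esub> z)"
      unfolding car mult_K using fstG by (simp add: G.m_assoc o_assoc)
  qed (use one fstG in \<open>auto simp: car one_K mult_K\<close>)
  have rinv: "\<exists>y\<in>R. x \<otimes>\<^bsub>?K\<^esub> y = \<one>\<^bsub>?K\<^esub>" if x: "x \<in> R" for x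
  proof -
    have "inj_on (\<lambda>y. x \<otimes>\<^bsub>?K\<^esub> y) R"
    proof (rule inj_onI)
      fix y z assume y: "y \<in> R" and z: "z \<in> R" and eq: "x \<otimes>\<^bsub>?K\<^esub> y = x \<otimes>\<^bsub>?K\<^esub> z"
      have "fst y = fst z" using eq x y z fstG by (simp add: mult_K)
      moreover have "snd y = snd z"
      proof
        fix c
        have "snd x (snd y c) = snd x (snd z c)" using eq unfolding mult_K by (metis comp_apply snd_conv)
        then show "snd y c = snd z c" using inj[of "fst x" "snd x"] x by (simp add: injD)
      qed
      ultimately show "y = z" by (simp add: prod_eq_iff)
    qed
    moreover have "(\<lambda>y. x \<otimes>\<^bsub>?K\<^esub> y) ` R \<subseteq> R"
      by (rule image_subsetI) (use M.m_closed[of x] x in \<open>simp only: car\<close>)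
    ultimately have "(\<lambda>y. x \<otimes>\<^bsub>?K\<^esub> y) ` R = R" using fin endo_inj_surj by blast
    then show ?thesis using one unfolding one_K by (metis imageE)
  qed
  interpret K: group ?K
  proof (rule M.group_l_invI)
    fix x assume "x \<in> carrier ?K"
    then have x: "x \<in> R" by (simp add: car)
    then obtain y where y: "y \<in> R" "x \<otimes>\<^bsub>?K\<^esub> y = \<one>\<^bsub>?K\<^esub>" using rinv by blast
    obtain z where z: "z \<in> R" "y \<otimes>\<^bsub>?K\<^esub> z = \<one>\<^bsub>?K\<^esub>" using rinv y(1) by blast
    have "x \<otimes>\<^bsub>?K\<^esub> (y \<otimes>\<^bsub>?K\<^esub> z) = z"
      using x y z M.m_assoc[of x y z] by (simp add: car)
    then have "x = z" using x z by (simp add: car)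
    then show "\<exists>y\<in>carrier ?K. y \<otimes>\<^bsub>?K\<^esub> x = \<one>\<^bsub>?K\<^esub>" using y z by (auto simp: car)
  qed
  have hom: "fst \<in> hom ?K G" by (auto simp: hom_def car mult_K fstG)
  interpret h: group_hom ?K G fst
    using hom by (simp add: group_hom_def group_hom_axioms_def K.is_group G.is_group)
  have "subgroup (fst ` R) G" using h.img_is_subgroup by (simp add: car)
  then have "carrier G \<subseteq> fst ` R" unfolding gen(1) by (rule G.generate_subgroup_incl[OF gen(2)])
  then have surj: "fst ` carrier ?K = carrier G" using sub by (simp add: car)
  show ?thesis
  proof (rule central_extension.intro[OF h.group_hom_axioms], unfold_locales)
    show "fst ` carrier ?K = carrier G" by (rule surj)
    fix z x assume "z \<in> kernel ?K G fst" "x \<in> carrier ?K"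
    then have zx: "z \<in> R" "fst z = \<one>\<^bsub>G\<^esub>" "x \<in> R" by (simp_all add: kernel_def car)
    then have "snd z \<circ> snd x = snd x \<circ> snd z" using cent[of "snd z" "fst x" "snd x"] by (metis prod.collapse)
    then show "z \<otimes>\<^bsub>?K\<^esub> x = x \<otimes>\<^bsub>?K\<^esub> z" using fstG[OF zx(3)] zx(2) unfolding mult_K by simp
  qed
qed

lemma not_deep_of_pairs:
  assumes "group G" "finite R" "fst ` R \<subseteq> carrier G" "(\<one>\<^bsub>G\<^esub>, id) \<in> R"
    and "\<And>s u t v. \<lbrakk>(s, u) \<in> R; (t, v) \<in> R\<rbrakk> \<Longrightarrow> (s \<otimes>\<^bsub>G\<^esub> t, u \<circ> v) \<in> R"
    and "\<And>s u. (s, u) \<in> R \<Longrightarrow> inj u"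
    and "carrier G = generate G S" "S \<subseteq> fst ` R"
    and "\<And>u t v. \<lbrakk>(\<one>\<^bsub>G\<^esub>, u) \<in> R; (t, v) \<in> R\<rbrakk> \<Longrightarrow> u \<circ> v = v \<circ> u"
    and perf: "derived G (carrier G) = carrier G"
    and st: "(s, u) \<in> R" "(t, v) \<in> R" "u \<circ> v \<noteq> v \<circ> u"
  shows "{s, t} \<notin> deep_commuting_edges G"
proof -
  have "central_extension (pair_monoid G R) G fst"
    using assms(1-9) by (rule central_extension_pair_monoid)
  from not_deep_commuting_if_lifts_not_commute[OF this _ perf, of "(s, u)" "(t, v)"]
  show ?thesis using st assms(2) by (simp add: pair_monoid_def)
qed

section \<open>Gauge fields\<close>

definition ksets :: "nat \<Rightarrow> nat \<Rightarrow> nat set set" where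
  "ksets N k = {p. p \<subseteq> {1..N} \<and> card p = k}"

text \<open>A function \<open>h\<close> on ordered pairs of disjoint \<open>k\<close>-sets is regarded as a gauge field. If all
  elements of \<open>A\<^sub>n\<close> preserve it up to a gauge transformation \<open>d\<close>, then the pairs consisting of an
  element and such a transformation form an extension of \<open>A\<^sub>n\<close> by the constant functions.\<close>

locale gauge_field =
  fixes n N k :: nat and h :: "nat set \<Rightarrow> nat set \<Rightarrow> 'a :: {ab_group_add, finite}"
  assumes n_le: "n \<le> N" and k_le: "3 * k \<le> N"
    and three_cycle_lift: "s \<in> three_cycles n \<Longrightarrow>
      \<exists>d. \<forall>p\<in>ksets N k. \<forall>q\<in>ksets N k. p \<inter> q = {} \<longrightarrow> h (s ` p) (s ` q) = h p q + d p - d q"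
begin

text \<open>Requiring \<open>d\<close> to vanish off \<open>ksets N k\<close> leaves finitely many
  gauge transformations for each permutation.\<close>

definition compensates :: "(nat \<Rightarrow> nat) \<Rightarrow> (nat set \<Rightarrow> 'a) \<Rightarrow> bool" where
  "compensates s d \<longleftrightarrow> (\<forall>p. p \<notin> ksets N k \<longrightarrow> d p = 0) \<and>
     (\<forall>p\<in>ksets N k. \<forall>q\<in>ksets N k. p \<inter> q = {} \<longrightarrow> h (s ` p) (s ` q) = h p q + d p - d q)"

text \<open>A monomial matrix written additively: \<open>(p, a)\<close> stands for the basis vector
  at \<open>p\<close> times the root of unity with exponent \<open>a\<close>.\<close>

definition monomial :: "(nat \<Rightarrow> nat) \<Rightarrow> (nat set \<Rightarrow> 'a) \<Rightarrow> nat set \<times> 'a \<Rightarrow> nat set \<times> 'a" where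
  "monomial s d = (\<lambda>(p, a). (s ` p, a + d p))"

definition gauge_pairs :: "((nat \<Rightarrow> nat) \<times> (nat set \<times> 'a \<Rightarrow> nat set \<times> 'a)) set" where
  "gauge_pairs = {(s, monomial s d) | s d. s \<in> carrier (alt_group n) \<and> compensates s d}"

abbreviation "gauge_group \<equiv> pair_monoid (alt_group n) gauge_pairs"

lemma finite_ksets: "finite (ksets N k)"
  by (rule finite_subset[of _ "Pow {1..N}"]) (auto simp: ksets_def)

lemma permutes_N: "s \<in> carrier (alt_group n) \<Longrightarrow> s permutes {1..N}"
  using n_le by (auto simp: alt_group_carrier intro: permutes_subset)

lemma image_in_ksets:
  assumes "s \<in> carrier (alt_group n)"
  shows "s ` p \<in> ksets N k \<longleftrightarrow> p \<in> ksets N k"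
proof -
  have s: "s permutes {1..N}" by (rule permutes_N[OF assms])
  have "card (s ` p) = card p" using permutes_inj[OF s] by (intro card_image) (auto intro: inj_on_subset)
  moreover have "s ` p \<subseteq> {1..N} \<longleftrightarrow> p \<subseteq> {1..N}" using permutes_in_image[OF s] by blast
  ultimately show ?thesis by (simp add: ksets_def)
qed

lemma image_disjoint:
  assumes "s \<in> carrier (alt_group n)"
  shows "s ` p \<inter> s ` q = {} \<longleftrightarrow> p \<inter> q = {}"
  using permutes_inj[OF permutes_N[OF assms]] by (metis image_Int image_is_empty)

text \<open>By \<open>3 * k \<le> N\<close> any two vertices of the Kneser graph have a common
  neighbour. This is what makes a gauge transformation that fixes the field constant.\<close>

lemma common_disjoint:
  assumes "p \<in> ksets N k" "q \<in> ksets N k"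
  obtains r where "r \<in> ksets N k" "p \<inter> r = {}" "r \<inter> q = {}"
proof -
  have "card (p \<union> q) \<le> 2 * k" using assms card_Un_le[of p q] by (simp add: ksets_def)
  moreover have "card ({1..N} - (p \<union> q)) = N - card (p \<union> q)"
    using assms by (subst card_Diff_subset) (auto simp: ksets_def intro: finite_subset)
  ultimately have "k \<le> card ({1..N} - (p \<union> q))" using k_le by linarith
  then obtain r where "r \<subseteq> {1..N} - (p \<union> q)" "card r = k" using obtain_subset_with_card_n by metis
  then have "r \<in> ksets N k" "p \<inter> r = {}" "r \<inter> q = {}" by (auto simp: ksets_def)
  then show thesis by (rule that)
qed

lemma compensatesD:
  assumes "compensates s d" "p \<in> ksets N k" "q \<in> ksets N k" "p \<inter> q = {}"
  shows "h (s ` p) (s ` q) = h p q + d p - d q"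
  using assms by (simp add: compensates_def)

lemma compensates_off: "\<lbrakk>compensates s d; p \<notin> ksets N k\<rbrakk> \<Longrightarrow> d p = 0"
  by (simp add: compensates_def)

lemma compensates_comp:
  assumes s: "s \<in> carrier (alt_group n)" "compensates s d" and t: "t \<in> carrier (alt_group n)" "compensates t e"
  shows "compensates (s \<circ> t) (\<lambda>p. e p + d (t ` p))"
  unfolding compensates_def
proof (intro conjI allI ballI impI)
  fix p assume "p \<notin> ksets N k"
  then show "e p + d (t ` p) = 0"
    using compensates_off[OF s(2)] compensates_off[OF t(2)] image_in_ksets[OF t(1)] by simp
next
  fix p q assume pq: "p \<in> ksets N k" "q \<in> ksets N k" "p \<inter> q = {}"
  have "h (s ` t ` p) (s ` t ` q) = h (t ` p) (t ` q) + d (t ` p) - d (t ` q)"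
    using pq image_in_ksets[OF t(1)] image_disjoint[OF t(1)] by (intro compensatesD[OF s(2)]) auto
  also have "h (t ` p) (t ` q) = h p q + e p - e q" by (rule compensatesD[OF t(2) pq])
  finally show "h ((s \<circ> t) ` p) ((s \<circ> t) ` q) = h p q + (e p + d (t ` p)) - (e q + d (t ` q))"
    by (simp add: image_image algebra_simps)
qed

lemma monomial_comp: "monomial s d \<circ> monomial t e = monomial (s \<circ> t) (\<lambda>p. e p + d (t ` p))"
  by (auto simp: monomial_def fun_eq_iff image_comp)

lemma compensates_id_constant:
  assumes d: "compensates id d" and pq: "p \<in> ksets N k" "q \<in> ksets N k"
  shows "d p = d q"
proof -
  obtain r where r: "r \<in> ksets N k" "p \<inter> r = {}" "r \<inter> q = {}" using common_disjoint[OF pq] .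
  have "d p = d r" using compensatesD[OF d pq(1) r(1,2)] by simp
  also have "\<dots> = d q" using compensatesD[OF d r(1) pq(2) r(3)] by simp
  finally show ?thesis .
qed

lemma three_cycle_compensates:
  assumes "s \<in> three_cycles n"
  shows "\<exists>d. compensates s d"
proof -
  obtain d where d: "\<forall>p\<in>ksets N k. \<forall>q\<in>ksets N k. p \<inter> q = {} \<longrightarrow> h (s ` p) (s ` q) = h p q + d p - d q"
    using three_cycle_lift[OF assms] by blast
  then have "compensates s (\<lambda>p. if p \<in> ksets N k then d p else 0)" by (simp add: compensates_def)
  then show ?thesis by blast
qed

lemma finite_gauge_pairs: "finite gauge_pairs"
proof -
  let ?D = "{d. \<forall>p. (p \<in> ksets N k \<longrightarrow> d p \<in> (UNIV :: 'a set)) \<and> (p \<notin> ksets N k \<longrightarrow> d p = 0)}"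
  have "finite ?D" by (rule finite_set_of_finite_funs[OF finite_ksets]) simp
  then have "finite ((\<lambda>(s, d). (s, monomial s d)) ` (carrier (alt_group n) \<times> ?D))"
    using finite_alt_group by blast
  moreover have "gauge_pairs \<subseteq> (\<lambda>(s, d). (s, monomial s d)) ` (carrier (alt_group n) \<times> ?D)"
    by (auto simp: gauge_pairs_def compensates_def)
  ultimately show ?thesis by (rule finite_subset[rotated])
qed

lemma gauge_group_central_extension: "central_extension gauge_group (alt_group n) fst"
proof (rule central_extension_pair_monoid[where S = "three_cycles n"])
  show "group (alt_group n)" by (rule alt_group_is_group)
  show "finite gauge_pairs" by (rule finite_gauge_pairs)
  show "fst ` gauge_pairs \<subseteq> carrier (alt_group n)" by (auto simp: gauge_pairs_def)
  have id: "id \<in> carrier (alt_group n)"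
    using monoid.one_closed[OF group.is_monoid[OF alt_group_is_group[of n]]] by (simp add: alt_group_one)
  have "compensates id (\<lambda>_. 0)" "id = monomial id (\<lambda>_. 0)" 
    by (auto simp: compensates_def monomial_def fun_eq_iff)
  then show "(\<one>\<^bsub>alt_group n\<^esub>, id) \<in> gauge_pairs" unfolding gauge_pairs_def alt_group_one using id by blast
  show "(s \<otimes>\<^bsub>alt_group n\<^esub> t, u \<circ> v) \<in> gauge_pairs" if su: "(s, u) \<in> gauge_pairs" and tv: "(t, v) \<in> gauge_pairs" for s u t v
  proof -
    obtain d where d: "s \<in> carrier (alt_group n)" "compensates s d" "u = monomial s d"
      using su by (auto simp: gauge_pairs_def)
    obtain e where e: "t \<in> carrier (alt_group n)" "compensates t e" "v = monomial t e"
      using tv by (auto simp: gauge_pairs_def)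
    show ?thesis
      unfolding d(3) e(3) monomial_comp alt_group_mult gauge_pairs_def
      using compensates_comp[OF d(1,2) e(1,2)] monoid.m_closed[OF group.is_monoid[OF alt_group_is_group[of n]] d(1) e(1)]
      unfolding alt_group_mult by blast
  qed
  show "inj u" if "(s, u) \<in> gauge_pairs" for s u
  proof -
    obtain d where d: "s \<in> carrier (alt_group n)" "u = monomial s d" using \<open>(s, u) \<in> gauge_pairs\<close> by (auto simp: gauge_pairs_def)
    show ?thesis
      using permutes_inj[OF permutes_N[OF d(1)]] by (auto simp: d(2) inj_def monomial_def inj_image_eq_iff)
  qed
  show "carrier (alt_group n) = generate (alt_group n) (three_cycles n)"
    by (rule alt_group_carrier_as_three_cycles)
  show "three_cycles n \<subseteq> fst ` gauge_pairs"
  proof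
    fix s assume s: "s \<in> three_cycles n"
    then obtain d where "compensates s d" using three_cycle_compensates by blast
    then have "(s, monomial s d) \<in> gauge_pairs" using s three_cycles_incl unfolding gauge_pairs_def by blast
    then show "s \<in> fst ` gauge_pairs" by force
  qed
  show "u \<circ> v = v \<circ> u" if su: "(\<one>\<^bsub>alt_group n\<^esub>, u) \<in> gauge_pairs" and tv: "(t, v) \<in> gauge_pairs" for u t v
  proof -
    obtain d where d: "compensates id d" "u = monomial id d"
      using su by (auto simp: gauge_pairs_def alt_group_one)
    obtain e where e: "t \<in> carrier (alt_group n)" "compensates t e" "v = monomial t e"
      using tv by (auto simp: gauge_pairs_def)
    \<comment> \<open>\<open>d\<close> is constant on \<open>ksets N k\<close> and zero elsewhere,
      and \<open>t\<close> preserves both classes of sets.\<close>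
    have "d (t ` p) = d p" for p
      using compensates_id_constant[OF d(1)] compensates_off[OF d(1)] image_in_ksets[OF e(1), of p] by metis
    then show ?thesis unfolding d(2) e(3) monomial_comp by (simp add: add.commute)
  qed
qed

lemma kernel_card_gauge_group: "card (kernel gauge_group (alt_group n) fst) \<le> CARD('a)"
  and finite_kernel_gauge_group: "finite (kernel gauge_group (alt_group n) fst)"
proof -
  let ?f = "\<lambda>c. (id, monomial id (\<lambda>p. if p \<in> ksets N k then c else 0))"
  have "kernel gauge_group (alt_group n) fst \<subseteq> range ?f"
  proof
    fix z assume "z \<in> kernel gauge_group (alt_group n) fst"
    then obtain d where d: "z = (id, monomial id d)" "compensates id d"
      by (auto simp: kernel_def pair_monoid_def gauge_pairs_def alt_group_one)
    have "\<exists>c. d = (\<lambda>p. if p \<in> ksets N k then c else 0)"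
    proof (cases "ksets N k = {}")
      case True
      then show ?thesis using compensates_off[OF d(2)] by auto
    next
      case False
      then obtain q where "q \<in> ksets N k" by blast
      then have "d p = (if p \<in> ksets N k then d q else 0)" for p
        using compensates_off[OF d(2), of p] compensates_id_constant[OF d(2), of p q] by simp
      then have "d = (\<lambda>p. if p \<in> ksets N k then d q else 0)" by blast
      then show ?thesis by blast
    qed
    then show "z \<in> range ?f" using d(1) by blast
  qed
  then show "card (kernel gauge_group (alt_group n) fst) \<le> CARD('a)"
    by (rule surj_card_le[OF finite])
  show "finite (kernel gauge_group (alt_group n) fst)"
    using \<open>_ \<subseteq> range ?f\<close> by (rule finite_subset) simp
qed

lemma gauge_lift:
  assumes "s \<in> carrier (alt_group n)"
  obtains d where "(s, monomial s d) \<in> gauge_pairs" "compensates s d"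
proof -
  have "s \<in> fst ` carrier gauge_group"
    using central_extension.surj[OF gauge_group_central_extension] assms by simp
  then obtain d where "compensates s d" by (auto simp: pair_monoid_def gauge_pairs_def)
  moreover from this have "(s, monomial s d) \<in> gauge_pairs" using assms unfolding gauge_pairs_def by blast
  ultimately show thesis using that by blast
qed

lemma commuting_monomials:
  assumes s: "compensates s d" and t: "compensates t e"
    and comm: "monomial s d \<circ> monomial t e = monomial t e \<circ> monomial s d"
    and p: "p \<in> ksets N k" "s ` p \<in> ksets N k" "t ` p \<in> ksets N k"
    and q: "q \<in> ksets N k" "p \<inter> q = {}" "t ` p \<inter> q = {}"
    and r: "r \<in> ksets N k" "p \<inter> r = {}" "s ` p \<inter> r = {}"
  shows "h (s ` p) (s ` q) - h p q - h (s ` t ` p) (s ` q) + h (t ` p) q =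
    h (t ` p) (t ` r) - h p r - h (t ` s ` p) (t ` r) + h (s ` p) r"
proof -
  have "e p + d (t ` p) = d p + e (s ` p)"
    using fun_cong[OF comm, of "(p, 0)"] by (simp add: monomial_def add.assoc)
  then have "d p - d (t ` p) = e p - e (s ` p)" by (simp add: algebra_simps)
  moreover have "h (s ` p) (s ` q) - h p q - h (s ` t ` p) (s ` q) + h (t ` p) q = d p - d (t ` p)"
    using compensatesD[OF s p(1) q(1,2)] compensatesD[OF s p(3) q(1,3)] by simp
  moreover have "h (t ` p) (t ` r) - h p r - h (t ` s ` p) (t ` r) + h (s ` p) r = e p - e (s ` p)"
    using compensatesD[OF t p(1) r(1,2)] compensatesD[OF t p(2) r(1,3)] by simp
  ultimately show ?thesis by simp
qed

end

section \<open>The triple cover of the alternating group of degree 7\<close>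

lemma (in gauge_field) noncommuting_lifts:
  assumes s: "s \<in> carrier (alt_group n)" and t: "t \<in> carrier (alt_group n)"
    and p: "p \<in> ksets N k"
    and q: "q \<in> ksets N k" "p \<inter> q = {}" "t ` p \<inter> q = {}"
    and r: "r \<in> ksets N k" "p \<inter> r = {}" "s ` p \<inter> r = {}"
    and ne: "h (s ` p) (s ` q) - h p q - h (s ` t ` p) (s ` q) + h (t ` p) q \<noteq>
      h (t ` p) (t ` r) - h p r - h (t ` s ` p) (t ` r) + h (s ` p) r"
  obtains u v where "(s, u) \<in> gauge_pairs" "(t, v) \<in> gauge_pairs" "u \<circ> v \<noteq> v \<circ> u"
proof -
  obtain d where d: "(s, monomial s d) \<in> gauge_pairs" "compensates s d" using gauge_lift[OF s] .
  obtain e where e: "(t, monomial t e) \<in> gauge_pairs" "compensates t e" using gauge_lift[OF t] .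
  have "monomial s d \<circ> monomial t e \<noteq> monomial t e \<circ> monomial s d"
    using commuting_monomials[OF d(2) e(2) _ p _ _ q r] p ne image_in_ksets[OF s] image_in_ksets[OF t] by blast
  then show thesis using d(1) e(1) that by blast
qed

text \<open>The stabiliser of a duad in \<open>A\<^sub>7\<close> splits in the triple cover, so the latter acts monomially on the
  21 duads. An invariant field is determined up to gauge by its holonomies, which are trivial on
  triangles and equal to the sign of the permutation \<open>a b c d e f g\<close> on the 4-cycle
  \<open>ab, de, ac, df\<close> (up to a common factor). The solution below, expressed by Legendre symbols modulo 7,
  is strictly equivariant under the affine group of the field with seven elements.\<close>

definition legendre7 :: "int \<Rightarrow> int" where
  "legendre7 x = (let y = x mod 7 in if y = 0 then 0 else if y = 1 \<or> y = 2 \<or> y = 4 then 1 else - 1)"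

definition phase :: "int \<Rightarrow> int \<Rightarrow> int \<Rightarrow> int \<Rightarrow> int" where
  "phase i j k l =
     (let e = legendre7 (i - k) + legendre7 (i - l) + legendre7 (j - k) + legendre7 (j - l)
      in if e = 0 then legendre7 (i + j - k - l) else e)"

text \<open>Set version of \<open>phase\<close>, with values modulo 3. Points are residues modulo 7,
  the label 7 being zero, and the sums make the value independent of how a duad is listed. The
  integer version serves evaluation.\<close>

definition duad_phase :: "nat set \<Rightarrow> nat set \<Rightarrow> 3" where
  "duad_phase p q = of_int
     (let e = \<Sum>i\<in>p. \<Sum>k\<in>q. legendre7 (int i - int k)
      in if e = 0 then legendre7 (int (\<Sum>p) - int (\<Sum>q)) else e)"

lemma duad_phase_doubleton:
  assumes "i \<noteq> j" "k \<noteq> l"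
  shows "duad_phase {i, j} {k, l} = of_int (phase (int i) (int j) (int k) (int l))"
  using assms by (simp add: duad_phase_def phase_def Let_def algebra_simps)

text \<open>The compensating function of the transposition \<open>(a b)\<close> is found by integrating the change of
  the phase along paths from the duad \<open>{a, b}\<close>.\<close>

definition transposition_shift :: "int \<Rightarrow> int \<Rightarrow> int \<Rightarrow> int \<Rightarrow> int" where
  "transposition_shift a b i j =
     (if i \<noteq> a \<and> i \<noteq> b \<and> j \<noteq> a \<and> j \<noteq> b then - phase i j a b
      else let c = (if i = a \<or> i = b then j else i) in
        if c = a \<or> c = b then 0
        else if legendre7 (c - a) = legendre7 (b - c) \<and> legendre7 (b - c) = legendre7 (a - b)
          then legendre7 (a + b - 2 * c) else 0)"

section \<open>Odd permutations reverse the phase up to gauge\<close>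

definition duad_list :: "(int \<times> int) list" where
  "duad_list = concat (map (\<lambda>i. map (Pair i) [i + 1..7]) [1..7])"

lemma duad_listI: "\<lbrakk>1 \<le> i; i < j; j \<le> 7\<rbrakk> \<Longrightarrow> (i, j) \<in> set duad_list"
  unfolding duad_list_def by (auto intro!: bexI[of _ i])

definition swap_int :: "int \<Rightarrow> int \<Rightarrow> int \<Rightarrow> int" where
  "swap_int a b x = (if x = a then b else if x = b then a else x)"

text \<open>A transposition negates the field up to the gauge \<open>transposition_shift\<close>,
  matching the fact that odd permutations invert the centre of order 3 of the triple cover. All 21
  transpositions and all ordered pairs of disjoint duads are evaluated.\<close>

lemma transposition_shift_check:
  "list_all (\<lambda>(a, b). list_all (\<lambda>(i, j). list_all (\<lambda>(k, l).
     (i = k \<or> i = l \<or> j = k \<or> j = l \<or>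
      (phase (swap_int a b i) (swap_int a b j) (swap_int a b k) (swap_int a b l) + phase i j k l
        - transposition_shift a b i j + transposition_shift a b k l) mod 3 = 0))
     duad_list) duad_list) duad_list"
  by code_simp

lemma of_int_3_eq_0: "x mod 3 = 0 \<Longrightarrow> (of_int x :: 3) = 0"
proof -
  assume "x mod 3 = 0"
  then obtain y where "x = 3 * y" by (auto simp: mod_eq_0_iff_dvd)
  then have "(of_int x :: 3) = 3 * of_int y" by simp
  also have "(3 :: 3) = 0" by simp
  finally show ?thesis by simp
qed

lemma ksets_7_2E:
  assumes "p \<in> ksets 7 2"
  obtains i j where "p = {i, j}" "i < j" "1 \<le> i" "j \<le> 7" "(int i, int j) \<in> set duad_list"
proof -
  have "card p = 2" "p \<subseteq> {1..7}" using assms by (auto simp: ksets_def)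
  then obtain i j where "p = {i, j}" "i \<noteq> j" by (auto simp: card_2_iff)
  then obtain i j where ij: "p = {i, j}" "i < j" by (metis insert_commute linorder_neqE_nat)
  then have "1 \<le> i" "j \<le> 7" using \<open>p \<subseteq> {1..7}\<close> by auto
  then have "(int i, int j) \<in> set duad_list" using ij by (intro duad_listI) auto
  then show thesis using that ij \<open>1 \<le> i\<close> \<open>j \<le> 7\<close> by blast
qed

lemma transposition_twists_phase_less:
  assumes ab: "(a::nat) < b" "1 \<le> a" "b \<le> 7"
  shows "\<exists>d. \<forall>p\<in>ksets 7 2. \<forall>q\<in>ksets 7 2. p \<inter> q = {} \<longrightarrow>
    duad_phase (transpose a b ` p) (transpose a b ` q) = - duad_phase p q + d p - d q"
proof (intro exI ballI impI)
  fix p q :: "nat set"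
  assume p: "p \<in> ksets 7 2" and q: "q \<in> ksets 7 2" and disj: "p \<inter> q = {}"
  obtain i j where ij: "p = {i, j}" "i < j" "(int i, int j) \<in> set duad_list" using ksets_7_2E[OF p] by metis
  obtain k l where kl: "q = {k, l}" "k < l" "(int k, int l) \<in> set duad_list" using ksets_7_2E[OF q] by metis
  have abL: "(int a, int b) \<in> set duad_list" using ab by (intro duad_listI) auto
  have sw: "swap_int (int a) (int b) (int x) = int (transpose a b x)" for x
    by (simp add: swap_int_def transpose_def)
  let ?f = "\<lambda>x. int (transpose a b x)"
  have "(phase (?f i) (?f j) (?f k) (?f l) + phase (int i) (int j) (int k) (int l)
      - transposition_shift (int a) (int b) (int i) (int j) + transposition_shift (int a) (int b) (int k) (int l)) mod 3 = 0"
    (is "?x mod 3 = 0")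
    using transposition_shift_check[unfolded list_all_iff, THEN bspec, OF abL, unfolded prod.case,
        THEN bspec, OF ij(3), unfolded prod.case, THEN bspec, OF kl(3), unfolded prod.case]
      ij(1) kl(1) disj unfolding sw by simp
  then have "(of_int ?x :: 3) = 0" by (rule of_int_3_eq_0)
  moreover have ne: "transpose a b i \<noteq> transpose a b j" "transpose a b k \<noteq> transpose a b l"
    using ij kl by (auto simp: transpose_eq_iff)
  \<comment> \<open>The shift was checked for duads listed increasingly; \<open>Min\<close> and
    \<open>Max\<close> recover that order from the set.\<close>
  ultimately show "duad_phase (transpose a b ` p) (transpose a b ` q) = - duad_phase p q +
      (\<lambda>p. of_int (transposition_shift (int a) (int b) (int (Min p)) (int (Max p)))) p -
      (\<lambda>p. of_int (transposition_shift (int a) (int b) (int (Min p)) (int (Max p)))) q"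
    using ij kl by (simp add: duad_phase_doubleton min_absorb1 max_absorb2 algebra_simps)
qed

lemma transposition_twists_phase:
  assumes "a \<in> {1..7::nat}" "b \<in> {1..7}" "a \<noteq> b"
  shows "\<exists>d. \<forall>p\<in>ksets 7 2. \<forall>q\<in>ksets 7 2. p \<inter> q = {} \<longrightarrow>
    duad_phase (transpose a b ` p) (transpose a b ` q) = - duad_phase p q + d p - d q"
  using transposition_twists_phase_less[of a b] transposition_twists_phase_less[of b a] assms
  by (cases "a < b") (auto simp: transpose_commute)

lemma transpose_in_ksets:
  assumes "a \<in> {1..N::nat}" "b \<in> {1..N}" "p \<in> ksets N k"
  shows "transpose a b ` p \<in> ksets N k"
proof -
  have "card (transpose a b ` p) = card p" by (intro card_image) simp
  then show ?thesis using assms by (auto simp: ksets_def transpose_def)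
qed

text \<open>A 3-cycle is a product of two transpositions. Their two sign changes cancel and their
  gauge functions combine.\<close>

lemma gauge_field_duad_phase:
  assumes "n \<le> 7"
  shows "gauge_field n 7 2 duad_phase"
proof
  fix s assume "s \<in> three_cycles n"
  then obtain cs where cs: "s = cycle_of_list cs" "cycle cs" "length cs = 3" "set cs \<subseteq> {1..n}" by auto
  obtain a b c where abc: "cs = [a, b, c]" using stupid_lemma[OF cs(3)] by auto
  have ab: "a \<in> {1..7}" "b \<in> {1..7}" "c \<in> {1..7}" "a \<noteq> b" "b \<noteq> c" using cs assms unfolding abc by auto
  have s: "s = transpose a b \<circ> transpose b c" using cs(1) unfolding abc by simp
  obtain d where d: "\<And>p q. \<lbrakk>p \<in> ksets 7 2; q \<in> ksets 7 2; p \<inter> q = {}\<rbrakk> \<Longrightarrow>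
    duad_phase (transpose a b ` p) (transpose a b ` q) = - duad_phase p q + d p - d q"
    using transposition_twists_phase[OF ab(1,2,4)] by blast
  obtain e where e: "\<And>p q. \<lbrakk>p \<in> ksets 7 2; q \<in> ksets 7 2; p \<inter> q = {}\<rbrakk> \<Longrightarrow>
    duad_phase (transpose b c ` p) (transpose b c ` q) = - duad_phase p q + e p - e q"
    using transposition_twists_phase[OF ab(2,3,5)] by blast
  show "\<exists>d. \<forall>p\<in>ksets 7 2. \<forall>q\<in>ksets 7 2. p \<inter> q = {} \<longrightarrow> duad_phase (s ` p) (s ` q) = duad_phase p q + d p - d q"
  proof (intro exI ballI impI)
    fix p q :: "nat set" assume pq: "p \<in> ksets 7 2" "q \<in> ksets 7 2" "p \<inter> q = {}"
    have "transpose b c ` p \<inter> transpose b c ` q = {}" using pq(3) by (auto simp: transpose_eq_iff)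
    then have "duad_phase (s ` p) (s ` q) =
        - duad_phase (transpose b c ` p) (transpose b c ` q) + d (transpose b c ` p) - d (transpose b c ` q)"
      unfolding s using d[of "transpose b c ` p" "transpose b c ` q"] pq transpose_in_ksets[OF ab(2,3)] by (simp add: image_image)
    then show "duad_phase (s ` p) (s ` q) = duad_phase p q +
       (\<lambda>p. d (transpose b c ` p) - e p) p - (\<lambda>p. d (transpose b c ` p) - e p) q"
      using e[OF pq] by simp
  qed
qed (use assms in auto)

text \<open>The obstruction in \<open>noncommuting_lifts\<close> for the 3-cycles \<open>(a b c)\<close> and \<open>(d e f)\<close>. It is
  gauge invariant, so any permutation of the labels can only change its sign.\<close>

definition holonomy :: "nat \<Rightarrow> nat \<Rightarrow> nat \<Rightarrow> nat \<Rightarrow> nat \<Rightarrow> nat \<Rightarrow> 3" where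
  "holonomy a b c d e f =
     (duad_phase {b, d} {c, a} - duad_phase {a, d} {b, c} - duad_phase {b, e} {c, a} + duad_phase {a, e} {b, c})
   - (duad_phase {a, e} {f, d} - duad_phase {a, d} {e, f} - duad_phase {b, e} {f, d} + duad_phase {b, d} {e, f})"

lemma holonomy_transpose:
  assumes xy: "x \<in> {1..7::nat}" "y \<in> {1..7}" "x \<noteq> y"
    and a: "{a, b, c, d, e, f} \<subseteq> {1..7}" "distinct [a, b, c, d, e, f]"
  defines "t \<equiv> transpose x y"
  shows "holonomy (t a) (t b) (t c) (t d) (t e) (t f) = - holonomy a b c d e f"
proof -
  obtain g where g: "\<And>p q. \<lbrakk>p \<in> ksets 7 2; q \<in> ksets 7 2; p \<inter> q = {}\<rbrakk> \<Longrightarrow>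
    duad_phase (t ` p) (t ` q) = - duad_phase p q + g p - g q"
    unfolding t_def using transposition_twists_phase[OF xy] by blast
  have g4: "duad_phase {t i, t j} {t k, t l} = - duad_phase {i, j} {k, l} + g {i, j} - g {k, l}"
    if "{i, j, k, l} \<subseteq> {1..7}" "distinct [i, j, k, l]" for i j k l
    using g[of "{i, j}" "{k, l}"] that by (simp add: ksets_def)
  have "duad_phase {t b, t d} {t c, t a} = - duad_phase {b, d} {c, a} + g {b, d} - g {c, a}"
    "duad_phase {t a, t d} {t b, t c} = - duad_phase {a, d} {b, c} + g {a, d} - g {b, c}"
    "duad_phase {t b, t e} {t c, t a} = - duad_phase {b, e} {c, a} + g {b, e} - g {c, a}"
    "duad_phase {t a, t e} {t b, t c} = - duad_phase {a, e} {b, c} + g {a, e} - g {b, c}"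
    "duad_phase {t a, t e} {t f, t d} = - duad_phase {a, e} {f, d} + g {a, e} - g {f, d}"
    "duad_phase {t a, t d} {t e, t f} = - duad_phase {a, d} {e, f} + g {a, d} - g {e, f}"
    "duad_phase {t b, t e} {t f, t d} = - duad_phase {b, e} {f, d} + g {b, e} - g {f, d}"
    "duad_phase {t b, t d} {t e, t f} = - duad_phase {b, d} {e, f} + g {b, d} - g {e, f}"
    by (rule g4; use a in \<open>simp; blast?\<close>)+
  note eqs = this
  show ?thesis unfolding holonomy_def eqs by (simp add: algebra_simps)
qed

lemma holonomy_base: "holonomy 1 2 3 4 5 6 \<noteq> 0"
  by (simp add: holonomy_def duad_phase_doubleton phase_def legendre7_def Let_def)

lemma holonomy_permutes:
  assumes "s permutes {1..7}"
  shows "holonomy (s 1) (s 2) (s 3) (s 4) (s 5) (s 6) \<noteq> 0"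
  using assms finite_atLeastAtMost
proof (induction s rule: permutes_induct)
  case (swap x y s)
  have "{s 1, s 2, s 3, s 4, s 5, s 6} \<subseteq> {1..7}"
    using permutes_in_image[OF \<open>s permutes _\<close>] by auto
  moreover have "distinct [s 1, s 2, s 3, s 4, s 5, s 6]"
    using permutes_inj[OF \<open>s permutes _\<close>] by (simp add: inj_eq)
  ultimately have "holonomy (transpose x y (s 1)) (transpose x y (s 2)) (transpose x y (s 3))
      (transpose x y (s 4)) (transpose x y (s 5)) (transpose x y (s 6)) = - holonomy (s 1) (s 2) (s 3) (s 4) (s 5) (s 6)"
    using swap.hyps by (intro holonomy_transpose) auto
  then show ?case using swap.IH by (metis comp_apply neg_equal_0_iff_equal)
qed (use holonomy_base in auto)

text \<open>Together with the one missing label, the six points form a permutation of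
  \<open>{1..7}\<close>, so the value is that at \<open>1 2 3 4 5 6\<close> up to sign.\<close>

lemma holonomy_nonzero:
  assumes "{a, b, c, d, e, f} \<subseteq> {1..7}" "distinct [a, b, c, d, e, f]"
  shows "holonomy a b c d e f \<noteq> 0"
proof -
  have "card {a, b, c, d, e, f} = 6" using assms(2) by simp
  then have "card ({1..7} - {a, b, c, d, e, f}) = 1" using assms(1) by (subst card_Diff_subset) auto
  then obtain g where g: "{1..7} - {a, b, c, d, e, f} = {g}" by (auto simp: card_1_singleton_iff)
  define s where "s = (\<lambda>k::nat. if k = 1 then a else if k = 2 then b else if k = 3 then c else
    if k = 4 then d else if k = 5 then e else if k = 6 then f else if k = 7 then g else k)"
  have seven: "{1..7::nat} = {1, 2, 3, 4, 5, 6, 7}" by auto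
  have img: "s ` {1..7} = {1..7}"
  proof -
    have "s ` {1..7} = {a, b, c, d, e, f, g}" unfolding seven s_def by (simp add: insert_commute)
    also have "\<dots> = ({1..7} - {a, b, c, d, e, f}) \<union> {a, b, c, d, e, f}" unfolding g by auto
    also have "\<dots> = {1..7}" unfolding Un_commute[of "{1..7} - _"] by (rule Diff_partition[OF assms(1)])
    finally show ?thesis .
  qed
  have "s permutes {1..7}"
  proof (rule bij_imp_permutes)
    show "bij_betw s {1..7} {1..7}" unfolding bij_betw_def using img eq_card_imp_inj_on[of "{1..7}" s] by simp
    show "s x = x" if "x \<notin> {1..7}" for x using that by (auto simp: s_def)
  qed
  from holonomy_permutes[OF this] show ?thesis by (simp add: s_def)
qed

lemma three_cycles_not_deep:
  assumes n: "5 \<le> n" "n \<le> 7" and a: "{a, b, c, d, e, f} \<subseteq> {1..n}" "distinct [a, b, c, d, e, f]"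
  shows "{transpose a b \<circ> transpose b c, transpose d e \<circ> transpose e f} \<notin> deep_commuting_edges (alt_group n)"
proof -
  interpret gauge_field n 7 2 duad_phase by (rule gauge_field_duad_phase[OF n(2)])
  have a7: "{a, b, c, d, e, f} \<subseteq> {1..7}" using a n by auto
  let ?s = "transpose a b \<circ> transpose b c" and ?t = "transpose d e \<circ> transpose e f"
  have "?s \<in> three_cycles n" by (intro CollectI exI[of _ "[a, b, c]"]) (use a in auto)
  moreover have "?t \<in> three_cycles n" by (intro CollectI exI[of _ "[d, e, f]"]) (use a in auto)
  ultimately have st: "?s \<in> carrier (alt_group n)" "?t \<in> carrier (alt_group n)" using three_cycles_incl by blast+
  have img: "?s a = b" "?s b = c" "?s c = a" "?s d = d" "?s e = e" "?s f = f"
    "?t a = a" "?t b = b" "?t c = c" "?t d = e" "?t e = f" "?t f = d"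
    using a by (auto simp: transpose_def)
  obtain u v where uv: "(?s, u) \<in> gauge_pairs" "(?t, v) \<in> gauge_pairs" "u \<circ> v \<noteq> v \<circ> u"
  \<comment> \<open>\<open>{b, c}\<close> avoids \<open>{a, d}\<close> and its image
    \<open>{a, e}\<close> under the second cycle; \<open>{e, f}\<close> avoids \<open>{a, d}\<close>
    and its image \<open>{b, d}\<close> under the first. The resulting obstruction is exactly
    \<open>holonomy\<close>.\<close>
  proof (rule noncommuting_lifts[OF st, of "{a, d}" "{b, c}" "{e, f}"])
    have "holonomy a b c d e f \<noteq> 0" by (rule holonomy_nonzero[OF a7 a(2)])
    then show "duad_phase (?s ` {a, d}) (?s ` {b, c}) - duad_phase {a, d} {b, c}
        - duad_phase (?s ` ?t ` {a, d}) (?s ` {b, c}) + duad_phase (?t ` {a, d}) {b, c}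
      \<noteq> duad_phase (?t ` {a, d}) (?t ` {e, f}) - duad_phase {a, d} {e, f}
        - duad_phase (?t ` ?s ` {a, d}) (?t ` {e, f}) + duad_phase (?s ` {a, d}) {e, f}"
      unfolding holonomy_def image_insert image_empty img by simp
  qed (use a7 a(2) in \<open>auto simp: ksets_def img simp del: comp_apply\<close>)
  have "finite (carrier gauge_group)" using finite_gauge_pairs by (simp add: pair_monoid_def)
  from not_deep_commuting_if_lifts_not_commute[OF gauge_group_central_extension this
      derived_alt_group_const[OF n(1)], of "(?s, u)" "(?t, v)"]
  show ?thesis using uv by (simp add: pair_monoid_def)
qed

section \<open>The alternating group of degree 4\<close>

text \<open>For \<open>i \<noteq> j\<close>, \<open>arrow i j\<close> holds iff \<open>det (v\<^sub>i, v\<^sub>j) = 1\<close> for suitable representatives \<open>v\<^sub>1, \<dots>, v\<^sub>4\<close> of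
  the four lines of the plane over the field with three elements. The gauge group of this field is
  therefore \<open>SL\<^sub>2(3)\<close>, the double cover of \<open>A\<^sub>4\<close>.\<close>

definition arrow :: "nat \<Rightarrow> nat \<Rightarrow> bool" where
  "arrow i j \<longleftrightarrow> i = 4 \<or> i = 1 \<and> j = 2 \<or> i = 2 \<and> j = 3 \<or> i = 3 \<and> j = 1"

text \<open>The determinant 1 or -1 of two line representatives, written additively modulo
  2.\<close>

definition point_phase :: "nat set \<Rightarrow> nat set \<Rightarrow> 2" where
  "point_phase p q = of_bool (\<not> arrow (the_elem p) (the_elem q))"

lemma of_bool_2: "(of_bool (x \<noteq> y) :: 2) = of_bool x + of_bool y" "(- of_bool x :: 2) = of_bool x"
  by (cases x; cases y; simp)+

lemma ksets_1: "p \<in> ksets N 1 \<longleftrightarrow> (\<exists>i\<in>{1..N}. p = {i})"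
  by (auto simp: ksets_def card_1_singleton_iff)

text \<open>The switching is forced once it is false at 4: \<open>arrow i 4\<close> fails for every
  other \<open>i\<close>, so the pair \<open>i\<close>, 4 determines \<open>d i\<close>. What
  remains is a finite check.\<close>

lemma three_cycle_switches_arrow:
  assumes "{a, b, c} \<subseteq> {1..4}" "distinct [a, b, c]" "i \<in> {1..4}" "j \<in> {1..4}" "i \<noteq> j"
  defines "s \<equiv> transpose a b \<circ> transpose b c"
  defines "d \<equiv> \<lambda>i. i \<noteq> 4 \<and> arrow (s i) (s 4)"
  shows "arrow (s i) (s j) \<longleftrightarrow> (arrow i j \<noteq> (d i \<noteq> d j))"
proof -
  have four: "x \<in> {1..4} \<Longrightarrow> x = 1 \<or> x = 2 \<or> x = 3 \<or> x = 4" for x :: nat by auto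
  have a: "a = 1 \<or> a = 2 \<or> a = 3 \<or> a = 4" and b: "b = 1 \<or> b = 2 \<or> b = 3 \<or> b = 4"
    and c: "c = 1 \<or> c = 2 \<or> c = 3 \<or> c = 4" and i: "i = 1 \<or> i = 2 \<or> i = 3 \<or> i = 4"
    and j: "j = 1 \<or> j = 2 \<or> j = 3 \<or> j = 4" and "a \<noteq> b" "a \<noteq> c" "b \<noteq> c"
    using assms(1-4) four by auto
  from a b c \<open>a \<noteq> b\<close> \<open>a \<noteq> c\<close> \<open>b \<noteq> c\<close> show ?thesis
    apply (elim disjE)
    apply (simp_all only: d_def s_def)
    using i j assms(5)
    apply (elim disjE; simp add: arrow_def transpose_def)+
    done
qed

lemma gauge_field_point_phase: "gauge_field 4 4 1 point_phase"
proof
  fix s assume "s \<in> three_cycles 4"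
  then obtain cs where cs: "s = cycle_of_list cs" "cycle cs" "length cs = 3" "set cs \<subseteq> {1..4}" by auto
  obtain a b c where abc: "cs = [a, b, c]" using stupid_lemma[OF cs(3)] by auto
  have s: "s = transpose a b \<circ> transpose b c" using cs(1) unfolding abc by simp
  define d where "d i \<longleftrightarrow> i \<noteq> 4 \<and> arrow (s i) (s 4)" for i
  have sw: "arrow (s i) (s j) \<longleftrightarrow> (arrow i j \<noteq> (d i \<noteq> d j))"
    if "i \<in> {1..4}" "j \<in> {1..4}" "i \<noteq> j" for i j
    using three_cycle_switches_arrow[of a b c i j, folded s] cs(2,4) that unfolding abc d_def by auto
  show "\<exists>d. \<forall>p\<in>ksets 4 1. \<forall>q\<in>ksets 4 1. p \<inter> q = {} \<longrightarrow> point_phase (s ` p) (s ` q) = point_phase p q + d p - d q"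
  proof (intro exI ballI impI)
    fix p q :: "nat set" assume pq: "p \<in> ksets 4 1" "q \<in> ksets 4 1" "p \<inter> q = {}"
    then obtain i j where ij: "p = {i}" "q = {j}" "i \<in> {1..4}" "j \<in> {1..4}" "i \<noteq> j" unfolding ksets_1 by auto
    have "(\<not> arrow (s i) (s j)) = ((\<not> arrow i j) \<noteq> (d i \<noteq> d j))" using sw[OF ij(3-5)] by blast
    then have "(of_bool (\<not> arrow (s i) (s j)) :: 2) = of_bool (\<not> arrow i j) + of_bool (d i) - of_bool (d j)"
      by (simp only: of_bool_2 diff_conv_add_uminus add.assoc)
    then show "point_phase (s ` p) (s ` q) = point_phase p q + (\<lambda>p. of_bool (d (the_elem p))) p - (\<lambda>p. of_bool (d (the_elem p))) q"
      by (simp add: point_phase_def ij)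
  qed
qed auto

text \<open>The commutator of noncommuting lifts of commuting elements is a nontrivial kernel
  element inside [H,H]. A kernel with at most two elements contains nothing else besides the
  identity.\<close>

lemma (in central_extension) kernel_of_order_2:
  assumes x: "x \<in> carrier H" and y: "y \<in> carrier H" and ne: "x \<otimes> y \<noteq> y \<otimes> x"
    and comm: "\<pi> x \<otimes>\<^bsub>G\<^esub> \<pi> y = \<pi> y \<otimes>\<^bsub>G\<^esub> \<pi> x"
    and ker: "finite (kernel H G \<pi>)" "card (kernel H G \<pi>) \<le> 2"
  shows "kernel H G \<pi> \<subseteq> derived H (carrier H)" and "card (kernel H G \<pi>) = 2"
proof -
  define z where "z = x \<otimes> y \<otimes> inv x \<otimes> inv y"
  have zH: "z \<in> carrier H" unfolding z_def using x y by simp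
  have z1: "z \<noteq> \<one>"
  proof
    assume "z = \<one>"
    then have "z \<otimes> y \<otimes> x = y \<otimes> x" using x y by simp
    moreover have "z \<otimes> y \<otimes> x = x \<otimes> y" unfolding z_def using x y by (simp add: G.m_assoc)
    ultimately show False using ne by simp
  qed
  have "\<pi> z = \<pi> x \<otimes>\<^bsub>G\<^esub> \<pi> y \<otimes>\<^bsub>G\<^esub> inv\<^bsub>G\<^esub> \<pi> x \<otimes>\<^bsub>G\<^esub> inv\<^bsub>G\<^esub> \<pi> y"
    unfolding z_def using x y by simp
  also have "\<dots> = \<one>\<^bsub>G\<^esub>" unfolding comm using x y by (simp add: H.m_assoc)
  finally have zker: "z \<in> kernel H G \<pi>" using zH by (simp add: kernel_def)
  have one: "\<one> \<in> kernel H G \<pi>" by (simp add: kernel_def)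
  have eq: "{\<one>, z} = kernel H G \<pi>"
    by (rule card_seteq[OF ker(1)]) (use one zker z1 ker(2) in auto)
  then show "card (kernel H G \<pi>) = 2" using z1 by (metis card_2_iff)
  have "z \<in> derived H (carrier H)"
    unfolding derived_def z_def using x y by (intro generate.incl) blast
  moreover have "\<one> \<in> derived H (carrier H)" unfolding derived_def by (rule generate.one)
  ultimately show "kernel H G \<pi> \<subseteq> derived H (carrier H)" unfolding eq[symmetric] by simp
qed

text \<open>Two generators of the four-group have noncommuting lifts in the gauge group. This makes
  the latter a stem extension with kernel of order 2, and maximality carries the bound over to
  \<open>H\<close>.\<close>

lemma schur_cover_alt4_kernel:
  assumes H: "schur_cover (alt_group 4) H \<pi>"
  shows "card (kernel H (alt_group 4) \<pi>) \<ge> 2"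
proof -
  interpret gauge_field 4 4 1 point_phase by (rule gauge_field_point_phase)
  let ?K = gauge_group
  interpret K: central_extension ?K "alt_group 4" fst by (rule gauge_group_central_extension)
  let ?s = "transpose 1 2 \<circ> transpose 3 (4::nat)" and ?t = "transpose 1 3 \<circ> transpose 2 (4::nat)"
  have st: "?s \<in> carrier (alt_group 4)" "?t \<in> carrier (alt_group 4)"
    by (rule transpositions_in_alt_group; simp)+
  have img: "?s 1 = 2" "?s 2 = 1" "?s 3 = 4" "?t 1 = 3" "?t 2 = 4" "?t 3 = 1" by (simp_all add: transpose_def)
  obtain u v where uv: "(?s, u) \<in> gauge_pairs" "(?t, v) \<in> gauge_pairs" "u \<circ> v \<noteq> v \<circ> u"
  \<comment> \<open>\<open>{2}\<close> avoids \<open>{1}\<close> and its image \<open>{3}\<close>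
    under the second involution; \<open>{3}\<close> avoids \<open>{1}\<close> and its image
    \<open>{2}\<close> under the first.\<close>
  proof (rule noncommuting_lifts[OF st, of "{1}" "{2}" "{3}"])
    show "point_phase (?s ` {1}) (?s ` {2}) - point_phase {1} {2} - point_phase (?s ` ?t ` {1}) (?s ` {2}) + point_phase (?t ` {1}) {2}
      \<noteq> point_phase (?t ` {1}) (?t ` {3}) - point_phase {1} {3} - point_phase (?t ` ?s ` {1}) (?t ` {3}) + point_phase (?s ` {1}) {3}"
      unfolding image_insert image_empty img by (simp add: point_phase_def arrow_def)
  qed (unfold ksets_1, auto simp: img[unfolded comp_apply])
  have comm: "?s \<circ> ?t = ?t \<circ> ?s" by (auto simp: fun_eq_iff transpose_def)
  have "card (kernel ?K (alt_group 4) fst) \<le> 2" using kernel_card_gauge_group by simp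
  then have stem: "kernel ?K (alt_group 4) fst \<subseteq> derived ?K (carrier ?K)"
    and two: "card (kernel ?K (alt_group 4) fst) = 2"
    using K.kernel_of_order_2[of "(?s, u)" "(?t, v)"] uv finite_kernel_gauge_group comm
    by (auto simp: pair_monoid_def alt_group_mult simp del: comp_apply)
  have "card (kernel ?K (alt_group 4) fst) \<le> card (kernel H (alt_group 4) \<pi>)"
    by (rule K.kernel_card_le_schur_cover[OF _ stem H]) (use finite_gauge_pairs in \<open>simp add: pair_monoid_def\<close>)
  then show ?thesis unfolding two .
qed

text \<open>The transfer goes into the preimage of \<open>B\<close>, which \<open>comm\<close> makes
  abelian and which has the same index \<open>m\<close> as \<open>B\<close>.\<close>

lemma (in central_extension) kernel_power_eq_one:
  assumes fin: "finite (carrier H)" and B: "subgroup B G"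
    and comm: "\<And>x y. \<lbrakk>x \<in> carrier H; y \<in> carrier H; \<pi> x \<in> B; \<pi> y \<in> B\<rbrakk> \<Longrightarrow> x \<otimes> y = y \<otimes> x"
    and idx: "card (carrier G) = m * card B"
    and z: "z \<in> kernel H G \<pi>" "z \<in> derived H (carrier H)"
  shows "z [^] m = \<one>"
proof -
  let ?A = "{x \<in> carrier H. \<pi> x \<in> B}"
  have BG: "B \<subseteq> carrier G" by (rule subgroup.subset[OF B])
  have A: "subgroup ?A H"
    by (rule G.subgroupI) (use subgroup.one_closed[OF B] subgroup.m_closed[OF B] subgroup.m_inv_closed[OF B] in auto)
  have "card ?A = card B * card (kernel H G \<pi>)" by (rule card_vimage[OF fin surj BG])
  moreover have "card (rcosets ?A) * card ?A = card (carrier G) * card (kernel H G \<pi>)"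
    using G.lagrange[OF A] card_carrier[OF fin surj] by (simp add: order_def)
  moreover have "card ?A > 0" using A fin by (metis (no_types, lifting) card_gt_0_iff empty_iff finite_subset subgroup.one_closed subgroup.subset)
  ultimately have m: "card (rcosets ?A) = m" using idx by simp
  have "z [^] card (rcosets ?A) = \<one>"
  proof (rule G.transfer_power_eq_one[OF fin A])
    show "a \<otimes> b = b \<otimes> a" if "a \<in> ?A" "b \<in> ?A" for a b using comm that by blast
    show "z \<otimes> g = g \<otimes> z" if "g \<in> carrier H" for g using central[OF z(1) that] .
    show "z \<in> ?A" using z(1) subgroup.one_closed[OF B] by (simp add: kernel_def)
    show "z \<in> derived H (carrier H)" by (rule z(2))
  qed
  then show ?thesis unfolding m .
qed

section \<open>Subgroups of orders 4 and 3, and the transfer argument in degree 4\<close>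

lemma (in group) klein_subgroup:
  assumes s: "s \<in> carrier G" "s \<otimes> s = \<one>" and t: "t \<in> carrier G" "t \<otimes> t = \<one>" and st: "s \<otimes> t = t \<otimes> s"
  shows "subgroup {\<one>, s, t, s \<otimes> t} G"
proof (rule subgroupI)
  have 1: "s \<otimes> (s \<otimes> t) = t" "t \<otimes> (t \<otimes> s) = s"
    using s t by (simp_all add: m_assoc[symmetric])
  have 2: "t \<otimes> (s \<otimes> t) = s" using 1(2) st by simp
  have 3: "s \<otimes> t \<otimes> s = t" "s \<otimes> t \<otimes> t = s" "s \<otimes> t \<otimes> (s \<otimes> t) = \<one>" "t \<otimes> s = s \<otimes> t"
    using s t st 1 2 by (simp_all add: m_assoc)
  show "u \<otimes> v \<in> {\<one>, s, t, s \<otimes> t}" if "u \<in> {\<one>, s, t, s \<otimes> t}" "v \<in> {\<one>, s, t, s \<otimes> t}" for u v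
    using that s t by (elim insertE emptyE) (simp_all add: 1(1) 2 3)
  have i: "u \<otimes> u = \<one>" if "u \<in> {\<one>, s, t, s \<otimes> t}" for u using that s t 3(3) by auto
  show "inv u \<in> {\<one>, s, t, s \<otimes> t}" if "u \<in> {\<one>, s, t, s \<otimes> t}" for u
    using inv_equality[OF i[OF that]] that s t by auto
qed (use s t in auto)

lemma (in group) order_3_subgroup:
  assumes r: "r \<in> carrier G" "r \<otimes> (r \<otimes> r) = \<one>"
  shows "subgroup {\<one>, r, r \<otimes> r} G"
proof (rule subgroupI)
  have 1: "r \<otimes> r \<otimes> r = \<one>" "r \<otimes> r \<otimes> (r \<otimes> r) = r" using r by (simp_all add: m_assoc)
  show "u \<otimes> v \<in> {\<one>, r, r \<otimes> r}" if "u \<in> {\<one>, r, r \<otimes> r}" "v \<in> {\<one>, r, r \<otimes> r}" for u v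
    using that r 1 by auto
  show "inv u \<in> {\<one>, r, r \<otimes> r}" if "u \<in> {\<one>, r, r \<otimes> r}" for u
    using inv_equality[OF 1(1)] inv_equality[OF r(2)] that r by auto
qed (use r in auto)

lemma double_transposition_involution:
  assumes "distinct [a, b, c, d]"
  shows "(transpose a b \<circ> transpose c d) \<circ> (transpose a b \<circ> transpose c d) = id"
proof
  fix x
  show "((transpose a b \<circ> transpose c d) \<circ> (transpose a b \<circ> transpose c d)) x = id x"
    using assms by (cases "x \<in> {a, b, c, d}") (auto simp: transpose_apply_other)
qed

lemma klein_commute:
  assumes "distinct [a, b, c, d]"
  shows "(transpose a b \<circ> transpose c d) \<circ> (transpose a c \<circ> transpose b d) =
    (transpose a c \<circ> transpose b d) \<circ> (transpose a b \<circ> transpose c d)"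
proof
  fix x
  show "((transpose a b \<circ> transpose c d) \<circ> (transpose a c \<circ> transpose b d)) x =
    ((transpose a c \<circ> transpose b d) \<circ> (transpose a b \<circ> transpose c d)) x"
    using assms by (cases "x \<in> {a, b, c, d}") (auto simp: transpose_apply_other)
qed

lemma three_cycle_cubed:
  assumes "distinct [a, b, c]"
  shows "(transpose a b \<circ> transpose b c) \<circ> ((transpose a b \<circ> transpose b c) \<circ> (transpose a b \<circ> transpose b c)) = id"
proof
  fix x
  show "((transpose a b \<circ> transpose b c) \<circ> ((transpose a b \<circ> transpose b c) \<circ> (transpose a b \<circ> transpose b c))) x = id x"
    using assms by (cases "x \<in> {a, b, c}") (auto simp: transpose_apply_other)
qed

lemma klein_not_deep_4:
  assumes a: "{a, b, c, d} \<subseteq> {1..4}" and dist: "distinct [a, b, c, d]"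
  shows "{transpose a b \<circ> transpose c d, transpose a c \<circ> transpose b d} \<notin> deep_commuting_edges (alt_group 4)"
proof
  let ?G = "alt_group 4"
  let ?s = "transpose a b \<circ> transpose c d" and ?t = "transpose a c \<circ> transpose b d"
  let ?r = "transpose a b \<circ> transpose b c"
  assume deep: "{?s, ?t} \<in> deep_commuting_edges ?G"
  interpret A: group ?G by (rule alt_group_is_group)
  obtain H \<pi> where H: "schur_cover ?G H \<pi>"
    using schur_cover_exists[OF alt_group_is_group finite_alt_group] by blast
  then have stem: "stem_extension ?G H \<pi>" by (simp add: schur_cover_def)
  interpret central_extension H ?G \<pi> by (rule stem_extension_central[OF alt_group_is_group stem])
  have fin: "finite (carrier H)" and ker: "kernel H ?G \<pi> \<subseteq> derived H (carrier H)"
    using stem by (auto simp: stem_extension_def)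
  have card12: "card (carrier ?G) = 12" using alt_group_card_carrier[of 4] by (simp add: fact_numeral)
  have stG: "?s \<in> carrier ?G" "?t \<in> carrier ?G"
    using deep unfolding doubleton_in_deep_commuting_edges by blast+
  have ss: "?s \<circ> ?s = id" and tt: "?t \<circ> ?t = id" and st: "?s \<circ> ?t = ?t \<circ> ?s"
    using double_transposition_involution[of a b c d] double_transposition_involution[of a c b d]
      klein_commute[OF dist] dist by auto
  have rG: "?r \<in> carrier ?G"
  proof -
    have "?r \<in> three_cycles 4" by (intro CollectI exI[of _ "[a, b, c]"]) (use a dist in auto)
    then show ?thesis using three_cycles_incl by blast
  qed
  have rrr: "?r \<circ> (?r \<circ> ?r) = id" using dist by (intro three_cycle_cubed) auto
  note defs = alt_group_mult alt_group_one
  have sub_V: "subgroup {id, ?s, ?t, ?s \<circ> ?t} ?G"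
    using A.klein_subgroup[OF stG(1) _ stG(2)] ss tt st unfolding defs by blast
  have sub_C: "subgroup {id, ?r, ?r \<circ> ?r} ?G"
    using A.order_3_subgroup[OF rG] rrr unfolding defs by blast
  have "?s a = b" "?t a = c" "(?s \<circ> ?t) a = d" "?r a = b" "(?r \<circ> ?r) a = c"
    using dist by (auto simp: transpose_def)
  then have "distinct (map (\<lambda>f. f a) [id, ?s, ?t, ?s \<circ> ?t])" "distinct (map (\<lambda>f. f a) [id, ?r, ?r \<circ> ?r])"
    using dist by auto
  then have "distinct [id, ?s, ?t, ?s \<circ> ?t]" "distinct [id, ?r, ?r \<circ> ?r]" unfolding distinct_map by blast+
  then have card_V: "card {id, ?s, ?t, ?s \<circ> ?t} = 4" and card_C: "card {id, ?r, ?r \<circ> ?r} = 3"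
    using distinct_card[of "[id, ?s, ?t, ?s \<circ> ?t]"] distinct_card[of "[id, ?r, ?r \<circ> ?r]"]
    by (simp_all only: list.set list.size)
  have V_gen: "{id, ?s, ?t, ?s \<circ> ?t} \<subseteq> generate ?G {?s, ?t}"
    using generate.one[of ?G] generate.eng[of ?s ?G "{?s, ?t}" ?t] by (auto simp: defs intro: generate.incl)
  have C_gen: "{id, ?r, ?r \<circ> ?r} \<subseteq> generate ?G {?r}"
    using generate.one[of ?G] generate.eng[of ?r ?G "{?r}" ?r] by (auto simp: defs intro: generate.incl)
  have "z = \<one>\<^bsub>H\<^esub>" if z: "z \<in> kernel H ?G \<pi>" for z
  proof -
    have zH: "z \<in> carrier H" using z by (simp add: kernel_def)
    have "z [^]\<^bsub>H\<^esub> (3::nat) = \<one>\<^bsub>H\<^esub>"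
    proof (rule kernel_power_eq_one[OF fin sub_V])
      fix x y assume xy: "x \<in> carrier H" "y \<in> carrier H" "\<pi> x \<in> {id, ?s, ?t, ?s \<circ> ?t}" "\<pi> y \<in> {id, ?s, ?t, ?s \<circ> ?t}"
      show "x \<otimes>\<^bsub>H\<^esub> y = y \<otimes>\<^bsub>H\<^esub> x"
      proof (cases "\<pi> x = \<pi> y")
        case True
        then show ?thesis using commute_lift_indep[of y x y] xy by auto
      next
        case False
        have "{\<pi> x, \<pi> y} \<in> deep_commuting_edges ?G"
          using deep_commuting_edges_generate[OF alt_group_is_group deep _ _ False] xy V_gen by blast
        then show ?thesis using H xy(1,2) unfolding doubleton_in_deep_commuting_edges by blast
      qed
    qed (use card12 card_V z ker in auto)
    \<comment> \<open>A 3-cycle generates a subgroup of index 4, whose preimage is abelian because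
      the subgroup is cyclic. This half does not depend on the assumed deep edge.\<close>
    moreover have "z [^]\<^bsub>H\<^esub> (4::nat) = \<one>\<^bsub>H\<^esub>"
    proof (rule kernel_power_eq_one[OF fin sub_C])
      fix x y assume xy: "x \<in> carrier H" "y \<in> carrier H" "\<pi> x \<in> {id, ?r, ?r \<circ> ?r}" "\<pi> y \<in> {id, ?r, ?r \<circ> ?r}"
      show "x \<otimes>\<^bsub>H\<^esub> y = y \<otimes>\<^bsub>H\<^esub> x"
      proof (rule lift_generate_commute2[where S = "{?r}"])
        fix u v assume "u \<in> carrier H" "v \<in> carrier H" "\<pi> u \<in> {?r}" "\<pi> v \<in> {?r}"
        then show "u \<otimes>\<^bsub>H\<^esub> v = v \<otimes>\<^bsub>H\<^esub> u" using commute_lift_indep[of v u v] by auto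
      qed (use xy C_gen rG in auto)
    qed (use card12 card_C z ker in auto)
    moreover have "z [^]\<^bsub>H\<^esub> (4::nat) = z [^]\<^bsub>H\<^esub> (3::nat) \<otimes>\<^bsub>H\<^esub> z"
      by (simp add: numeral_eq_Suc)
    ultimately show ?thesis using zH by simp
  qed
  then have "kernel H ?G \<pi> \<subseteq> {\<one>\<^bsub>H\<^esub>}" by blast
  then have "card (kernel H ?G \<pi>) \<le> 1" using card_mono[of "{\<one>\<^bsub>H\<^esub>}"] by simp
  then show False using schur_cover_alt4_kernel[OF H] by simp
qed

section \<open>The double cover from a Clifford algebra\<close>

text \<open>The operators \<open>clif k\<close> satisfy the Clifford relations, with coefficients in the field with three
  elements, where \<open>e\<^sub>i - e\<^sub>j\<close> squares to \<open>2 = -1\<close>. Hence no square root of 2 is needed to lift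
  transpositions.\<close>

type_synonym spinor = "nat set \<Rightarrow> 3"

text \<open>The Jordan-Wigner sign: it counts the occupied places below \<open>k\<close> and makes
  toggles at different places anticommute.\<close>

definition sgn_below :: "nat \<Rightarrow> nat set \<Rightarrow> 3" where
  "sgn_below k S = (- 1) ^ card {s \<in> S. s < k}"

definition toggle :: "nat \<Rightarrow> nat set \<Rightarrow> nat set" where
  "toggle k S = (if k \<in> S then S - {k} else insert k S)"

definition clif :: "nat \<Rightarrow> spinor \<Rightarrow> spinor" where
  "clif k f = (\<lambda>S. sgn_below k S * f (toggle k S))"

lemma toggle_toggle [simp]: "toggle k (toggle k S) = S"
  by (auto simp: toggle_def)

lemma toggle_commute: "toggle i (toggle j S) = toggle j (toggle i S)"
  by (auto simp: toggle_def)

lemma sgn_below_square [simp]: "sgn_below k S * sgn_below k S = 1"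
  by (simp add: sgn_below_def power_add[symmetric] mult_2[symmetric] power_mult)

lemma sgn_below_toggle_ge: "k \<le> i \<Longrightarrow> sgn_below k (toggle i S) = sgn_below k S"
proof -
  assume "k \<le> i"
  then have "{s \<in> toggle i S. s < k} = {s \<in> S. s < k}" by (auto simp: toggle_def)
  then show ?thesis by (simp add: sgn_below_def)
qed

lemma sgn_below_toggle_less: "i < k \<Longrightarrow> sgn_below k (toggle i S) = - sgn_below k S"
proof -
  assume i: "i < k"
  let ?A = "{s \<in> S. s < k}"
  show ?thesis
  proof (cases "i \<in> S")
    case True
    then have "{s \<in> toggle i S. s < k} = ?A - {i}" "i \<in> ?A" using i by (auto simp: toggle_def)
    moreover have "card ?A = Suc (card (?A - {i}))" using calculation(2) by (intro card.remove) auto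
    ultimately show ?thesis by (simp add: sgn_below_def del: card_Diff_singleton card_Diff_insert)
  next
    case False
    then have "{s \<in> toggle i S. s < k} = insert i ?A" "i \<notin> ?A" using i by (auto simp: toggle_def)
    then show ?thesis by (simp add: sgn_below_def)
  qed
qed

lemma clif_square [simp]: "clif k (clif k f) = f"
  by (simp add: clif_def sgn_below_toggle_ge mult.assoc[symmetric])

lemma clif_anticommute_less: "i < j \<Longrightarrow> clif i (clif j f) = - clif j (clif i f)"
  by (auto simp: clif_def fun_eq_iff sgn_below_toggle_ge sgn_below_toggle_less toggle_commute[of i j])

lemma clif_anticommute: "i \<noteq> j \<Longrightarrow> clif i (clif j f) = - clif j (clif i f)"
  using clif_anticommute_less[of i j f] clif_anticommute_less[of j i f] by (cases "i < j") auto

lemma clif_add: "clif k (f + g) = clif k f + clif k g"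
  by (simp add: clif_def fun_eq_iff distrib_left)

lemma clif_minus: "clif k (- f) = - clif k f"
  by (simp add: clif_def fun_eq_iff)

lemma clif_diff: "clif k (f - g) = clif k f - clif k g"
  by (simp add: clif_def fun_eq_iff right_diff_distrib)

lemma spinor_three: "f + f = - (f :: spinor)"
proof
  fix S
  have "f S + f S + f S = 3 * f S" by simp
  also have "(3::3) = 0" by simp
  finally have "f S + f S + f S = 0" by simp
  then show "(f + f) S = (- f) S" by (simp add: eq_neg_iff_add_eq_0)
qed

lemma spinor_eq_neg: "f = - f \<Longrightarrow> (f :: spinor) = 0"
  using spinor_three[of f] by (metis add.right_inverse add_cancel_right_right)

text \<open>The operator of the root e_i - e_j. Conjugation by it is minus the reflection exchanging
  e_i and e_j, so products of two such operators cover even permutations without any sign.\<close>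

definition clif_root :: "nat \<Rightarrow> nat \<Rightarrow> spinor \<Rightarrow> spinor" where
  "clif_root i j f = clif i f - clif j f"

lemma clif_root_square: "i \<noteq> j \<Longrightarrow> clif_root i j (clif_root i j f) = - f"
  using clif_anticommute[of i j f] spinor_three[of f] by (simp add: clif_root_def clif_diff)

lemma clif_root_clif: "i \<noteq> j \<Longrightarrow> clif_root i j (clif k f) = - clif (transpose i j k) (clif_root i j f)"
  using clif_anticommute[of i k f] clif_anticommute[of j k f]
  by (auto simp: clif_root_def clif_diff transpose_def)

lemma clif_root_minus: "clif_root i j (- f) = - clif_root i j f"
  by (simp add: clif_root_def clif_minus)

lemma clif_root_diff: "clif_root i j (f - g) = clif_root i j f - clif_root i j g"
  by (simp add: clif_root_def clif_diff)

lemma clif_root_root: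
  "i \<noteq> j \<Longrightarrow> clif_root i j (clif_root k l f) = - clif_root (transpose i j k) (transpose i j l) (clif_root i j f)"
  by (simp add: clif_root_def[of k l] clif_root_diff clif_root_clif) (simp add: clif_root_def)

lemma clif_root_anticommute:
  "distinct [i, j, k, l] \<Longrightarrow> clif_root i j (clif_root k l f) = - clif_root k l (clif_root i j f)"
  by (subst clif_root_root) (auto simp: transpose_def)

text \<open>Taking lifts from this algebra gives the two properties needed of them: there are
  finitely many, and one that commutes with every generator commutes with all of them.\<close>

inductive_set clif_alg :: "nat \<Rightarrow> (spinor \<Rightarrow> spinor) set" for n where
  id: "id \<in> clif_alg n"
| clif: "\<lbrakk>k \<in> {1..n}; u \<in> clif_alg n\<rbrakk> \<Longrightarrow> clif k \<circ> u \<in> clif_alg n"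
| add: "\<lbrakk>u \<in> clif_alg n; v \<in> clif_alg n\<rbrakk> \<Longrightarrow> u + v \<in> clif_alg n"

lemma clif_alg_additive: "u \<in> clif_alg n \<Longrightarrow> u (f + g) = u f + u g"
  by (induction arbitrary: f g rule: clif_alg.induct) (simp_all add: clif_add)

lemma clif_alg_comp: "\<lbrakk>u \<in> clif_alg n; v \<in> clif_alg n\<rbrakk> \<Longrightarrow> u \<circ> v \<in> clif_alg n"
proof (induction rule: clif_alg.induct)
  case (clif k u)
  then show ?case using clif_alg.clif[OF clif(1), of "u \<circ> v"] by (simp only: comp_assoc)
next
  case (add u w)
  have "(u + w) \<circ> v = (u \<circ> v) + (w \<circ> v)" by (simp add: fun_eq_iff)
  then show ?case using clif_alg.add[OF add.IH[OF add.prems]] by (simp only:)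
qed simp

lemma clif_root_in_alg:
  assumes "i \<in> {1..n}" "j \<in> {1..n}"
  shows "clif_root i j \<in> clif_alg n"
proof -
  have c: "clif k \<in> clif_alg n" if "k \<in> {1..n}" for k using clif_alg.clif[OF that clif_alg.id] by simp
  \<comment> \<open>In characteristic 3, subtracting is adding twice, so closure under addition
    suffices.\<close>
  have "clif_root i j = clif i + (clif j + clif j)"
    by (rule ext) (simp only: clif_root_def plus_fun_apply spinor_three diff_conv_add_uminus)
  then show ?thesis using assms c by (metis clif_alg.add)
qed

text \<open>Normal forms a + e_(m+1) b with a and b over the first m generators, starting from
  scalars. They provide a finite set containing \<open>clif_alg\<close>.\<close>

fun clif_span :: "nat \<Rightarrow> (spinor \<Rightarrow> spinor) set" where
  "clif_span 0 = range (\<lambda>c f S. c * f S)"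
| "clif_span (Suc m) = (\<lambda>(a, b). a + (clif (Suc m) \<circ> b)) ` (clif_span m \<times> clif_span m)"

lemma clif_span_finite: "finite (clif_span m)"
  by (induction m) auto

lemma clif_span_SucI:
  "\<lbrakk>a \<in> clif_span m; b \<in> clif_span m\<rbrakk> \<Longrightarrow> a + (clif (Suc m) \<circ> b) \<in> clif_span (Suc m)"
  unfolding clif_span.simps by (rule image_eqI[of _ _ "(a, b)"]) simp_all

lemma clif_span_add: "\<lbrakk>a \<in> clif_span m; b \<in> clif_span m\<rbrakk> \<Longrightarrow> a + b \<in> clif_span m"
proof (induction m arbitrary: a b)
  case 0
  then obtain c d where "a = (\<lambda>f S. c * f S)" "b = (\<lambda>f S. d * f S)" by auto
  then have "a + b = (\<lambda>f S. (c + d) * f S)" by (simp add: fun_eq_iff distrib_right)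
  then show ?case by auto
next
  case (Suc m)
  then obtain a1 a2 b1 b2 where ab: "a = a1 + (clif (Suc m) \<circ> a2)" "b = b1 + (clif (Suc m) \<circ> b2)"
    and m: "a1 \<in> clif_span m" "a2 \<in> clif_span m" "b1 \<in> clif_span m" "b2 \<in> clif_span m" by auto
  have "a + b = (a1 + b1) + (clif (Suc m) \<circ> (a2 + b2))"
    by (simp add: ab fun_eq_iff[where 'b = spinor] clif_add)
  then show ?case using clif_span_SucI[OF Suc.IH[OF m(1,3)] Suc.IH[OF m(2,4)]] by (simp only:)
qed

lemma clif_span_minus: "a \<in> clif_span m \<Longrightarrow> - a \<in> clif_span m"
proof -
  assume "a \<in> clif_span m"
  moreover have "- a = a + a" by (rule ext) (simp only: plus_fun_apply spinor_three uminus_apply)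
  ultimately show ?thesis using clif_span_add by metis
qed

lemma clif_span_mono: "a \<in> clif_span m \<Longrightarrow> a \<in> clif_span (Suc m)"
proof -
  assume a: "a \<in> clif_span m"
  have "(0 :: spinor \<Rightarrow> spinor) = a + - a" by simp
  then have "0 \<in> clif_span m" using a clif_span_add clif_span_minus by metis
  moreover have "a = a + (clif (Suc m) \<circ> 0)" by (simp add: fun_eq_iff clif_def)
  ultimately show ?thesis using clif_span_SucI[OF a, of 0] by simp
qed

text \<open>The top generator squares to 1 and so swaps the two components of a normal form; a lower
  generator moves past it with a sign.\<close>

lemma clif_span_clif: "\<lbrakk>a \<in> clif_span m; k \<in> {1..m}\<rbrakk> \<Longrightarrow> clif k \<circ> a \<in> clif_span m"
proof (induction m arbitrary: a)
  case (Suc m)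
  then obtain a1 a2 where a: "a = a1 + (clif (Suc m) \<circ> a2)" "a1 \<in> clif_span m" "a2 \<in> clif_span m" by auto
  show ?case
  proof (cases "k = Suc m")
    case True
    then have "clif k \<circ> a = a2 + (clif (Suc m) \<circ> a1)"
      by (simp add: a fun_eq_iff[where 'b = spinor] clif_add add.commute)
    then show ?thesis using clif_span_SucI[OF a(3,2)] by (simp only:)
  next
    case False
    then have k: "k \<in> {1..m}" using Suc.prems by auto
    have "clif k \<circ> a = (clif k \<circ> a1) + (clif (Suc m) \<circ> (- (clif k \<circ> a2)))"
      using False by (simp add: a fun_eq_iff[where 'b = spinor] clif_add clif_minus clif_anticommute[of k])
    then show ?thesis
      using clif_span_SucI[OF Suc.IH[OF a(2) k] clif_span_minus[OF Suc.IH[OF a(3) k]]] by (simp only:)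
  qed
qed simp

lemma clif_alg_finite: "finite (clif_alg n)"
proof (rule finite_subset[OF _ clif_span_finite[of n]], rule subsetI)
  fix u assume "u \<in> clif_alg n"
  then show "u \<in> clif_span n"
  proof (induction rule: clif_alg.induct)
    case id
    have "id \<in> clif_span 0" by (auto simp: fun_eq_iff intro!: image_eqI[of _ _ 1])
    then show ?case by (induction n) (use clif_span_mono in \<open>auto simp del: clif_span.simps\<close>)
  next
    case (clif k u)
    then show ?case by (intro clif_span_clif)
  next
    case (add u v)
    then show ?case by (intro clif_span_add)
  qed
qed

text \<open>The kernel of the first projection may exceed the scalars 1 and -1. All its operators
  commute with every \<open>clif k\<close>, hence are central, and a central kernel is all that is
  asked for.\<close>

definition spin_pairs :: "nat \<Rightarrow> ((nat \<Rightarrow> nat) \<times> (spinor \<Rightarrow> spinor)) set" where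
  "spin_pairs n = {(s, u). s \<in> carrier (alt_group n) \<and> u \<in> clif_alg n \<and> inj u \<and>
     (\<forall>k \<in> {1..n}. u \<circ> clif k = clif (s k) \<circ> u)}"

lemma spin_pairs_iff:
  "(s, u) \<in> spin_pairs n \<longleftrightarrow> s \<in> carrier (alt_group n) \<and> u \<in> clif_alg n \<and> inj u \<and>
     (\<forall>k \<in> {1..n}. u \<circ> clif k = clif (s k) \<circ> u)"
  by (simp only: spin_pairs_def mem_Collect_eq prod.case)

text \<open>The signs of the two roots cancel. The transpositions may share a point, so the case
  \<open>b = c\<close> lifts 3-cycles.\<close>

lemma spin_pairs_double_transposition:
  assumes "a \<in> {1..n}" "b \<in> {1..n}" "c \<in> {1..n}" "d \<in> {1..n}" "a \<noteq> b" "c \<noteq> d"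
  shows "(transpose a b \<circ> transpose c d, clif_root a b \<circ> clif_root c d) \<in> spin_pairs n"
proof -
  have inj: "inj (clif_root i j)" if "i \<noteq> j" for i j
  proof (rule injI)
    fix f g assume "clif_root i j f = clif_root i j g"
    then have "clif_root i j (clif_root i j f) = clif_root i j (clif_root i j g)" by simp
    then show "f = g" using that by (simp add: clif_root_square)
  qed
  have "(clif_root a b \<circ> clif_root c d) \<circ> clif k = clif ((transpose a b \<circ> transpose c d) k) \<circ> (clif_root a b \<circ> clif_root c d)" for k
    using assms by (simp add: fun_eq_iff[where 'b = spinor] clif_root_clif clif_root_minus)
  then show ?thesis
    unfolding spin_pairs_def
    using assms inj transpositions_in_alt_group[of a b c d n] clif_alg_comp clif_root_in_alg by (auto simp: inj_compose)
qed

lemma clif_alg_commute: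
  assumes u: "u \<in> clif_alg n" and comm: "\<And>k. k \<in> {1..n} \<Longrightarrow> u \<circ> clif k = clif k \<circ> u"
    and v: "v \<in> clif_alg n"
  shows "u \<circ> v = v \<circ> u"
  using v
proof (induction rule: clif_alg.induct)
  case (clif k w)
  then show ?case using comm[OF clif(1)] by (metis comp_assoc)
next
  case (add v w)
  have "u \<circ> (v + w) = (u \<circ> v) + (u \<circ> w)" using clif_alg_additive[OF u] by (simp add: fun_eq_iff[where 'b = spinor])
  also have "\<dots> = (v + w) \<circ> u" unfolding add.IH by (simp add: fun_eq_iff[where 'b = spinor])
  finally show ?case .
qed simp

lemma not_deep_of_spin_pairs:
  assumes n: "n \<ge> 5" and st: "(s, u) \<in> spin_pairs n" "(t, v) \<in> spin_pairs n"
    and uv: "\<And>f. u (v f) = - v (u f)"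
  shows "{s, t} \<notin> deep_commuting_edges (alt_group n)"
proof (rule not_deep_of_pairs[where R = "spin_pairs n" and S = "three_cycles n"])
  show "group (alt_group n)" by (rule alt_group_is_group)
  have fs: "spin_pairs n \<subseteq> carrier (alt_group n) \<times> clif_alg n" by (auto simp: spin_pairs_def)
  show "finite (spin_pairs n)" using fs finite_alt_group[of n] clif_alg_finite by (meson finite_SigmaI finite_subset)
  show "fst ` spin_pairs n \<subseteq> carrier (alt_group n)" using fs by auto
  show "(\<one>\<^bsub>alt_group n\<^esub>, id) \<in> spin_pairs n"
    using monoid.one_closed[OF group.is_monoid[OF alt_group_is_group[of n]]] clif_alg.id
    by (auto simp: spin_pairs_def alt_group_one)
  show "(s \<otimes>\<^bsub>alt_group n\<^esub> t, u \<circ> v) \<in> spin_pairs n"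
    if "(s, u) \<in> spin_pairs n" "(t, v) \<in> spin_pairs n" for s u t v
  proof -
    have s: "s \<in> carrier (alt_group n)" "u \<in> clif_alg n" "inj u" "\<And>k. k \<in> {1..n} \<Longrightarrow> u \<circ> clif k = clif (s k) \<circ> u"
      and t: "t \<in> carrier (alt_group n)" "v \<in> clif_alg n" "inj v" "\<And>k. k \<in> {1..n} \<Longrightarrow> v \<circ> clif k = clif (t k) \<circ> v"
      using that[unfolded spin_pairs_iff, THEN conjunct1]
        that[unfolded spin_pairs_iff, THEN conjunct2, THEN conjunct1]
        that[unfolded spin_pairs_iff, THEN conjunct2, THEN conjunct2, THEN conjunct1]
        that[unfolded spin_pairs_iff, THEN conjunct2, THEN conjunct2, THEN conjunct2, THEN bspec]
      by - assumption+
    have "(u \<circ> v) \<circ> clif k = clif ((s \<circ> t) k) \<circ> (u \<circ> v)" if k: "k \<in> {1..n}" for k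
    proof -
      have tk: "t k \<in> {1..n}" using permutes_in_image[of t "{1..n}" k] t(1) k by (simp only: alt_group_carrier)
      have "(u \<circ> v) \<circ> clif k = (u \<circ> clif (t k)) \<circ> v" using t(4)[OF k] by (simp only: comp_assoc)
      also have "\<dots> = clif (s (t k)) \<circ> (u \<circ> v)" using s(4)[OF tk] by (simp only: comp_assoc)
      finally show ?thesis by (simp only: comp_apply)
    qed
    then show ?thesis
      using s(1-3) t(1-3) clif_alg_comp[OF s(2) t(2)] inj_compose[OF s(3) t(3)]
        monoid.m_closed[OF group.is_monoid[OF alt_group_is_group[of n]] s(1) t(1)]
      unfolding spin_pairs_iff alt_group_mult by (intro conjI ballI)
  qed
  show "inj u" if "(s, u) \<in> spin_pairs n" for s u using that by (simp add: spin_pairs_def)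
  show "carrier (alt_group n) = generate (alt_group n) (three_cycles n)"
    by (rule alt_group_carrier_as_three_cycles)
  show "three_cycles n \<subseteq> fst ` spin_pairs n"
  proof
    fix p assume "p \<in> three_cycles n"
    then obtain cs where cs: "p = cycle_of_list cs" "cycle cs" "length cs = 3" "set cs \<subseteq> {1..n}" by auto
    obtain a b c where abc: "cs = [a, b, c]" using stupid_lemma[OF cs(3)] by auto
    have "(transpose a b \<circ> transpose b c, clif_root a b \<circ> clif_root b c) \<in> spin_pairs n"
      using cs unfolding abc by (intro spin_pairs_double_transposition) auto
    moreover have "p = transpose a b \<circ> transpose b c" using cs(1) unfolding abc by simp
    ultimately show "p \<in> fst ` spin_pairs n" by force
  qed
  show "u \<circ> v = v \<circ> u" if "(\<one>\<^bsub>alt_group n\<^esub>, u) \<in> spin_pairs n" "(t, v) \<in> spin_pairs n" for u t v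
  proof (rule clif_alg_commute[of u n])
    have u: "(id, u) \<in> spin_pairs n" using that(1) by (simp only: alt_group_one)
    then show "u \<in> clif_alg n" by (simp add: spin_pairs_def)
    show "u \<circ> clif k = clif k \<circ> u" if "k \<in> {1..n}" for k
      using u[unfolded spin_pairs_iff, THEN conjunct2, THEN conjunct2, THEN conjunct2, THEN bspec, OF that]
      by (simp only: id_apply)
    show "v \<in> clif_alg n" using that(2) by (simp add: spin_pairs_def)
  qed
  show "derived (alt_group n) (carrier (alt_group n)) = carrier (alt_group n)"
    by (rule derived_alt_group_const[OF n])
  show "u \<circ> v \<noteq> v \<circ> u"
  proof
    assume "u \<circ> v = v \<circ> u"
    \<comment> \<open>Operators that both commute and anticommute have product zero in
      characteristic 3, against injectivity.\<close>
    then have "u (v f) = v (u f)" for f by (simp add: fun_eq_iff[where 'b = spinor])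
    then have z: "u (v f) = 0" for f using uv[of f] spinor_eq_neg by metis
    have "inj (u \<circ> v)" using st by (auto simp: spin_pairs_def inj_compose)
    moreover have "(u \<circ> v) (\<lambda>_ :: nat set. 0 :: 3) = (u \<circ> v) (\<lambda>_. 1)" by (simp only: comp_apply z)
    ultimately have "(\<lambda>_ :: nat set. 0 :: 3) = (\<lambda>_. 1)" unfolding inj_def by blast
    then show False by (simp add: fun_eq_iff)
  qed
qed (use st in auto)

lemma klein_not_deep:
  assumes n: "n \<ge> 5" and "{a, b, c, d} \<subseteq> {1..n}" and "distinct [a, b, c, d]"
  shows "{transpose a b \<circ> transpose c d, transpose a c \<circ> transpose b d} \<notin> deep_commuting_edges (alt_group n)"
proof (rule not_deep_of_spin_pairs[OF n])
  show "(transpose a b \<circ> transpose c d, clif_root a b \<circ> clif_root c d) \<in> spin_pairs n"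
    "(transpose a c \<circ> transpose b d, clif_root a c \<circ> clif_root b d) \<in> spin_pairs n"
    using assms by (auto intro!: spin_pairs_double_transposition)
  fix f
  have 2: "clif_root b d (clif_root a c g) = - clif_root a c (clif_root b d g)" for g
    using assms by (intro clif_root_anticommute) auto
  \<comment> \<open>Moving the roots cd and ab to the right turns ac into bd and bd into ac, with
    four signs that cancel. Restoring the order of the orthogonal roots bd and ac leaves one
    sign.\<close>
  show "(clif_root a b \<circ> clif_root c d) ((clif_root a c \<circ> clif_root b d) f) = - (clif_root a c \<circ> clif_root b d) ((clif_root a b \<circ> clif_root c d) f)"
    using assms by (simp add: clif_root_root[of c d a c] clif_root_root[of c d b d] clif_root_root[of a b a d] clif_root_root[of a b b c]
      clif_root_minus transpose_def 2)
qed

lemma double_transposition_not_deep: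
  assumes n: "n \<ge> 5" and "{a, b, c, d, e, f} \<subseteq> {1..n}" and "distinct [a, b, c, d, e, f]"
  shows "{transpose a b \<circ> transpose c d, transpose a b \<circ> transpose e f} \<notin> deep_commuting_edges (alt_group n)"
proof (rule not_deep_of_spin_pairs[OF n])
  show "(transpose a b \<circ> transpose c d, clif_root a b \<circ> clif_root c d) \<in> spin_pairs n"
    "(transpose a b \<circ> transpose e f, clif_root a b \<circ> clif_root e f) \<in> spin_pairs n"
    using assms by (auto intro!: spin_pairs_double_transposition)
  fix g
  have 1: "clif_root c d (clif_root a b h) = - clif_root a b (clif_root c d h)"
    and 2: "clif_root c d (clif_root e f h) = - clif_root e f (clif_root c d h)"
    and 3: "clif_root e f (clif_root a b h) = - clif_root a b (clif_root e f h)" for h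
    using assms by (auto intro!: clif_root_anticommute)
  \<comment> \<open>Three exchanges of orthogonal roots turn one side into the other, so the sign is
    -1.\<close>
  show "(clif_root a b \<circ> clif_root c d) ((clif_root a b \<circ> clif_root e f) g) = - (clif_root a b \<circ> clif_root e f) ((clif_root a b \<circ> clif_root c d) g)"
    by (simp add: 1 2 3 clif_root_minus)
qed

section \<open>Elementary abelian subgroups of rank 2\<close>

text \<open>Take a cyclic subgroup \<open>?C g\<close> of maximal order and \<open>y0\<close>
  outside it with \<open>y0 [^] p\<close> inside, for a prime \<open>p\<close>. Maximality makes
  \<open>y0 [^] p\<close> a \<open>p\<close>-th power in \<open>?C g\<close>; dividing out its root
  turns \<open>y0\<close> into \<open>b\<close> of order \<open>p\<close>. Maximality again makes
  \<open>p\<close> divide the order of \<open>g\<close>, whose power \<open>a\<close> is the second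
  element.\<close>

lemma (in comm_group) noncyclic_prime_rank_2:
  assumes fin: "finite (carrier G)" and nc: "\<not> cyclic_group G"
  obtains p a b where "prime (p::nat)" "a \<in> carrier G" "b \<in> carrier G"
    "a [^] p = \<one>" "b [^] p = \<one>" "a \<noteq> \<one>" "b \<notin> generate G {a}"
proof -
  let ?C = "\<lambda>g. generate G {g}"
  have sub: "subgroup (?C g) G" if "g \<in> carrier G" for g using generate_is_subgroup[of "{g}"] that by simp
  have self: "g \<in> ?C g" for g by (rule generate.incl) simp
  have finC: "finite (?C g)" if "g \<in> carrier G" for g
    using subgroup.subset[OF sub[OF that]] fin finite_subset by blast
  have "\<exists>g. g \<in> carrier G \<and> (\<forall>h. h \<in> carrier G \<longrightarrow> card (?C h) \<le> card (?C g))"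
  proof (rule ex_has_greatest_nat[where b = "Suc (card (carrier G))"])
    show "\<one> \<in> carrier G" by simp
    show "\<forall>y. y \<in> carrier G \<longrightarrow> card (?C y) < Suc (card (carrier G))"
      using card_mono[OF fin subgroup.subset[OF sub]] by (simp add: le_imp_less_Suc)
  qed
  then obtain g where g: "g \<in> carrier G" and max: "\<And>h. h \<in> carrier G \<Longrightarrow> card (?C h) \<le> card (?C g)" by blast
  \<comment> \<open>Maximality in usable form: a cyclic group containing \<open>g\<close> is no
    larger than \<open>?C g\<close>, so its generator lies there.\<close>
  have strict: "h \<in> ?C g" if h: "h \<in> carrier G" and gh: "g \<in> ?C h" for h
  proof -
    have "?C g \<subseteq> ?C h" using generate_subgroup_incl[OF _ sub[OF h], of "{g}"] gh by simp
    then have "?C g = ?C h" using card_seteq[OF finC[OF h]] max[OF h] by blast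
    then show ?thesis using self[of h] by simp
  qed
  have "?C g \<noteq> carrier G"
  proof
    assume "?C g = carrier G"
    then have "carrier G = range (\<lambda>n::int. g [^] n)" using generate_pow[OF g] by (simp add: full_SetCompr_eq)
    then show False using nc g cyclic_group by blast
  qed
  then obtain y where y: "y \<in> carrier G" "y \<notin> ?C g" using subgroup.subset[OF sub[OF g]] by blast
  let ?P = "\<lambda>k::nat. 0 < k \<and> y [^] k \<in> ?C g"
  have "?P (order G)"
    using pow_order_eq_1[OF y(1)] fin order_gt_0_iff_finite subgroup.one_closed[OF sub[OF g]] by simp
  then have P: "?P (LEAST k. ?P k)" by (rule LeastI)
  define k where "k = (LEAST k. ?P k)"
  have kmin: "y [^] j \<notin> ?C g" if "0 < j" "j < k" for j using not_less_Least[of j ?P] that unfolding k_def by blast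
  have k: "0 < k" "y [^] k \<in> ?C g" using P unfolding k_def by auto
  have "k \<noteq> 1" using k(2) y by auto
  then obtain p where p: "prime p" "p dvd k" using prime_factor_nat by blast
  define y0 where "y0 = y [^] (k div p)"
  have kp: "k = (k div p) * p" using p(2) by simp
  then have "0 < k div p" "k div p < k" using k(1) prime_gt_1_nat[OF p(1)] by (auto intro: Nat.gr0I)
  then have y0: "y0 \<in> carrier G" "y0 \<notin> ?C g" unfolding y0_def using kmin y by auto
  have "y0 [^] p \<in> ?C g" unfolding y0_def using nat_pow_pow[OF y(1)] kp k(2) by metis
  then obtain j :: int where j: "y0 [^] p = g [^] j" using generate_pow[OF g] by auto
  have j': "y0 [^] int p = g [^] j" using j by (simp add: int_pow_int)
  \<comment> \<open>Otherwise a Bezout combination \<open>w\<close> of \<open>y0\<close> and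
    \<open>g\<close> has \<open>p\<close>-th power \<open>g\<close>. By \<open>strict\<close> it
    lies in \<open>?C g\<close>, and this drags \<open>y0\<close> in.\<close>
  have "int p dvd j"
  proof (rule ccontr)
    assume "\<not> int p dvd j"
    then have "coprime j (int p)" using p(1) prime_imp_coprime[of "int p" j] by (simp add: coprime_commute)
    then obtain u v where uv: "u * j + v * int p = 1" by (metis bezout_int coprime_imp_gcd_eq_1)
    define w where "w = y0 [^] u \<otimes> g [^] v"
    have wG: "w \<in> carrier G" using y0 g by (simp add: w_def)
    have "w [^] int p = (y0 [^] int p) [^] u \<otimes> (g [^] v) [^] int p"
      unfolding w_def using y0 g by (simp add: int_pow_distrib int_pow_pow mult.commute)
    also have "\<dots> = g [^] (j * u) \<otimes> g [^] (v * int p)" unfolding j' using g by (simp add: int_pow_pow)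
    also have "\<dots> = g [^] (u * j + v * int p)" using g by (simp add: int_pow_mult mult.commute)
    also have "\<dots> = g" unfolding uv using g by simp
    finally have "g \<in> ?C w" using subgroup_int_pow_closed[OF sub[OF wG] self, of "int p"] by simp
    then have w: "w \<in> ?C g" by (rule strict[OF wG])
    have "y0 [^] u = w \<otimes> inv (g [^] v)" unfolding w_def using y0 g by (simp add: m_assoc)
    moreover have "g [^] v \<in> ?C g" by (rule subgroup_int_pow_closed[OF sub[OF g] self])
    ultimately have y0u: "y0 [^] u \<in> ?C g"
      using w subgroup.m_closed[OF sub[OF g]] subgroup.m_inv_closed[OF sub[OF g]] by simp
    have "y0 = y0 [^] (u * j + v * int p)" unfolding uv using y0 by simp
    also have "\<dots> = (y0 [^] u) [^] j \<otimes> (y0 [^] int p) [^] v"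
      using y0 by (simp add: int_pow_mult int_pow_pow mult.commute)
    also have "\<dots> \<in> ?C g"
      using subgroup_int_pow_closed[OF sub[OF g] y0u] subgroup_int_pow_closed[OF sub[OF g], of "y0 [^] int p"]
        j' subgroup_int_pow_closed[OF sub[OF g] self] subgroup.m_closed[OF sub[OF g]] by simp
    finally show False using y0(2) by simp
  qed
  then obtain i where i: "j = i * int p" by (auto simp: dvd_def mult.commute)
  define b where "b = y0 \<otimes> inv (g [^] i)"
  have gi: "g [^] i \<in> ?C g" by (rule subgroup_int_pow_closed[OF sub[OF g] self])
  have bG: "b \<in> carrier G" using y0 g by (simp add: b_def)
  have y0b: "y0 = b \<otimes> g [^] i" using y0 g by (simp add: b_def m_assoc)
  have bC: "b \<notin> ?C g" using y0(2) gi subgroup.m_closed[OF sub[OF g]] y0b by metis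
  have "y0 [^] int p = b [^] int p \<otimes> y0 [^] int p"
    using y0b bG g j' i by (metis int_pow_closed int_pow_distrib int_pow_pow)
  then have "b [^] int p = \<one>" using bG y0 by (metis int_pow_closed r_cancel_one')
  then have bp: "b [^] p = \<one>" by (simp add: int_pow_int)
  define m where "m = ord g"
  have m0: "0 < m" unfolding m_def using ord_ge_1[OF fin g] by simp
  have gm: "g [^] m = \<one>" unfolding m_def using g by simp
  \<comment> \<open>Otherwise a power of \<open>b \<otimes> g\<close> equals \<open>g\<close>,
    because \<open>p\<close> is invertible modulo \<open>m\<close>, and \<open>strict\<close> would
    put \<open>b\<close> into \<open>?C g\<close>.\<close>
  have "p dvd m"
  proof (rule ccontr)
    assume "\<not> p dvd m"
    then have "coprime (int p) (int m)" using p(1) by (simp add: prime_imp_coprime)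
    then obtain u v where uv: "u * int p + v * int m = 1" by (metis bezout_int coprime_imp_gcd_eq_1)
    define w where "w = b \<otimes> g"
    have wG: "w \<in> carrier G" using bG g by (simp add: w_def)
    have "w [^] int p = g [^] int p"
      unfolding w_def using bG g \<open>b [^] int p = \<one>\<close> by (simp add: int_pow_distrib)
    then have "w [^] (u * int p) = g [^] (u * int p)"
      using wG g by (metis int_pow_pow mult.commute)
    also have "\<dots> = g [^] (u * int p) \<otimes> (g [^] int m) [^] v" using gm g by (simp add: int_pow_int)
    also have "\<dots> = g [^] (u * int p + v * int m)" using g by (simp add: int_pow_pow int_pow_mult mult.commute)
    also have "\<dots> = g" unfolding uv using g by simp
    finally have "g \<in> ?C w" using subgroup_int_pow_closed[OF sub[OF wG] self, of "u * int p"] by simp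
    then have "w \<in> ?C g" by (rule strict[OF wG])
    then have "w \<otimes> inv g \<in> ?C g"
      using self[of g] subgroup.m_closed[OF sub[OF g]] subgroup.m_inv_closed[OF sub[OF g]] by simp
    moreover have "w \<otimes> inv g = b" unfolding w_def using bG g by (simp add: m_assoc)
    ultimately show False using bC by simp
  qed
  define a where "a = g [^] (m div p)"
  have aG: "a \<in> carrier G" using g by (simp add: a_def)
  have "a [^] p = \<one>" unfolding a_def using g gm \<open>p dvd m\<close> by (simp add: nat_pow_pow)
  moreover have "a \<noteq> \<one>"
  proof
    assume "a = \<one>"
    then have "m dvd m div p" unfolding a_def m_def using pow_eq_id[OF g] by simp
    moreover have "0 < m div p" using \<open>p dvd m\<close> m0 by (simp add: div_greater_zero_iff dvd_imp_le prime_gt_0_nat[OF p(1)])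
    moreover have "m div p < m" using m0 prime_gt_1_nat[OF p(1)] by simp
    ultimately show False by (auto dest: dvd_imp_le)
  qed
  moreover have "b \<notin> ?C a"
  proof -
    have "a \<in> ?C g" unfolding a_def using subgroup_int_pow_closed[OF sub[OF g] self, of "int (m div p)"] by (simp add: int_pow_int)
    then have "?C a \<subseteq> ?C g" using generate_subgroup_incl[OF _ sub[OF g]] by simp
    then show ?thesis using bC by blast
  qed
  ultimately show thesis using that p(1) aG bG bp by blast
qed

section \<open>Commuting even involutions on at most seven points\<close>

lemma involution_step:
  assumes b: "b \<circ> b = id" "permutation b" and m: "b m \<noteq> m"
  shows "evenperm (transpose m (b m) \<circ> b) \<longleftrightarrow> \<not> evenperm b"
    and "permutation (transpose m (b m) \<circ> b)"
    and "(transpose m (b m) \<circ> b) x = (if x \<in> {m, b m} then x else b x)"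
proof -
  have bb: "b (b x) = x" for x using b(1) by (metis comp_apply id_apply)
  show "evenperm (transpose m (b m) \<circ> b) \<longleftrightarrow> \<not> evenperm b"
    using evenperm_comp[OF permutation_swap_id b(2), of m "b m"] m by (auto simp: evenperm_swap)
  show "permutation (transpose m (b m) \<circ> b)" by (rule permutation_compose[OF permutation_swap_id b(2)])
  show "(transpose m (b m) \<circ> b) x = (if x \<in> {m, b m} then x else b x)"
    using bb by (auto simp: transpose_def) metis+
qed

text \<open>Removing one 2-cycle leaves an odd permutation, which is not the identity.\<close>

lemma even_involution_moves_another:
  assumes b: "b \<circ> b = id" "permutation b" "evenperm b" and m: "b m \<noteq> m"
  obtains q where "b q \<noteq> q" "q \<notin> {m, b m}"
proof -
  let ?t = "transpose m (b m) \<circ> b"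
  have "?t \<noteq> id" using involution_step(1)[OF b(1,2) m] b(3) by auto
  then obtain q where "?t q \<noteq> q" by (metis eq_id_iff)
  then have "b q \<noteq> q" "q \<notin> {m, b m}" using involution_step(3)[OF b(1,2) m, of q] by (auto split: if_splits)
  then show thesis by (rule that)
qed

text \<open>A third 2-cycle would force a fourth by parity, and four of them need eight
  points.\<close>

lemma even_involution_eq:
  fixes b :: "nat \<Rightarrow> nat"
  assumes b: "b \<circ> b = id" "b permutes {1..n}" "evenperm b" and n: "n \<le> 7"
    and m: "b m \<noteq> m" and q: "b q \<noteq> q" "q \<notin> {m, b m}"
  shows "b = transpose m (b m) \<circ> transpose q (b q)"
proof -
  have bb: "b (b x) = x" for x using b(1) by (metis comp_apply id_apply)
  have per: "permutation b" using b(2) permutation_permutes by blast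
  let ?t1 = "transpose m (b m) \<circ> b"
  have t1: "?t1 x = (if x \<in> {m, b m} then x else b x)" for x by (rule involution_step(3)[OF b(1) per m])
  have t1i: "?t1 \<circ> ?t1 = id" by (rule ext) (simp only: comp_apply[of ?t1] t1, auto simp: bb; metis bb)
  have t1p: "permutation ?t1" by (rule involution_step(2)[OF b(1) per m])
  have t1q: "?t1 q = b q" using q t1[of q] by auto
  have t1m: "?t1 q \<noteq> q" using t1q q by simp
  let ?t2 = "transpose q (b q) \<circ> ?t1"
  have bq: "b q \<notin> {m, b m}" using q bb by auto metis+
  have t2: "?t2 x = (if x \<in> {m, b m, q, b q} then x else b x)" for x
    using involution_step(3)[OF t1i t1p t1m, of x] t1[of x] unfolding t1q by auto
  have t2p: "permutation ?t2" using involution_step(2)[OF t1i t1p t1m] unfolding t1q .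
  have t2i: "?t2 \<circ> ?t2 = id" by (rule ext) (simp only: comp_apply[of ?t2] t2, auto simp: bb; metis bb)
  have e2: "evenperm ?t2"
    using involution_step(1)[OF t1i t1p t1m] involution_step(1)[OF b(1) per m] b(3) unfolding t1q by blast
  have fix_x: "b x = x" if x: "x \<notin> {m, b m, q, b q}" for x
  proof (rule ccontr)
    assume bx: "b x \<noteq> x"
    then have "?t2 x \<noteq> x" using t2[of x] x by simp
    from even_involution_moves_another[OF t2i t2p e2 this] obtain y where y: "?t2 y \<noteq> y" "y \<notin> {x, ?t2 x}" .
    have "?t2 x = b x" using t2[of x] x by simp
    then have y': "b y \<noteq> y" "y \<notin> {m, b m, q, b q, x, b x}" using y t2[of y] by (auto split: if_splits)
    have "distinct [m, b m, q, b q, x, b x, y, b y]"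
      using m q bq x bx y' bb by auto metis+
    then have "card {m, b m, q, b q, x, b x, y, b y} = 8" using distinct_card[of "[m, b m, q, b q, x, b x, y, b y]"] by simp
    moreover have "{m, b m, q, b q, x, b x, y, b y} \<subseteq> {1..n}"
      using permutes_not_in[OF b(2)] m q bx y' bb by (metis (no_types, lifting) empty_subsetI insert_subset)
    ultimately show False using card_mono[of "{1..n}" "{m, b m, q, b q, x, b x, y, b y}"] n by simp
  qed
  show ?thesis
  proof
    fix x
    show "b x = (transpose m (b m) \<circ> transpose q (b q)) x"
      using fix_x[of x] m q bq bb by (auto simp: transpose_def)
  qed
qed

definition klein_pair :: "nat \<Rightarrow> (nat \<Rightarrow> nat) \<Rightarrow> (nat \<Rightarrow> nat) \<Rightarrow> bool" where
  "klein_pair n s t \<longleftrightarrow> (\<exists>a b c d. {a, b, c, d} \<subseteq> {1..n} \<and> distinct [a, b, c, d] \<and>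
     s = transpose a b \<circ> transpose c d \<and> t = transpose a c \<circ> transpose b d)"

definition shared_transposition_pair :: "nat \<Rightarrow> (nat \<Rightarrow> nat) \<Rightarrow> (nat \<Rightarrow> nat) \<Rightarrow> bool" where
  "shared_transposition_pair n s t \<longleftrightarrow> (\<exists>a b c d e f. {a, b, c, d, e, f} \<subseteq> {1..n} \<and>
     distinct [a, b, c, d, e, f] \<and>
     s = transpose a b \<circ> transpose c d \<and> t = transpose a b \<circ> transpose e f)"

definition three_cycle_pair :: "nat \<Rightarrow> (nat \<Rightarrow> nat) \<Rightarrow> (nat \<Rightarrow> nat) \<Rightarrow> bool" where
  "three_cycle_pair n s t \<longleftrightarrow> (\<exists>a b c d e f. {a, b, c, d, e, f} \<subseteq> {1..n} \<and>
     distinct [a, b, c, d, e, f] \<and>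
     s = transpose a b \<circ> transpose b c \<and> t = transpose d e \<circ> transpose e f)"

text \<open>Commuting makes \<open>b\<close> preserve the four points that \<open>a\<close> moves.
  If \<open>b\<close> exchanges the two 2-cycles of \<open>a\<close>, the pair is of Klein type.
  Otherwise \<open>b\<close> fixes or flips each of them: flipping one gives the shared
  transposition, flipping both gives \<open>b = a\<close>, and flipping none needs four further
  points.\<close>

lemma commuting_involutions:
  fixes a b :: "nat \<Rightarrow> nat"
  assumes a: "a \<circ> a = id" "a permutes {1..n}" "evenperm a" "a \<noteq> id"
    and b: "b \<circ> b = id" "b permutes {1..n}" "evenperm b" "b \<noteq> id"
    and ab: "a \<circ> b = b \<circ> a" "a \<noteq> b" and n: "n \<le> 7"
  shows "klein_pair n a b \<or> shared_transposition_pair n a b"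
proof -
  have aa: "a (a x) = x" for x using a(1) by (metis comp_apply id_apply)
  have bb: "b (b x) = x" for x using b(1) by (metis comp_apply id_apply)
  have c: "a (b x) = b (a x)" for x using ab(1) by (metis comp_apply)
  have pa: "permutation a" and pb: "permutation b" using a(2) b(2) permutation_permutes by blast+
  have dom_a: "x \<in> {1..n}" if "a x \<noteq> x" for x using permutes_not_in[OF a(2)] that by blast
  have dom_b: "x \<in> {1..n}" if "b x \<noteq> x" for x using permutes_not_in[OF b(2)] that by blast
  obtain i where i: "a i \<noteq> i" using a(4) by (metis eq_id_iff)
  obtain k where k: "a k \<noteq> k" "k \<notin> {i, a i}" using even_involution_moves_another[OF a(1) pa a(3) i] .
  define j where "j = a i"
  define l where "l = a k"
  have aj: "a j = i" "a i = j" and al: "a l = k" "a k = l" unfolding j_def l_def by (simp_all add: aa)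
  have dist: "distinct [i, j, k, l]" using i k aj al by auto
  have a_eq: "a = transpose i j \<circ> transpose k l"
    using even_involution_eq[OF a(1-3) n i k] unfolding j_def l_def .
  have a_other: "a x = x" if "x \<notin> {i, j, k, l}" for x
    using that by (subst a_eq) (simp add: transpose_def)
  have ijkl: "{i, j, k, l} \<subseteq> {1..n}"
    using dom_a[of i] dom_a[of j] dom_a[of k] dom_a[of l] dist aj al by simp
  have pairs: "b x \<in> {i, j, k, l}" if "x \<in> {i, j, k, l}" for x
  proof (rule ccontr)
    assume "b x \<notin> {i, j, k, l}"
    then have "b (a x) = b x" using a_other c by metis
    then have "a x = x" using bb by metis
    then show False using that dist aj al by auto
  qed
  have bj: "b j = a (b i)" and bl: "b l = a (b k)" unfolding j_def l_def using c by metis+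
  show ?thesis
  proof (cases "b i \<in> {k, l}")
    case True
    have bi: "b i \<noteq> i" using True dist by auto
    have bj': "b j \<noteq> j" using True dist bj al by auto
    have "j \<notin> {i, b i}" using True dist by auto
    then have b_eq: "b = transpose i (b i) \<circ> transpose j (b j)"
      using even_involution_eq[OF b(1-3) n bi bj'] by simp
    show ?thesis
    proof (cases "b i = k")
      case True
      then have "b = transpose i k \<circ> transpose j l" using b_eq bj al by simp
      then have "klein_pair n a b" unfolding klein_pair_def using a_eq ijkl dist
        by (intro exI[of _ i] exI[of _ j] exI[of _ k] exI[of _ l]) simp
      then show ?thesis ..
    next
      case False
      then have "b i = l" using True by auto
      then have "b = transpose i l \<circ> transpose j k" using b_eq bj al by simp
      moreover have "a = transpose i j \<circ> transpose l k" using a_eq by (simp add: transpose_commute)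
      ultimately have "klein_pair n a b" unfolding klein_pair_def using ijkl dist
        by (intro exI[of _ i] exI[of _ j] exI[of _ l] exI[of _ k]) auto
      then show ?thesis ..
    qed
  next
    case False
    then have bi: "b i \<in> {i, j}" using pairs[of i] by auto
    then have bj'': "b j \<in> {i, j}" using bj aj by auto
    have bk: "b k \<in> {k, l}"
    proof (rule ccontr)
      assume "b k \<notin> {k, l}"
      then have "b k \<in> {i, j}" using pairs[of k] by auto
      then have "k \<in> {b i, b j}" using bb by auto
      then show False using bi bj'' dist by auto
    qed
    have swap_c: "transpose i j \<circ> transpose k l = transpose k l \<circ> transpose i j"
      using dist by (intro ext) (auto simp: transpose_def)
    show ?thesis
    proof (cases "b i = i")
      case True
      then have bj1: "b j = j" using bj aj by simp
      show ?thesis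
      proof (cases "b k = k")
        case True
        then have bl1: "b l = l" using bl al by simp
        obtain m where m: "b m \<noteq> m" using b(4) by (metis eq_id_iff)
        obtain q where q: "b q \<noteq> q" "q \<notin> {m, b m}" using even_involution_moves_another[OF b(1) pb b(3) m] .
        have f: "b x = x" if "x \<in> {i, j, k, l}" for x using that \<open>b i = i\<close> bj1 True bl1 by auto
        have mv: "b x \<noteq> x" if "x \<in> {m, b m, q, b q}" for x using that m q bb by auto
        have "distinct [m, b m, q, b q]" using m q bb[of m] bb[of q] by auto
        moreover have "{m, b m, q, b q} \<inter> {i, j, k, l} = {}" using f mv by blast
        ultimately have "distinct [i, j, k, l, m, b m, q, b q]" using dist by auto
        then have "card {i, j, k, l, m, b m, q, b q} = 8"
          using distinct_card[of "[i, j, k, l, m, b m, q, b q]"] by simp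
        moreover have "{m, b m, q, b q} \<subseteq> {1..n}" using dom_b mv by blast
        then have "{i, j, k, l, m, b m, q, b q} \<subseteq> {1..n}" using ijkl by auto
        ultimately show ?thesis using card_mono[of "{1..n}" "{i, j, k, l, m, b m, q, b q}"] n by simp
      next
        case False
        then have bkl: "b k = l" using bk by auto
        obtain q where q: "b q \<noteq> q" "q \<notin> {k, b k}" using even_involution_moves_another[OF b(1) pb b(3) False] .
        have "b = transpose k l \<circ> transpose q (b q)" using even_involution_eq[OF b(1-3) n False q] unfolding bkl .
        moreover have "distinct [k, l, i, j, q, b q]"
        proof -
          have "b q \<notin> {k, b k}" using q bb[of q] bb[of k] by auto
          moreover have "q \<notin> {i, j}" "b q \<notin> {i, j}" using q(1) bb[of q] \<open>b i = i\<close> bj1 by auto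
          ultimately show ?thesis using q bkl dist by auto
        qed
        moreover have "{k, l, i, j, q, b q} \<subseteq> {1..n}" using ijkl dom_b[of q] dom_b[of "b q"] q(1) bb[of q] by simp
        moreover have "a = transpose k l \<circ> transpose i j" by (rule trans[OF a_eq swap_c])
        ultimately have "shared_transposition_pair n a b" unfolding shared_transposition_pair_def by blast
        then show ?thesis ..
      qed
    next
      case False
      then have bij: "b i = j" using bi by auto
      show ?thesis
      proof (cases "b k = k")
        case True
        then have bl1: "b l = l" using bl al by simp
        obtain q where q: "b q \<noteq> q" "q \<notin> {i, b i}" using even_involution_moves_another[OF b(1) pb b(3) False] .
        have "b = transpose i j \<circ> transpose q (b q)" using even_involution_eq[OF b(1-3) n False q] unfolding bij .
        moreover have "distinct [i, j, k, l, q, b q]"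
        proof -
          have "b q \<notin> {i, b i}" using q bb[of q] bb[of i] by auto
          moreover have "q \<notin> {k, l}" "b q \<notin> {k, l}" using q(1) bb[of q] True bl1 by auto
          ultimately show ?thesis using q bij dist by auto
        qed
        moreover have "{i, j, k, l, q, b q} \<subseteq> {1..n}" using ijkl dom_b[of q] dom_b[of "b q"] q(1) bb[of q] by simp
        ultimately have "shared_transposition_pair n a b" unfolding shared_transposition_pair_def using a_eq by blast
        then show ?thesis ..
      next
        case kk: False
        then have bkl: "b k = l" using bk by auto
        have "k \<notin> {i, b i}" using dist bij by auto
        then have "b = transpose i j \<circ> transpose k l"
          using even_involution_eq[OF b(1-3) n False kk] unfolding bij bkl by blast
        then have "b = a" by (rule trans[OF _ a_eq[symmetric]])
        then show ?thesis using ab(2) by simp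
      qed
    qed
  qed
qed

section \<open>Commuting permutations of odd prime order\<close>

lemma prime_inverse_mod:
  assumes "prime (p::nat)" "\<not> p dvd k"
  obtains u v where "k * u = p * v + 1"
  using bezout_prime[OF assms] by auto

lemma funpow_commute_apply:
  assumes "a \<circ> b = b \<circ> a"
  shows "(a ^^ s) ((b ^^ t) x) = (b ^^ t) ((a ^^ s) x)"
proof -
  have 1: "a ((b ^^ t) x) = (b ^^ t) (a x)" for t x
    by (induction t) (use assms in \<open>auto simp: fun_eq_iff\<close>)
  show ?thesis by (induction s) (auto simp: 1)
qed

lemma funpow_period:
  assumes "a ^^ p = id"
  shows "a ^^ (p * k + s) = a ^^ s"
proof -
  have "a ^^ (p * k) = id" using assms by (simp add: funpow_mult[symmetric])
  then show ?thesis by (simp add: funpow_add)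
qed

text \<open>Iterating the relation \<open>u\<close> times, with \<open>u\<close> inverse to
  \<open>k\<close> modulo \<open>p\<close>, reduces the power of \<open>b\<close> to
  \<open>b\<close> itself.\<close>

lemma commuting_orbit_coprime:
  assumes p: "prime (p::nat)" "b ^^ p = id" and ab: "a \<circ> b = b \<circ> a"
    and k: "\<not> p dvd k" "(b ^^ k) i = (a ^^ s) i"
  shows "\<exists>t. b i = (a ^^ t) i"
proof -
  have "(b ^^ (k * u)) i = (a ^^ (s * u)) i" for u
  proof (induction u)
    case (Suc u)
    have "(b ^^ (k * Suc u)) i = (b ^^ k) ((b ^^ (k * u)) i)" by (simp add: funpow_add)
    also have "\<dots> = (a ^^ (s * u)) ((b ^^ k) i)" unfolding Suc using funpow_commute_apply[OF ab] by metis
    also have "\<dots> = (a ^^ (s * u + s)) i" unfolding k(2) by (simp add: funpow_add)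
    finally show ?case by (simp add: add.commute)
  qed simp
  moreover obtain u v where "k * u = p * v + 1" using prime_inverse_mod[OF p(1) k(1)] .
  ultimately have "(b ^^ (p * v + 1)) i = (a ^^ (s * u)) i" by metis
  then show ?thesis unfolding funpow_period[OF p(2)] by auto
qed

lemma inj_of_funpow_id:
  assumes "a ^^ p = id" "0 < (p::nat)"
  shows "inj a"
proof -
  have "(a ^^ (p - 1)) \<circ> a = id" using assms by (metis Suc_diff_1 funpow_Suc_right)
  then show ?thesis by (metis inj_on_id inj_on_imageI2)
qed

lemma orbit_inj:
  assumes p: "prime (p::nat)" "a ^^ p = id" and i: "a i \<noteq> i"
  shows "inj_on (\<lambda>s. (a ^^ s) i) {..<p}"
proof (rule linorder_inj_onI)
  fix s t assume st: "s < t" "s \<in> {..<p}" "t \<in> {..<p}"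
  show "(a ^^ s) i \<noteq> (a ^^ t) i"
  proof
    assume eq: "(a ^^ s) i = (a ^^ t) i"
    have "(a ^^ t) i = (a ^^ s) ((a ^^ (t - s)) i)" using st(1) by (simp add: funpow_add[symmetric, THEN fun_cong, simplified])
    then have "(a ^^ (t - s)) i = i"
      using eq inj_fn[OF inj_of_funpow_id[OF p(2) prime_gt_0_nat[OF p(1)]], of s] by (metis injD)
    moreover have "\<not> p dvd t - s" using st by (auto dest: dvd_imp_le)
    ultimately have "\<exists>u. a i = (id ^^ u) i"
      \<comment> \<open>Here the identity plays the role of \<open>a\<close>: a point fixed by a
        power prime to \<open>p\<close> is fixed outright.\<close>
      using commuting_orbit_coprime[OF p, of id "t - s" i 0] by simp
    then show False using i by simp
  qed
qed auto

text \<open>A coincidence with different powers of \<open>b\<close> would put a power of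
  \<open>b\<close> prime to \<open>p\<close> at \<open>i\<close> into the \<open>a\<close>-orbit,
  and then \<open>b i\<close> too. So the orbit of \<open>i\<close> is a full grid of
  \<open>p * p\<close> points.\<close>

lemma commuting_orbits_grid_inj:
  assumes p: "prime (p::nat)" "a ^^ p = id" "b ^^ p = id" and ab: "a \<circ> b = b \<circ> a"
    and i: "a i \<noteq> i" and b: "\<nexists>s. b i = (a ^^ s) i"
  shows "inj_on (\<lambda>(s, t). (b ^^ t) ((a ^^ s) i)) ({..<p} \<times> {..<p})"
proof -
  have injb: "inj (b ^^ t)" for t by (rule inj_fn[OF inj_of_funpow_id[OF p(3) prime_gt_0_nat[OF p(1)]]])
  have *: False if "t < t'" "t' < p" "s < p" "s' < p" "(b ^^ t) ((a ^^ s) i) = (b ^^ t') ((a ^^ s') i)" for s t s' t'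
  proof -
    have "(b ^^ t') ((a ^^ s') i) = (b ^^ t) ((b ^^ (t' - t)) ((a ^^ s') i))"
      using \<open>t < t'\<close> by (simp add: funpow_add[symmetric, THEN fun_cong, simplified])
    then have "(a ^^ s) i = (b ^^ (t' - t)) ((a ^^ s') i)" using that(5) injb by (metis injD)
    also have "\<dots> = (a ^^ s') ((b ^^ (t' - t)) i)" using funpow_commute_apply[OF ab] by metis
    finally have "(a ^^ (p - s')) ((a ^^ s) i) = (a ^^ (p - s' + s')) ((b ^^ (t' - t)) i)"
      by (simp add: funpow_add)
    moreover have "(a ^^ (p - s' + s')) x = x" for x using \<open>s' < p\<close> p(2) by simp
    ultimately have "(b ^^ (t' - t)) i = (a ^^ (p - s' + s)) i" unfolding funpow_add by simp
    moreover have "\<not> p dvd t' - t" using that by (auto dest: dvd_imp_le)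
    ultimately show False using commuting_orbit_coprime[OF p(1,3) ab] b by blast
  qed
  show ?thesis
  proof (rule inj_onI, clarsimp)
    fix s t s' t' assume st: "s < p" "t < p" "s' < p" "t' < p" and eq: "(b ^^ t) ((a ^^ s) i) = (b ^^ t') ((a ^^ s') i)"
    have "t = t'" using *[of t t' s s'] *[of t' t s' s] st eq by (metis linorder_neqE_nat)
    then have "(a ^^ s) i = (a ^^ s') i" using eq injb by (metis injD)
    then have "s = s'" using orbit_inj[OF p(1,2) i] st by (auto dest: inj_onD)
    then show "s = s' \<and> t = t'" using \<open>t = t'\<close> by simp
  qed
qed

text \<open>Otherwise the orbit grid has at least nine points.\<close>

lemma commuting_same_orbit:
  fixes a b :: "nat \<Rightarrow> nat"
  assumes p: "prime (p::nat)" "3 \<le> p" and a: "a permutes {1..n}" "a ^^ p = id" and b: "b permutes {1..n}" "b ^^ p = id"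
    and ab: "a \<circ> b = b \<circ> a" and i: "a i \<noteq> i" and n: "n \<le> 7"
  shows "\<exists>s. b i = (a ^^ s) i"
proof (rule ccontr)
  assume "\<nexists>s. b i = (a ^^ s) i"
  from commuting_orbits_grid_inj[OF p(1) a(2) b(2) ab i this]
  have "card ((\<lambda>(s, t). (b ^^ t) ((a ^^ s) i)) ` ({..<p} \<times> {..<p})) = p * p"
    by (simp add: card_image card_cartesian_product)
  moreover have "i \<in> {1..n}" using permutes_not_in[OF a(1)] i by blast
  then have "(\<lambda>(s, t). (b ^^ t) ((a ^^ s) i)) ` ({..<p} \<times> {..<p}) \<subseteq> {1..n}"
    using permutes_in_image[OF permutes_funpow[OF a(1)]] permutes_in_image[OF permutes_funpow[OF b(1)]] by auto
  ultimately have "p * p \<le> n" using card_mono[of "{1..n}"] by (metis card_atLeastAtMost diff_Suc_1 finite_atLeastAtMost)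
  moreover have "3 * 3 \<le> p * p" by (rule mult_le_mono[OF p(2) p(2)])
  ultimately show False using n by simp
qed

lemma order_3_orbit:
  assumes "a ^^ 3 = id" "a x \<noteq> x"
  shows "a (a (a x)) = x" "distinct [x, a x, a (a x)]"
proof -
  show 1: "a (a (a y)) = y" for y using fun_cong[OF assms(1), of y] by (simp add: numeral_3_eq_3)
  show "distinct [x, a x, a (a x)]" using assms(2) 1 by auto metis+
qed

text \<open>The orbits of \<open>i\<close> under \<open>a\<close> and of \<open>l\<close> under
  \<open>b\<close> are disjoint and fill six points. At most one point is left, too few for another
  nontrivial orbit, so both permutations are single 3-cycles.\<close>

lemma disjoint_order_3:
  fixes a b :: "nat \<Rightarrow> nat"
  assumes a: "a permutes {1..n}" "a ^^ 3 = id" and b: "b permutes {1..n}" "b ^^ 3 = id"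
    and ab: "a \<circ> b = b \<circ> a" and n: "n \<le> 7"
    and i: "a i \<noteq> i" "b i = i" and l: "b l \<noteq> l" "a l = l"
  shows "three_cycle_pair n a b"
proof -
  have a3: "a (a (a x)) = x" for x using fun_cong[OF a(2), of x] by (simp add: numeral_3_eq_3)
  have b3: "b (b (b x)) = x" for x using fun_cong[OF b(2), of x] by (simp add: numeral_3_eq_3)
  have c: "a (b x) = b (a x)" for x using ab by (metis comp_apply)
  have fb: "b (a i) = a i" "b (a (a i)) = a (a i)" using c i(2) by metis+
  have fa: "a (b l) = b l" "a (b (b l)) = b (b l)" using c l(2) by metis+
  let ?O = "{i, a i, a (a i), l, b l, b (b l)}"
  note d = order_3_orbit(2)[OF a(2) i(1)] order_3_orbit(2)[OF b(2) l(1)]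
  have "a x \<noteq> x" if "x \<in> {i, a i, a (a i)}" for x using that d(1) a3[of i] by auto
  moreover have "a y = y" if "y \<in> {l, b l, b (b l)}" for y using that fa l(2) by auto
  ultimately have "{i, a i, a (a i)} \<inter> {l, b l, b (b l)} = {}" by blast
  then have dist: "distinct [i, a i, a (a i), l, b l, b (b l)]" using d by auto
  have dom: "x \<in> {1..n}" if "a x \<noteq> x \<or> b x \<noteq> x" for x
    using permutes_not_in[OF a(1)] permutes_not_in[OF b(1)] that by blast
  have O: "?O \<subseteq> {1..n}"
    using dom[of i] dom[of "a i"] dom[of "a (a i)"] dom[of l] dom[of "b l"] dom[of "b (b l)"] i l dist a3[of i] b3[of l]
    by auto
  have O6: "card ?O = 6" using distinct_card[OF dist] by simp
  have fixed: "f x = x" if f: "f permutes {1..n}" "f ^^ 3 = id" and stable: "\<And>y. f y \<in> ?O \<Longrightarrow> y \<in> ?O" and x: "x \<notin> ?O" for f x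
  proof (rule ccontr)
    assume fx: "f x \<noteq> x"
    note d = order_3_orbit[OF f(2) fx]
    have "f x \<notin> ?O" "f (f x) \<notin> ?O" using stable x by blast+
    moreover have "x \<in> {1..n}" using permutes_not_in[OF f(1)] fx by blast
    ultimately have "{x, f x} \<subseteq> {1..n} - ?O" using x permutes_in_image[OF f(1), of x] by auto
    moreover have "card {x, f x} = 2" using fx by simp
    moreover have "card ({1..n} - ?O) = n - 6" using O6 O by (simp add: card_Diff_subset)
    ultimately show False using n card_mono[of "{1..n} - ?O" "{x, f x}"] by simp
  qed
  have sa: "y \<in> ?O" if "a y \<in> ?O" for y
  proof -
    have "a (a z) \<in> ?O" if "z \<in> ?O" for z using that fa l(2) a3[of i] by auto
    then show ?thesis using that a3[of y] by metis
  qed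
  have sb: "y \<in> ?O" if "b y \<in> ?O" for y
  proof -
    have "b (b z) \<in> ?O" if "z \<in> ?O" for z using that fb i(2) b3[of l] by auto
    then show ?thesis using that b3[of y] by metis
  qed
  have ax: "a x = x" if "x \<notin> ?O" for x by (rule fixed[OF a sa that])
  have bx: "b x = x" if "x \<notin> ?O" for x by (rule fixed[OF b sb that])
  have "a = transpose i (a i) \<circ> transpose (a i) (a (a i))"
  proof
    fix x show "a x = (transpose i (a i) \<circ> transpose (a i) (a (a i))) x"
    proof (cases "x \<in> ?O")
      case True
      then show ?thesis using dist a3[of i] fa l(2) by auto
    next
      case False
      then show ?thesis using ax[OF False] by simp
    qed
  qed
  moreover have "b = transpose l (b l) \<circ> transpose (b l) (b (b l))"
  proof
    fix x show "b x = (transpose l (b l) \<circ> transpose (b l) (b (b l))) x"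
    proof (cases "x \<in> ?O")
      case True
      then show ?thesis using dist b3[of l] fb i(2) by auto
    next
      case False
      then show ?thesis using bx[OF False] by simp
    qed
  qed
  ultimately show ?thesis unfolding three_cycle_pair_def using O dist by blast
qed

text \<open>Multiplying \<open>b\<close> by a power of \<open>a\<close> makes it fix a point
  \<open>i\<close> moved by \<open>a\<close>; multiplying \<open>a\<close> by a power of the new
  \<open>b'\<close> makes it fix a point \<open>l\<close> moved by \<open>b'\<close>. The two orbits
  are then disjoint, so \<open>2 * p \<le> 7\<close> and \<open>p = 3\<close>. Closure of
  \<open>S\<close> keeps the replacements inside.\<close>

lemma commuting_odd_prime_order:
  fixes a b :: "nat \<Rightarrow> nat"
  assumes p: "prime (p::nat)" "3 \<le> p" and a: "a permutes {1..n}" "a ^^ p = id" "a \<noteq> id"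
    and b: "b permutes {1..n}" "b ^^ p = id" "\<And>s. b \<noteq> a ^^ s"
    and ab: "a \<circ> b = b \<circ> a" and n: "n \<le> 7"
    and S: "a \<in> S" "b \<in> S" "id \<in> S" "\<And>f g. \<lbrakk>f \<in> S; g \<in> S\<rbrakk> \<Longrightarrow> f \<circ> g \<in> S"
  shows "\<exists>s\<in>S. \<exists>t\<in>S. three_cycle_pair n s t"
proof -
  have pow_S: "f ^^ k \<in> S" if "f \<in> S" for f k
  proof (induction k)
    case (Suc k)
    then show ?case using S(4)[OF that] by (simp only: funpow.simps)
  qed (use S(3) in \<open>simp only: funpow.simps\<close>)
  have shift: "\<exists>r. f ((g ^^ r) x) = x" if "f x = (g ^^ s) x" "g ^^ p = id" "f \<circ> g = g \<circ> f" for f g :: "nat \<Rightarrow> nat" and x s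
  proof -
    \<comment> \<open>The exponent \<open>s * (p - 1)\<close> represents minus \<open>s\<close>
      modulo \<open>p\<close>.\<close>
    have "f ((g ^^ (s * (p - 1))) x) = (g ^^ (s * (p - 1))) (f x)"
      using funpow_commute_apply[OF that(3), of 1] by simp
    also have "\<dots> = (g ^^ (s * (p - 1) + s)) x" unfolding that(1) by (simp add: funpow_add)
    also have "s * (p - 1) + s = p * s + 0" using p(2) by (simp add: algebra_simps mult_eq_if)
    finally show ?thesis unfolding funpow_period[OF that(2)] by auto
  qed
  have comp_pow: "(f \<circ> g ^^ r) ^^ p = id" if "f ^^ p = id" "g ^^ p = id" "f \<circ> g = g \<circ> f" for f g :: "nat \<Rightarrow> nat" and r
  proof -
    have "((f \<circ> g ^^ r) ^^ k) x = (f ^^ k) ((g ^^ (r * k)) x)" for k x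
    proof (induction k)
      case (Suc k)
      have "((f \<circ> g ^^ r) ^^ Suc k) x = f ((g ^^ r) (((f \<circ> g ^^ r) ^^ k) x))" by (simp only: funpow.simps comp_apply)
      also have "\<dots> = f ((g ^^ r) ((f ^^ k) ((g ^^ (r * k)) x)))" unfolding Suc ..
      also have "(g ^^ r) ((f ^^ k) ((g ^^ (r * k)) x)) = (f ^^ k) ((g ^^ r) ((g ^^ (r * k)) x))"
        using funpow_commute_apply[OF that(3)] by metis
      finally show ?case by (simp add: funpow_add)
    qed simp
    then have "((f \<circ> g ^^ r) ^^ p) x = x" for x
      using that(1) funpow_period[OF that(2), of r 0] by (simp add: mult.commute)
    then show ?thesis by (simp add: fun_eq_iff)
  qed
  have comm_pow: "g \<circ> (f \<circ> g ^^ r) = (f \<circ> g ^^ r) \<circ> g" if "f \<circ> g = g \<circ> f" for f g :: "nat \<Rightarrow> nat" and r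
    using that by (metis comp_assoc funpow_Suc_right funpow.simps(2))
  obtain i where i: "a i \<noteq> i" using a(3) by (metis eq_id_iff)
  obtain s where s: "b i = (a ^^ s) i" using commuting_same_orbit[OF p a(1,2) b(1,2) ab i n] by blast
  obtain r where r: "b ((a ^^ r) i) = i" using shift[OF s a(2) ab[symmetric]] by blast
  define b' where "b' = b \<circ> a ^^ r"
  have b': "b' permutes {1..n}" "b' ^^ p = id" "b' \<in> S" "a \<circ> b' = b' \<circ> a" "b' i = i"
    unfolding b'_def using permutes_compose[OF permutes_funpow[OF a(1)] b(1)] comp_pow[OF b(2) a(2) ab[symmetric]]
      S(4)[OF S(2) pow_S[OF S(1)]] comm_pow[OF ab[symmetric]] r by auto
  have "b' \<noteq> id"
  proof
    assume "b' = id"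
    have "p * r = r + (p - 1) * r" using p(2) by (cases p) auto
    then have "a ^^ r \<circ> a ^^ ((p - 1) * r) = id"
      using funpow_period[OF a(2), of r 0] by (simp add: funpow_add[symmetric])
    then have "b = b' \<circ> a ^^ ((p - 1) * r)" unfolding b'_def by (simp add: comp_assoc)
    then show False using \<open>b' = id\<close> b(3) by simp
  qed
  then obtain l where l: "b' l \<noteq> l" by (metis eq_id_iff)
  obtain u where u: "a l = (b' ^^ u) l"
    using commuting_same_orbit[OF p b'(1,2) a(1,2) b'(4)[symmetric] l n] by blast
  obtain w where w: "a ((b' ^^ w) l) = l" using shift[OF u b'(2) b'(4)] by blast
  define a' where "a' = a \<circ> b' ^^ w"
  have bi: "(b' ^^ t) i = i" for t by (induction t) (simp_all add: b'(5))
  have a': "a' permutes {1..n}" "a' ^^ p = id" "a' \<in> S" "b' \<circ> a' = a' \<circ> b'" "a' l = l" "a' i = a i"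
    unfolding a'_def using permutes_compose[OF permutes_funpow[OF b'(1)] a(1)] comp_pow[OF a(2) b'(2) b'(4)]
      S(4)[OF S(1) pow_S[OF b'(3)]] comm_pow[OF b'(4)] w bi by auto
  have "p = 3"
  proof -
    have ai: "a' i \<noteq> i" using a'(6) i by simp
    let ?O = "(\<lambda>s. (a' ^^ s) i) ` {..<p}" and ?O' = "(\<lambda>s. (b' ^^ s) l) ` {..<p}"
    have card: "card ?O = p" "card ?O' = p"
      using orbit_inj[OF p(1) a'(2) ai] orbit_inj[OF p(1) b'(2) l] by (simp_all add: card_image)
    \<comment> \<open>\<open>b'\<close> fixes the whole \<open>a'\<close>-orbit of \<open>i\<close>,
      but no point of its own orbit of \<open>l\<close>.\<close>
    have "(a' ^^ s) i \<noteq> (b' ^^ t) l" for s t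
    proof
      assume eq: "(a' ^^ s) i = (b' ^^ t) l"
      have "b' ((a' ^^ s) i) = (a' ^^ s) i" using funpow_commute_apply[OF a'(4), of 1 s i] b'(5) by simp
      then have "(b' ^^ t) (b' l) = (b' ^^ t) l" unfolding eq by (metis funpow_swap1)
      then show False
        using l inj_fn[OF inj_of_funpow_id[OF b'(2) prime_gt_0_nat[OF p(1)]], of t] by (metis injD)
    qed
    then have "?O \<inter> ?O' = {}" by auto
    then have "card (?O \<union> ?O') = 2 * p" using card by (simp add: card_Un_disjoint)
    moreover have "i \<in> {1..n}" "l \<in> {1..n}" using permutes_not_in[OF a(1)] i permutes_not_in[OF b'(1)] l by blast+
    then have "?O \<union> ?O' \<subseteq> {1..n}"
      using permutes_in_image[OF permutes_funpow[OF a'(1)]] permutes_in_image[OF permutes_funpow[OF b'(1)]] by auto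
    ultimately have "2 * p \<le> n" using card_mono[of "{1..n}" "?O \<union> ?O'"] by simp
    then show ?thesis using n p(2) by simp
  qed
  then have "three_cycle_pair n a' b'"
    using disjoint_order_3[of a' n b' i l] a' b' l i n by simp
  then show ?thesis using a'(3) b'(3) by blast
qed

section \<open>The edge sets\<close>

lemma (in central_extension) commute_if_conjugate_inverse:
  assumes x: "x \<in> carrier H" and y: "y \<in> carrier H" and g: "g \<in> carrier H"
    and comm: "\<pi> x \<otimes>\<^bsub>G\<^esub> \<pi> y = \<pi> y \<otimes>\<^bsub>G\<^esub> \<pi> x"
    and gx: "\<pi> g \<otimes>\<^bsub>G\<^esub> \<pi> x = inv\<^bsub>G\<^esub> \<pi> x \<otimes>\<^bsub>G\<^esub> \<pi> g" and gy: "\<pi> g \<otimes>\<^bsub>G\<^esub> \<pi> y = \<pi> y \<otimes>\<^bsub>G\<^esub> \<pi> g"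
    and x3: "\<pi> x \<otimes>\<^bsub>G\<^esub> \<pi> x \<otimes>\<^bsub>G\<^esub> \<pi> x = \<one>\<^bsub>G\<^esub>"
  shows "x \<otimes> y = y \<otimes> x"
proof -
  obtain c where c: "c \<in> kernel H G \<pi>" "c \<in> carrier H" "x \<otimes> y = y \<otimes> x \<otimes> c"
    using fibre[of "x \<otimes> y" "y \<otimes> x"] x y comm by auto
  obtain w where w: "w \<in> kernel H G \<pi>" "w \<in> carrier H" "g \<otimes> x = inv x \<otimes> g \<otimes> w"
    using fibre[of "g \<otimes> x" "inv x \<otimes> g"] x g gx by auto
  obtain z where z: "z \<in> kernel H G \<pi>" "z \<in> carrier H" "g \<otimes> y = y \<otimes> g \<otimes> z"
    using fibre[of "g \<otimes> y" "y \<otimes> g"] y g gy by auto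
  let ?x = "inv x"
  have xH: "?x \<in> carrier H" using x by simp
  \<comment> \<open>Moving \<open>g\<close> through either product of \<open>x\<close> and
    \<open>y\<close> replaces \<open>x\<close> by its inverse and creates the same central factor
    \<open>z \<otimes> w\<close>, which therefore cancels in the comparison.\<close>
  have 1: "g \<otimes> (x \<otimes> y) = ?x \<otimes> y \<otimes> (g \<otimes> z \<otimes> w)"
  proof -
    have "g \<otimes> (x \<otimes> y) = ?x \<otimes> g \<otimes> (w \<otimes> y)"
      using w(3)[THEN arg_cong[where f = "\<lambda>t. t \<otimes> y"]] x y g w(2) by (simp add: G.m_assoc)
    also have "w \<otimes> y = y \<otimes> w" by (rule central[OF w(1) y])
    also have "?x \<otimes> g \<otimes> (y \<otimes> w) = ?x \<otimes> (g \<otimes> y) \<otimes> w" using x y g w(2) by (simp add: G.m_assoc)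
    finally show ?thesis unfolding z(3) using x y g w(2) z(2) by (simp add: G.m_assoc)
  qed
  have 2: "g \<otimes> (y \<otimes> x) = y \<otimes> ?x \<otimes> (g \<otimes> z \<otimes> w)"
  proof -
    have "g \<otimes> (y \<otimes> x) = y \<otimes> g \<otimes> (z \<otimes> x)"
      using z(3)[THEN arg_cong[where f = "\<lambda>t. t \<otimes> x"]] x y g z(2) by (simp add: G.m_assoc)
    also have "z \<otimes> x = x \<otimes> z" by (rule central[OF z(1) x])
    also have "y \<otimes> g \<otimes> (x \<otimes> z) = y \<otimes> (g \<otimes> x) \<otimes> z" using x y g z(2) by (simp add: G.m_assoc)
    also have "\<dots> = y \<otimes> ?x \<otimes> g \<otimes> (w \<otimes> z)" unfolding w(3) using x y g w(2) z(2) by (simp add: G.m_assoc)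
    also have "w \<otimes> z = z \<otimes> w" by (rule central[OF w(1) z(2)])
    finally show ?thesis using x y g w(2) z(2) by (simp add: G.m_assoc)
  qed
  let ?e = "g \<otimes> z \<otimes> w"
  have e: "?e \<in> carrier H" using g z(2) w(2) by simp
  \<comment> \<open>The commutator of \<open>inv x\<close> with \<open>y\<close> turns out to be the
    same \<open>c\<close> as for \<open>x\<close>. Rewriting this for \<open>x\<close> yields
    relation 4, in which \<open>c\<close> appears on the other side.\<close>
  have "?x \<otimes> y \<otimes> ?e = g \<otimes> (y \<otimes> x) \<otimes> c"
    unfolding 1[symmetric] c(3) using x y g c(2) by (simp add: G.m_assoc)
  also have "\<dots> = y \<otimes> ?x \<otimes> (?e \<otimes> c)" unfolding 2 using x y e c(2) by (simp add: G.m_assoc)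
  also have "?e \<otimes> c = c \<otimes> ?e" using central[OF c(1) e] ..
  also have "y \<otimes> ?x \<otimes> (c \<otimes> ?e) = y \<otimes> ?x \<otimes> c \<otimes> ?e" using x y e c(2) by (simp add: G.m_assoc)
  finally have 3: "?x \<otimes> y = y \<otimes> ?x \<otimes> c" using x y e c(2) by simp
  have "y \<otimes> x = x \<otimes> (?x \<otimes> y) \<otimes> x" using x y by (simp add: G.m_assoc[symmetric])
  also have "\<dots> = x \<otimes> y \<otimes> ?x \<otimes> (c \<otimes> x)" unfolding 3 using x y c(2) by (simp add: G.m_assoc)
  also have "c \<otimes> x = x \<otimes> c" by (rule central[OF c(1) x])
  also have "x \<otimes> y \<otimes> ?x \<otimes> (x \<otimes> c) = x \<otimes> y \<otimes> (?x \<otimes> x) \<otimes> c"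
    using x y c(2) by (simp only: G.m_assoc G.m_closed xH)
  also have "\<dots> = x \<otimes> y \<otimes> c" using x y by simp
  finally have 4: "y \<otimes> x = x \<otimes> y \<otimes> c" .
  \<comment> \<open>Since \<open>c\<close> is its own inverse, the square of \<open>x\<close>
    commutes with \<open>y\<close>; the cube does because it lies in the central kernel. Hence
    \<open>x\<close> does.\<close>
  have "x \<otimes> (x \<otimes> y) = x \<otimes> (y \<otimes> x \<otimes> c)" by (rule arg_cong[OF c(3)])
  also have "\<dots> = (x \<otimes> y) \<otimes> (x \<otimes> c)" using x y c(2) by (simp add: G.m_assoc)
  also have "x \<otimes> c = c \<otimes> x" using central[OF c(1) x] ..
  also have "(x \<otimes> y) \<otimes> (c \<otimes> x) = (x \<otimes> y \<otimes> c) \<otimes> x" using x y c(2) by (simp add: G.m_assoc)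
  finally have 5: "x \<otimes> (x \<otimes> y) = y \<otimes> x \<otimes> x" unfolding 4[symmetric] .
  have "x \<otimes> x \<otimes> x \<in> kernel H G \<pi>" using x x3 by (simp add: kernel_def)
  then have "x \<otimes> x \<otimes> x \<otimes> y = y \<otimes> (x \<otimes> x \<otimes> x)" by (rule central[OF _ y])
  then have "x \<otimes> (x \<otimes> (x \<otimes> y)) = y \<otimes> x \<otimes> x \<otimes> x" using x y by (simp add: G.m_assoc)
  then have "(x \<otimes> y) \<otimes> (x \<otimes> x) = (y \<otimes> x) \<otimes> (x \<otimes> x)" unfolding 5 using x y by (simp add: G.m_assoc)
  then show ?thesis using x y by simp
qed

section \<open>Comparison of the three edge sets\<close>

lemma doubleton_in_commuting_edges:
  "{x, y} \<in> commuting_edges G \<longleftrightarrow> x \<in> carrier G \<and> y \<in> carrier G \<and> x \<noteq> y \<and> x \<otimes>\<^bsub>G\<^esub> y = y \<otimes>\<^bsub>G\<^esub> x"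
  unfolding commuting_edges_def by (rule doubleton_mem_iff) metis

lemma doubleton_in_enhanced_power_edges:
  "{x, y} \<in> enhanced_power_edges G \<longleftrightarrow> x \<in> carrier G \<and> y \<in> carrier G \<and> x \<noteq> y \<and>
     cyclic_group (subgroup_generated G {x, y})"
  unfolding enhanced_power_edges_def by (rule doubleton_mem_iff) (metis insert_commute)

text \<open>Existence of a Schur cover is essential here: deep commutation quantifies over all
  covers and would otherwise hold vacuously.\<close>

lemma deep_subset_commuting:
  assumes G: "group G" and fin: "finite (carrier G)"
  shows "deep_commuting_edges G \<subseteq> commuting_edges G"
proof
  fix e assume e: "e \<in> deep_commuting_edges G"
  then obtain x y where xy: "e = {x, y}" unfolding deep_commuting_edges_def by auto
  note deep = e[unfolded xy doubleton_in_deep_commuting_edges]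
  obtain H \<pi> where H: "schur_cover G H \<pi>" using schur_cover_exists[OF G fin] by blast
  interpret central_extension H G \<pi>
    using stem_extension_central[OF G] H unfolding schur_cover_def by blast
  obtain x' y' where l: "x' \<in> carrier H" "\<pi> x' = x" "y' \<in> carrier H" "\<pi> y' = y"
    using surj deep by (metis imageE)
  then have "x' \<otimes>\<^bsub>H\<^esub> y' = y' \<otimes>\<^bsub>H\<^esub> x'" using deep H by blast
  then have "x \<otimes>\<^bsub>G\<^esub> y = y \<otimes>\<^bsub>G\<^esub> x" using l by (metis hom_mult)
  then show "e \<in> commuting_edges G" unfolding xy doubleton_in_commuting_edges using deep by blast
qed

lemma generate_commute_of_deep:
  assumes G: "group G" and fin: "finite (carrier G)" and deep: "{x, y} \<in> deep_commuting_edges G"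
    and ab: "a \<in> generate G {x, y}" "b \<in> generate G {x, y}"
  shows "a \<otimes>\<^bsub>G\<^esub> b = b \<otimes>\<^bsub>G\<^esub> a"
proof (cases "a = b")
  case False
  then have "{a, b} \<in> commuting_edges G"
    using deep_commuting_edges_generate[OF G deep ab] deep_subset_commuting[OF G fin] by blast
  then show ?thesis unfolding doubleton_in_commuting_edges by blast
qed simp

lemma alt_group_pow: "x [^]\<^bsub>alt_group n\<^esub> (k::nat) = x ^^ k"
proof -
  interpret group "alt_group n" by (rule alt_group_is_group)
  show ?thesis
  proof (induction k)
    case (Suc k)
    then show ?case by (simp only: nat_pow_Suc alt_group_mult funpow_Suc_right)
  qed (simp add: alt_group_one)
qed

text \<open>All distinct pairs in the subgroup generated by a deep edge are deep edges. Were it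
  noncyclic, it would contain one of the three forbidden pairs.\<close>

lemma deep_imp_enhanced_power:
  assumes n: "4 \<le> n" "n \<le> 7"
  shows "deep_commuting_edges (alt_group n) \<subseteq> enhanced_power_edges (alt_group n)"
proof
  let ?G = "alt_group n"
  interpret group ?G by (rule alt_group_is_group)
  fix e assume e: "e \<in> deep_commuting_edges ?G"
  then obtain x y where xy: "e = {x, y}" unfolding deep_commuting_edges_def by auto
  have deep: "{x, y} \<in> deep_commuting_edges ?G" using e xy by simp
  then have xyG: "x \<in> carrier ?G" "y \<in> carrier ?G" "x \<noteq> y" unfolding doubleton_in_deep_commuting_edges by auto
  define S where "S = generate ?G {x, y}"
  let ?B = "subgroup_generated ?G {x, y}"
  have carB: "carrier ?B = S" using xyG by (simp add: carrier_subgroup_generated S_def)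
  have SG: "S \<subseteq> carrier ?G" unfolding S_def using xyG by (intro generate_incl) auto
  have S_deep: "{s, t} \<in> deep_commuting_edges ?G" if "s \<in> S" "t \<in> S" "s \<noteq> t" for s t
    using deep_commuting_edges_generate[OF alt_group_is_group deep] that unfolding S_def by blast
  have S_comm: "s \<circ> t = t \<circ> s" if "s \<in> S" "t \<in> S" for s t
    using generate_commute_of_deep[OF alt_group_is_group finite_alt_group deep] that unfolding S_def alt_group_mult by blast
  have S_id: "id \<in> S" unfolding S_def using generate.one[of ?G] by (simp add: alt_group_one)
  have S_comp: "s \<circ> t \<in> S" if "s \<in> S" "t \<in> S" for s t
    using generate.eng[of s ?G "{x, y}" t] that unfolding S_def alt_group_mult by blast
  have "cyclic_group ?B"
  proof (rule ccontr)
    assume nc: "\<not> cyclic_group ?B"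
    have "comm_group ?B"
      by (rule group.group_comm_groupI[OF group_subgroup_generated])
        (use S_comm in \<open>simp only: carB mult_subgroup_generated alt_group_mult\<close>)
    then interpret B: comm_group ?B .
    have finB: "finite (carrier ?B)" unfolding carB using finite_subset[OF SG finite_alt_group] .
    obtain p a b where p: "prime (p::nat)" and a: "a \<in> carrier ?B" "a [^]\<^bsub>?B\<^esub> p = \<one>\<^bsub>?B\<^esub>" "a \<noteq> \<one>\<^bsub>?B\<^esub>"
      and b: "b \<in> carrier ?B" "b [^]\<^bsub>?B\<^esub> p = \<one>\<^bsub>?B\<^esub>" "b \<notin> generate ?B {a}"
      using B.noncyclic_prime_rank_2[OF finB nc] by metis
    have pow: "f [^]\<^bsub>?B\<^esub> k = f ^^ k" for f and k :: nat
      by (simp only: pow_subgroup_generated alt_group_pow)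
    have aS: "a \<in> S" "a ^^ p = id" "a \<noteq> id" and bS: "b \<in> S" "b ^^ p = id"
      using a b unfolding pow carB one_subgroup_generated alt_group_one by auto
    have b_pow: "b \<noteq> a ^^ s" for s
    proof
      assume "b = a ^^ s"
      then have "b = a [^]\<^bsub>?B\<^esub> (int s)" by (simp only: int_pow_int pow)
      then show False using b(3) B.generate_pow[OF a(1)] by blast
    qed
    have ab: "a \<circ> b = b \<circ> a" by (rule S_comm[OF aS(1) bS(1)])
    have a_alt: "a permutes {1..n}" "evenperm a" and b_alt: "b permutes {1..n}" "evenperm b"
      using SG aS bS alt_group_carrier by blast+
    show False
    proof (cases "p = 2")
      case True
      have "a \<circ> a = id" "b \<circ> b = id" using aS(2) bS(2) True by (simp_all add: numeral_2_eq_2)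
      moreover have ne: "b \<noteq> id" "a \<noteq> b" using b_pow[of 0] b_pow[of 1] by auto
      ultimately have "klein_pair n a b \<or> shared_transposition_pair n a b"
        using commuting_involutions[of a n b] a_alt b_alt aS(3) ab n(2) by blast
      moreover have deep_ab: "{a, b} \<in> deep_commuting_edges ?G" by (rule S_deep[OF aS(1) bS(1) ne(2)])
      moreover have "\<not> klein_pair n a b"
      proof
        assume "klein_pair n a b"
        then obtain i j k l where ijkl: "{i, j, k, l} \<subseteq> {1..n}" "distinct [i, j, k, l]"
          "a = transpose i j \<circ> transpose k l" "b = transpose i k \<circ> transpose j l"
          unfolding klein_pair_def by blast
        show False
        \<comment> \<open>The argument through the double cover requires a perfect group, so degree
          4 is separate.\<close>
        proof (cases "n = 4")
          case True
          then show False using klein_not_deep_4[of i j k l] ijkl(1,2) deep_ab unfolding ijkl(3,4) True by blast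
        next
          case False
          then have "5 \<le> n" using n by simp
          then show False using klein_not_deep[OF _ ijkl(1,2)] deep_ab unfolding ijkl(3,4) by blast
        qed
      qed
      moreover have "\<not> shared_transposition_pair n a b"
      proof
        assume "shared_transposition_pair n a b"
        then obtain i j k l m q where d: "{i, j, k, l, m, q} \<subseteq> {1..n}" "distinct [i, j, k, l, m, q]"
          "a = transpose i j \<circ> transpose k l" "b = transpose i j \<circ> transpose m q"
          unfolding shared_transposition_pair_def by blast
        have "card {i, j, k, l, m, q} = 6" using distinct_card[OF d(2)] by simp
        then have "5 \<le> n" using card_mono[OF _ d(1)] by simp
        then show False using double_transposition_not_deep[OF _ d(1,2)] deep_ab unfolding d(3,4) by blast
      qed
      ultimately show False by blast
    next
      case False
      then have "3 \<le> p" using prime_ge_2_nat[OF p] by simp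
      have "\<exists>s\<in>S. \<exists>t\<in>S. three_cycle_pair n s t"
        by (rule commuting_odd_prime_order[OF p \<open>3 \<le> p\<close> a_alt(1) aS(2,3) b_alt(1) bS(2) b_pow ab n(2) aS(1) bS(1) S_id S_comp])
      then obtain s t where st: "s \<in> S" "t \<in> S" and pair: "three_cycle_pair n s t" by blast
      from pair obtain i j k l m q where d: "{i, j, k, l, m, q} \<subseteq> {1..n}" "distinct [i, j, k, l, m, q]"
          "s = transpose i j \<circ> transpose j k" "t = transpose l m \<circ> transpose m q"
        unfolding three_cycle_pair_def by blast
      have "s i = j" "t i = i" using d(2) unfolding d(3,4) by (auto simp: transpose_def)
      then have "s \<noteq> t" using d(2) by auto
      then have "{s, t} \<in> deep_commuting_edges ?G" by (rule S_deep[OF st])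
      moreover have "card {i, j, k, l, m, q} = 6" using distinct_card[OF d(2)] by simp
      then have "5 \<le> n" using card_mono[OF _ d(1)] by simp
      ultimately show False using three_cycles_not_deep[OF _ n(2) d(1,2)] unfolding d(3,4) by blast
    qed
  qed
  then show "e \<in> enhanced_power_edges ?G" unfolding xy doubleton_in_enhanced_power_edges using xyG by blast
qed

lemma deep_proper_subset_commuting:
  assumes n: "4 \<le> n"
  shows "deep_commuting_edges (alt_group n) \<subset> commuting_edges (alt_group n)"
proof -
  let ?s = "transpose 1 2 \<circ> transpose 3 (4::nat)" and ?t = "transpose 1 3 \<circ> transpose 2 (4::nat)"
  have sub: "{1, 2, 3, 4} \<subseteq> {1..n}" and dist: "distinct [1, 2, 3, 4::nat]" using n by auto
  have "{?s, ?t} \<notin> deep_commuting_edges (alt_group n)"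
  proof (cases "n = 4")
    case True
    then show ?thesis using klein_not_deep_4[of 1 2 3 4] by simp
  next
    case False
    then show ?thesis using klein_not_deep[OF _ sub dist] n by simp
  qed
  moreover have "{?s, ?t} \<in> commuting_edges (alt_group n)"
    unfolding doubleton_in_commuting_edges alt_group_mult
  proof (intro conjI)
    show "?s \<in> carrier (alt_group n)" "?t \<in> carrier (alt_group n)"
      by (rule transpositions_in_alt_group; use n in simp)+
    have "?s 1 = 2" "?t 1 = 3" "(2::nat) \<noteq> 3" by simp_all
    then show "?s \<noteq> ?t" by metis
    show "?s \<circ> ?t = ?t \<circ> ?s" by (rule klein_commute[OF dist])
  qed
  ultimately show ?thesis
    using deep_subset_commuting[OF alt_group_is_group finite_alt_group, of n] by blast
qed

lemma enhanced_power_proper_subset_deep: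
  assumes n: "8 \<le> n"
  shows "enhanced_power_edges (alt_group n) \<subset> deep_commuting_edges (alt_group n)"
proof -
  let ?G = "alt_group n"
  interpret group ?G by (rule alt_group_is_group)
  \<comment> \<open>\<open>(1 2)\<close> by itself inverts \<open>x\<close> and centralises
    \<open>y\<close>, but it is odd. Making it even without touching either 3-cycle takes the two
    further points 7 and 8, hence \<open>8 \<le> n\<close>.\<close>
  define x y g :: "nat \<Rightarrow> nat" where "x = transpose 1 2 \<circ> transpose 2 3" and "y = transpose 4 5 \<circ> transpose 5 6"
    and "g = transpose 1 2 \<circ> transpose 7 8"
  have G: "x \<in> carrier ?G" "y \<in> carrier ?G" "g \<in> carrier ?G"
    unfolding x_def y_def g_def by (rule transpositions_in_alt_group; use n in simp)+
  have x_app: "x k = (if k = 1 then 2 else if k = 2 then 3 else if k = 3 then 1 else k)" for k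
    by (simp add: x_def transpose_def)
  have y_app: "y k = (if k = 4 then 5 else if k = 5 then 6 else if k = 6 then 4 else k)" for k
    by (simp add: y_def transpose_def)
  have g_app: "g k = (if k = 1 then 2 else if k = 2 then 1 else if k = 7 then 8 else if k = 8 then 7 else k)" for k
    by (simp add: g_def transpose_def)
  have xy: "x \<circ> y = y \<circ> x" and gy: "g \<circ> y = y \<circ> g" and x3: "x \<circ> x \<circ> x = id" and y3: "y \<circ> y \<circ> y = id"
    and gx: "x \<circ> (g \<circ> x) = g"
    by (rule ext; simp add: x_app y_app g_app)+
  have "x 4 = 4" "y 4 = 5" "x 1 = 2" by (simp_all add: x_app y_app)
  moreover have "(4::nat) \<noteq> 5" "(1::nat) \<noteq> 2" by simp_all
  ultimately have ne: "x \<noteq> y" "x \<noteq> id" "y \<noteq> id" "y \<noteq> x \<circ> x" by (metis comp_apply id_apply)+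
  have gx': "g \<circ> x = inv\<^bsub>?G\<^esub> x \<circ> g"
  proof -
    have "g \<circ> x = inv\<^bsub>?G\<^esub> x \<otimes>\<^bsub>?G\<^esub> (x \<otimes>\<^bsub>?G\<^esub> (g \<otimes>\<^bsub>?G\<^esub> x))"
      using G by (simp add: m_assoc[symmetric]) (simp add: alt_group_mult)
    then show ?thesis unfolding alt_group_mult gx .
  qed
  have "{x, y} \<in> deep_commuting_edges ?G"
    unfolding doubleton_in_deep_commuting_edges
  proof (intro conjI allI impI ballI)
    fix H \<pi> x' y' assume H: "schur_cover ?G H \<pi>" and x': "x' \<in> carrier H" "\<pi> x' = x" and y': "y' \<in> carrier H" "\<pi> y' = y"
    interpret E: central_extension H ?G \<pi>
      using stem_extension_central[OF alt_group_is_group] H unfolding schur_cover_def by blast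
    obtain g' where g': "g' \<in> carrier H" "\<pi> g' = g" using E.surj G(3) by (metis imageE)
    show "x' \<otimes>\<^bsub>H\<^esub> y' = y' \<otimes>\<^bsub>H\<^esub> x'"
      by (rule E.commute_if_conjugate_inverse[OF x'(1) y'(1) g'(1)])
        (unfold x'(2) y'(2) g'(2) alt_group_mult alt_group_one, (rule xy | rule gx' | rule gy | rule x3)+)
  qed (use G ne in auto)
  note deep = this
  have "{x, y} \<notin> enhanced_power_edges ?G"
  proof
    assume "{x, y} \<in> enhanced_power_edges ?G"
    then have "cyclic_group (subgroup_generated ?G {x, y})" unfolding doubleton_in_enhanced_power_edges by blast
    then obtain h where h: "h \<in> carrier ?G" "generate ?G {x, y} = generate ?G {h}"
      using cyclic_subgroup_generatedE[OF _ G(1,2)] by blast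
    \<comment> \<open>The generated group has exponent 3. If it were cyclic it would have at most
      three elements, and \<open>y\<close> would be \<open>x\<close> or its square.\<close>
    have cube: "a \<circ> a \<circ> a = id" if "a \<in> generate ?G {x, y}" for a
      using that
    proof (induction rule: generate.induct)
      case (inv h)
      then have hhh: "h \<circ> h \<circ> h = id" using x3 y3 by auto
      have "inv\<^bsub>?G\<^esub> h = h \<circ> h"
        by (rule inv_equality[of "h \<circ> h" h, unfolded alt_group_mult alt_group_one])
          (use hhh inv G m_closed[of h h] in \<open>auto simp: alt_group_mult\<close>)
      then show ?case using hhh by (metis comp_assoc id_comp)
    next
      case (eng a b)
      have ab: "a \<circ> b = b \<circ> a"
        using generate_commute_of_deep[OF alt_group_is_group finite_alt_group deep eng(1,2)] unfolding alt_group_mult .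
      have "(a \<circ> b) \<circ> (a \<circ> b) \<circ> (a \<circ> b) = (a \<circ> a \<circ> a) \<circ> (b \<circ> b \<circ> b)"
        using ab by (metis comp_assoc)
      then show ?case unfolding eng.IH alt_group_mult by (simp only: id_comp)
    next
      case one
      show ?case by (simp only: alt_group_one id_comp)
    next
      case (incl h)
      then show ?case using x3 y3 by blast
    qed
    have hhh: "h \<otimes>\<^bsub>?G\<^esub> (h \<otimes>\<^bsub>?G\<^esub> h) = \<one>\<^bsub>?G\<^esub>"
    proof -
      have "h \<in> generate ?G {x, y}" unfolding h(2) by (rule generate.incl) simp
      from cube[OF this] show ?thesis unfolding alt_group_mult alt_group_one by (simp only: comp_assoc)
    qed
    note h(2)
    also have "generate ?G {h} \<subseteq> {\<one>\<^bsub>?G\<^esub>, h, h \<otimes>\<^bsub>?G\<^esub> h}"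
      by (rule generate_subgroup_incl[OF _ order_3_subgroup[OF h(1) hhh]]) simp
    finally have "x \<in> {id, h, h \<circ> h}" "y \<in> {id, h, h \<circ> h}"
      using generate.incl[of _ "{x, y}" ?G] unfolding alt_group_mult alt_group_one by blast+
    moreover have "h \<circ> (h \<circ> h) = id" using hhh unfolding alt_group_mult alt_group_one .
    ultimately have "y = x \<or> y = x \<circ> x"
      using ne(2,3) by (metis comp_assoc comp_id empty_iff id_comp insert_iff)
    then show False using ne by auto
  qed
  then show ?thesis using deep enhanced_power_subset_deep[OF alt_group_is_group, of n] by blast
qed

theorem theorem5p22:
  fixes n :: nat
  assumes "n \<ge> 4"
  shows "(n \<le> 7 \<longrightarrow>
            enhanced_power_edges (alt_group n) = deep_commuting_edges (alt_group n) \<and>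
            deep_commuting_edges (alt_group n) \<subset> commuting_edges (alt_group n))
       \<and> (n \<ge> 8 \<longrightarrow>
            enhanced_power_edges (alt_group n) \<subset> deep_commuting_edges (alt_group n) \<and>
            deep_commuting_edges (alt_group n) \<subset> commuting_edges (alt_group n))"
  using assms deep_imp_enhanced_power[of n] enhanced_power_subset_deep[OF alt_group_is_group, of n]
    deep_proper_subset_commuting[of n] enhanced_power_proper_subset_deep[of n]
  by blast

end
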